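(* For every $n\ge 2$, let $$\lambda_n = 1-\sum_{i=2}^{n}\left(\frac{-1}{n}\right)^{i-1}\frac{i}{i-1}\binom{n-1}{i-1},\qquad \gamma_n=\left(\frac{n}{n-1}\right)^{n-1}-1 .$$ Then for every $n\ge 2$: (1) there is a truthful (randomized) digital goods auction for $n$ bidders with competitive ratio $\lambda_n$ with respect to the benchmark $\mathcal{F}^{(2)}$, and this is optimal, i.e. no truthful auction for $n$ bidders has a competitive ratio smaller than $\lambda_n$ with respect to $\mathcal{F}^{(2)}$; (2) there is a truthful (randomized) digital goods auction for $n$ bidders with competitive ratio $\gamma_n$ with respect to the benchmark $\mathrm{maxV}$, and this is optimal, i.e. no truthful auction for $n$ bidders has a competitive ratio smaller than $\gamma_n$ with respect to $\mathrm{maxV}$.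
   Context: Digital goods auction: an auctioneer sells identical items in unlimited supply to $n$ bidders; bidder $i$ wants one unit and has a private value $v_i\in[1,\infty)$. Each bidder submits a sealed bid; the auctioneer decides who receives an item and what each winner pays (non-winners pay $0$). The revenue is the total payment. An auction is truthful if bidding one's true value is a dominant strategy for every bidder; a randomized auction is (universally) truthful if it is a probability distribution over deterministic truthful auctions. Truthful auctions are identified with bid-independent ones: a deterministic truthful auction is given by functions $g_1,\dots,g_n$, where bidder $i$ is offered the threshold price $p_i=g_i(v_{-i})\in[0,\infty]$ depending only on the bids $v_{-i}$ of the other bidders; bidder $i$ wins and pays $p_i$ if $v_i\ge p_i$, and otherwise loses and pays $0$. In a randomized truthful auction the functions $g_i$ may additionally depend on random coins independent of the bids, and all prices are assumed to be jointly (Lebesgue) measurable functions of bids and coins. $\mathbf{E}[\mathcal{A}(v)]$ denotes the expected revenue of auction $\mathcal{A}$ on bid vector $v$. The auction $\mathcal{A}$ has competitive ratio $\lambda$ with respect to a benchmark $f:[1,\infty)^n\to\mathbb{R}$ if $f(v)\le\lambda\cdot\mathbf{E}[\mathcal{A}(v)]$ for every $v\in[1,\infty)^n$. Benchmarks: for $b=(b_1,\dots,b_n)$, let $b_{(1)}\ge b_{(2)}\ge\cdots\ge b_{(n)}$ be the bids in non-increasing order. Then $\mathcal{F}^{(2)}(b)=\max_{2\le k\le n} k\cdot b_{(k)}$ and $\mathrm{maxV}(b)=\max_{1\le k<n} k\cdot b_{(k+1)}$. *)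

theory Defs
  imports "HOL-Analysis.Analysis" "HOL-Probability.Probability"
begin

definition bid_vectors :: "nat \<Rightarrow> (nat \<Rightarrow> real) set" where
  "bid_vectors n = {1..n} \<rightarrow>\<^sub>E {1..}"

definition others :: "nat \<Rightarrow> nat \<Rightarrow> (nat \<Rightarrow> real) \<Rightarrow> nat \<Rightarrow> real" where
  "others n i v = restrict v ({1..n} - {i})"

definition others_measure :: "nat \<Rightarrow> nat \<Rightarrow> (nat \<Rightarrow> real) measure" where
  "others_measure n i = Pi\<^sub>M ({1..n} - {i}) (\<lambda>_. restrict_space lborel {1..})"

text \<open>
  A randomized auction consists of a probability space \<open>M\<close> of coins and price functions:
  \<open>g i \<omega> w\<close> is the threshold price in $[0,\infty]$ offered to bidder \<open>i\<close> when the coins are \<open>\<omega>\<close>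
  and the other bidders bid \<open>w\<close>. For each outcome \<open>\<omega>\<close> this is a deterministic bid-independent
  auction, and truthful auctions are identified with bid-independent ones.
  Taking the completion of the product of \<open>M\<close> with Lebesgue measure
  expresses joint Lebesgue (and not merely Borel) measurability of the prices. Since such
  a function may have non-measurable sections over a null set, it is required separately that
  the price is a random variable for each bid vector, so that the expected revenue is
  defined everywhere.
\<close>

definition truthful_auction ::
    "nat \<Rightarrow> 'c measure \<Rightarrow> (nat \<Rightarrow> 'c \<Rightarrow> (nat \<Rightarrow> real) \<Rightarrow> ennreal) \<Rightarrow> bool" where
  "truthful_auction n M g \<longleftrightarrow>
     prob_space M \<and>
     (\<forall>i\<in>{1..n}.
        (\<lambda>(\<omega>, w). g i \<omega> w) \<in> borel_measurable (completion (M \<Otimes>\<^sub>M others_measure n i)) \<and>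
        (\<forall>v\<in>bid_vectors n. (\<lambda>\<omega>. g i \<omega> (others n i v)) \<in> borel_measurable M))"

definition wins ::
    "nat \<Rightarrow> (nat \<Rightarrow> 'c \<Rightarrow> (nat \<Rightarrow> real) \<Rightarrow> ennreal) \<Rightarrow> 'c \<Rightarrow> (nat \<Rightarrow> real) \<Rightarrow> nat \<Rightarrow> bool" where
  "wins n g \<omega> v i \<longleftrightarrow> g i \<omega> (others n i v) \<le> ennreal (v i)"

definition payment ::
    "nat \<Rightarrow> (nat \<Rightarrow> 'c \<Rightarrow> (nat \<Rightarrow> real) \<Rightarrow> ennreal) \<Rightarrow> 'c \<Rightarrow> (nat \<Rightarrow> real) \<Rightarrow> nat \<Rightarrow> real" where
  "payment n g \<omega> v i = (if wins n g \<omega> v i then enn2real (g i \<omega> (others n i v)) else 0)"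

definition revenue ::
    "nat \<Rightarrow> (nat \<Rightarrow> 'c \<Rightarrow> (nat \<Rightarrow> real) \<Rightarrow> ennreal) \<Rightarrow> 'c \<Rightarrow> (nat \<Rightarrow> real) \<Rightarrow> real" where
  "revenue n g \<omega> v = (\<Sum>i=1..n. payment n g \<omega> v i)"

definition expected_revenue ::
    "nat \<Rightarrow> 'c measure \<Rightarrow> (nat \<Rightarrow> 'c \<Rightarrow> (nat \<Rightarrow> real) \<Rightarrow> ennreal) \<Rightarrow> (nat \<Rightarrow> real) \<Rightarrow> real" where
  "expected_revenue n M g v = (\<integral>\<omega>. revenue n g \<omega> v \<partial>M)"

definition has_competitive_ratio ::
    "nat \<Rightarrow> 'c measure \<Rightarrow> (nat \<Rightarrow> 'c \<Rightarrow> (nat \<Rightarrow> real) \<Rightarrow> ennreal) \<Rightarrow>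
     ((nat \<Rightarrow> real) \<Rightarrow> real) \<Rightarrow> real \<Rightarrow> bool" where
  "has_competitive_ratio n M g f r \<longleftrightarrow>
     (\<forall>v\<in>bid_vectors n. f v \<le> r * expected_revenue n M g v)"

text \<open>The \<open>k\<close>-th largest bid, for \<open>k\<close> between 1 and \<open>n\<close>, counted with multiplicity.\<close>

definition ordered_bid :: "nat \<Rightarrow> (nat \<Rightarrow> real) \<Rightarrow> nat \<Rightarrow> real" where
  "ordered_bid n b k = rev (sort (map b [1..<Suc n])) ! (k - 1)"

definition benchmark_F2 :: "nat \<Rightarrow> (nat \<Rightarrow> real) \<Rightarrow> real" where
  "benchmark_F2 n b = Max ((\<lambda>k. real k * ordered_bid n b k) ` {2..n})"

definition benchmark_maxV :: "nat \<Rightarrow> (nat \<Rightarrow> real) \<Rightarrow> real" where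
  "benchmark_maxV n b = Max ((\<lambda>k. real k * ordered_bid n b (k + 1)) ` {1..<n})"

definition lambda_ratio :: "nat \<Rightarrow> real" where
  "lambda_ratio n =
     1 - (\<Sum>i=2..n. (- 1 / real n) ^ (i - 1) * (real i / (real i - 1)) *
                   real ((n - 1) choose (i - 1)))"

definition gamma_ratio :: "nat \<Rightarrow> real" where
  "gamma_ratio n = (real n / (real n - 1)) ^ (n - 1) - 1"

text \<open>
  The two facts below justify the definitions: for each outcome of the coins, bidding
  the true value \<open>x\<close> is a dominant strategy, and the revenue is integrable, so that
  \<^const>\<open>expected_revenue\<close> is a genuine expectation.
\<close>

definition utility ::
    "nat \<Rightarrow> (nat \<Rightarrow> 'c \<Rightarrow> (nat \<Rightarrow> real) \<Rightarrow> ennreal) \<Rightarrow> 'c \<Rightarrow> nat \<Rightarrow> real \<Rightarrow> (nat \<Rightarrow> real) \<Rightarrow> real" where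
  "utility n g \<omega> i x b = (if wins n g \<omega> b i then x - payment n g \<omega> b i else 0)"

lemma truthful_bid_dominant:
  assumes "x \<ge> 1" "y \<ge> 1"
  shows "utility n g \<omega> i x (b(i := y)) \<le> utility n g \<omega> i x (b(i := x))"
proof -
  have o: "others n i (b(i := z)) = others n i b" for z
    by (auto simp: others_def)
  show ?thesis
    using assms
    by (cases "g i \<omega> (others n i b)")
       (auto simp: utility_def wins_def payment_def o ennreal_le_iff top_unique)
qed

lemma integrable_revenue:
  assumes A: "truthful_auction n M g" and v: "v \<in> bid_vectors n"
  shows "integrable M (\<lambda>\<omega>. revenue n g \<omega> v)"
proof -
  interpret prob_space M
    using A by (simp add: truthful_auction_def)
  have "integrable M (\<lambda>\<omega>. payment n g \<omega> v i)" if i: "i \<in> {1..n}" for i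
  proof (rule integrable_const_bound[where B = "v i"])
    have [measurable]: "(\<lambda>\<omega>. g i \<omega> (others n i v)) \<in> borel_measurable M"
      using A v i by (auto simp: truthful_auction_def)
    show "(\<lambda>\<omega>. payment n g \<omega> v i) \<in> borel_measurable M"
      unfolding payment_def wins_def by measurable
    have vi: "v i \<ge> 1"
      using v i by (auto simp: bid_vectors_def PiE_def Pi_def)
    have "norm (payment n g \<omega> v i) \<le> v i" for \<omega>
      using vi by (auto simp: payment_def wins_def enn2real_leI)
    then show "AE \<omega> in M. norm (payment n g \<omega> v i) \<le> v i"
      by simp
  qed
  then show ?thesis
    unfolding revenue_def by (intro Bochner_Integration.integrable_sum) auto
qed

end

theory Submission
  imports Defs
begin

text \<open>
  In the variables \<open>t = 1 / v\<close> an equal-revenue bid is uniform on \<open>[0,1]\<close>, and a bidder's expected payment,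
  as a function of the own bid, integrates to at most 1 against it. Hence the expected benchmark of \<open>n\<close> independent
  equal-revenue bids is at most \<open>n\<close> times any competitive ratio. Sweeping the price upwards and revealing the bids
  on the way, this expectation is a martingale whose increments can be distributed to the bidders: the benchmark
  becomes an exact sum of (not monotone) payments that integrate to \<open>\<lambda>\<close> on every line and to at most \<open>\<lambda>\<close> on
  every upper ray of a line. So its mean is \<open>n \<lambda>\<close>, which is the lower bound, and its integral over an upward closed
  set is at most \<open>\<lambda>\<close> times the sum of the measures of the \<open>n\<close> projections of the set.

  This last estimate is Hall's condition for sharing the benchmark among the bidders. On a finite grid of bids the
  benchmark is shared in proportion to weights attached to the lines, and the weight of a line is lowered as long as the
  line is overloaded. Monotonicity of the benchmark in the bids passes to the weights and makes each share
  increasing in the own bid, that is, the revenue of a random posted price; Hall's condition forces the shares to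
  exhaust the benchmark in the limit. Finally, almost optimal price distributions converge: almost everywhere along
  suitable convex combinations, which gives joint measurability, and at the remaining bid vectors along a cluster point
  in the product topology.
\<close>

section \<open>The polynomials behind the benchmarks\<close>

text \<open>A nonnegative nondecreasing step function of the own bid is the revenue of a measure on
  posted prices, and the total mass of that measure is the integral of the function against 1/x^2.
  So the upper bound amounts to splitting the benchmark into \<open>n\<close> functions, each
  nondecreasing in its own bid and with integral at most \<open>lam\<close> on every line. The split
  produced by the sweep has the right integrals but not the monotonicity. It is therefore used only
  through its integrals over upward closed sets. On a ray starting at \<open>a\<close>, its integral
  is \<open>lam / a\<close> plus the mean slope below \<open>a\<close>, so it stays below
  \<open>lam\<close> only if the slope stays in [0, \<open>lam\<close>] however many bids are still
  in the race. This is why the slopes at all switching points are compared, and why the ratio is the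
  slope at the start, where all \<open>n\<close> bids remain. The coefficients leave no freedom. A
  race with at most one bid left cannot improve the maximum, which gives \<open>a 0 = 1\<close> and
  \<open>a 1 = 0\<close>; smooth fit at the moment when the current price value overtakes the old
  maximum gives each further \<open>a k\<close> from the earlier ones.\<close>

text \<open>
  The benchmarks are \<open>max\<^bsub>2\<le>k\<le>n\<^esub> (k - d) * b\<^sub>k\<close> for \<open>d = 0\<close> (\<open>F2\<close>) and \<open>d = 1\<close> (\<open>maxV\<close>), where \<open>b\<^sub>k\<close> is the
  \<open>k\<close>-th largest bid. If \<open>k\<close> bids are independent equal-revenue variables above \<open>y\<close>, then the expectation of
  the maximum of \<open>c\<close> and their benchmark is \<open>c * app_poly a k (y / c)\<close> for \<open>c \<ge> (k - d) * y\<close>,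
  where \<open>a\<close> depends only on \<open>d\<close>.
\<close>
definition app_poly :: "(nat \<Rightarrow> real) \<Rightarrow> nat \<Rightarrow> real \<Rightarrow> real" where
  "app_poly a k z = (\<Sum>j\<le>k. real (k choose j) * a j * z ^ j)"

text \<open>It has two roles at once: \<open>k * app_deriv a k z\<close> is the derivative of
  \<open>app_poly a k\<close>, and \<open>z * app_deriv a k z\<close> is what is lost when one of
  \<open>k\<close> bids drops out. Equal-revenue bids leave at rate 1/y each, so this agreement is
  what makes the expected benchmark a martingale along the sweep.\<close>

definition app_deriv :: "(nat \<Rightarrow> real) \<Rightarrow> nat \<Rightarrow> real \<Rightarrow> real" where
  "app_deriv a k z = (\<Sum>j<k. real ((k - 1) choose j) * a (Suc j) * z ^ j)"

lemma app_poly_Suc: "app_poly a (Suc k) z = app_poly a k z + z * app_deriv a (Suc k) z"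
proof -
  have "app_poly a (Suc k) z = a 0 + (\<Sum>j\<le>k. real (Suc k choose Suc j) * a (Suc j) * z ^ Suc j)"
    unfolding app_poly_def by (subst sum.atMost_Suc_shift) simp
  also have "(\<Sum>j\<le>k. real (Suc k choose Suc j) * a (Suc j) * z ^ Suc j) =
     (\<Sum>j\<le>k. real (k choose Suc j) * a (Suc j) * z ^ Suc j) + z * app_deriv a (Suc k) z"
    by (simp add: app_deriv_def lessThan_Suc_atMost sum_distrib_left sum.distrib[symmetric] algebra_simps)
  also have "a 0 + ((\<Sum>j\<le>k. real (k choose Suc j) * a (Suc j) * z ^ Suc j) + z * app_deriv a (Suc k) z)
     = (\<Sum>j\<le>Suc k. real (k choose j) * a j * z ^ j) + z * app_deriv a (Suc k) z"
    by (subst sum.atMost_Suc_shift) simp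
  also have "(\<Sum>j\<le>Suc k. real (k choose j) * a j * z ^ j) = app_poly a k z"
    by (simp add: app_poly_def binomial_eq_0)
  finally show ?thesis .
qed

lemma has_real_derivative_app_poly:
  "(app_poly a k has_real_derivative real k * app_deriv a k z) (at z within S)"
proof (cases k)
  case 0
  then show ?thesis by (simp add: app_poly_def[abs_def])
next
  case (Suc p)
  have "((\<lambda>z. \<Sum>j\<le>k. real (k choose j) * a j * z ^ j) has_real_derivative
     (\<Sum>j\<le>k. real (k choose j) * a j * (real j * z ^ (j - 1)))) (at z within S)"
    by (auto intro!: derivative_eq_intros sum.cong)
  moreover have "(\<Sum>j\<le>k. real (k choose j) * a j * (real j * z ^ (j - 1))) = real k * app_deriv a k z"
  proof -
    have *: "real (Suc p choose Suc j) * real (Suc j) = real (Suc p) * real (p choose j)" for j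
      by (metis Suc_times_binomial_eq mult.commute of_nat_mult)
    have "(\<Sum>j\<le>k. real (k choose j) * a j * (real j * z ^ (j - 1))) =
      (\<Sum>j\<le>p. (real (Suc p choose Suc j) * real (Suc j)) * a (Suc j) * z ^ j)"
      unfolding Suc by (subst sum.atMost_Suc_shift) (simp add: mult_ac)
    also have "\<dots> = real k * app_deriv a k z"
      unfolding * by (simp add: Suc app_deriv_def lessThan_Suc_atMost sum_distrib_left mult_ac)
    finally show ?thesis .
  qed
  ultimately show ?thesis
    unfolding app_poly_def[abs_def] by simp
qed

section \<open>The coefficients of the two benchmarks\<close>

definition maxV_coeff :: "nat \<Rightarrow> real" where
  "maxV_coeff j = (if j = 1 then 0 else 1)"

text \<open>The values are forced by smooth fit, which says that the sum over j of C(k,j) a_j (j-1)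
  z^j vanishes at z = 1/(k-d); its top term determines a_k from the earlier ones. For d = 0 the
  solution has a_j (j-1) = (-1)^j j^2 for j \<ge> 2, because an alternating second binomial moment
  vanishes at z = 1/k.\<close>

definition F2_coeff :: "nat \<Rightarrow> real" where
  "F2_coeff j = (if j = 0 then 1 else if j = 1 then 0 else (- 1) ^ j * real j ^ 2 / (real j - 1))"

lemma app_deriv_maxV: "k \<ge> 1 \<Longrightarrow> app_deriv maxV_coeff k z = (1 + z) ^ (k - 1) - 1"
proof (cases k)
  case (Suc p)
  have "app_deriv maxV_coeff (Suc p) z = (\<Sum>j\<le>p. real (p choose j) * z ^ j - (if j = 0 then 1 else 0))"
    unfolding app_deriv_def by (auto simp: lessThan_Suc_atMost maxV_coeff_def intro!: sum.cong)
  also have "\<dots> = (z + 1) ^ p - 1"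
    unfolding sum_subtractf by (subst binomial_ring) simp
  finally show ?thesis by (simp add: Suc add.commute)
qed auto

lemma app_poly_maxV: "app_poly maxV_coeff k z = (1 + z) ^ k - real k * z"
proof (induction k)
  case 0 then show ?case by (simp add: app_poly_def maxV_coeff_def)
next
  case (Suc k)
  then show ?case by (simp add: app_poly_Suc app_deriv_maxV algebra_simps)
qed

lemma maxV_switch:
  assumes "k \<ge> 2"
  shows "real k * app_deriv maxV_coeff k (1 / (real k - 1)) =
    (real k - 1) * app_poly maxV_coeff k (1 / (real k - 1))"
proof -
  obtain p where k: "k = Suc p" "p \<ge> 1" using assms by (cases k) auto
  show ?thesis using k(2)
    by (simp add: k(1) app_poly_maxV app_deriv_maxV field_simps)
qed

text \<open>For u = 1 this is the monotonicity of (1 + 1/p)^p. Bernoulli's inequality for the ratio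
  of the two bases leaves a remainder proportional to u (1-u). The other values of u serve the
  derivative in \<open>harmonic_part_scaled_mono\<close>.\<close>

lemma power_ratio_antimono:
  fixes u :: real
  assumes "0 \<le> u" "u \<le> 1"
  shows "(1 - u / (real p + 2)) ^ (p + 1) \<le> (1 - u / (real p + 1)) ^ p"
proof -
  define x where "x = 1 - u / (real p + 1)"
  define y where "y = 1 - u / (real p + 2)"
  have x0: "x > 0 \<or> p = 0" using assms by (cases p) (auto simp: x_def field_simps)
  have y0: "y > 0" using assms by (auto simp: y_def field_simps)
  show ?thesis
  proof (cases "p = 0")
    case True
    then show ?thesis using assms by auto
  next
    case False
    then have x0: "x > 0" using x0 by simp
    have "1 + real (p + 1) * (x / y - 1) \<le> (1 + (x / y - 1)) ^ (p + 1)"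
      by (rule Bernoulli_inequality) (use x0 y0 in auto)
    then have b: "1 + real (p + 1) * (x / y - 1) \<le> (x / y) ^ (p + 1)" by simp
    have "x \<le> 1 + real (p + 1) * (x / y - 1)"
    proof -
      have "(1 + real (p + 1) * (x / y - 1) - x) * y = y - x * y + (real p + 1) * (x - y)"
        using y0 by (simp add: field_simps)
      also have "\<dots> = u * (1 - u) / ((real p + 1) * (real p + 2))"
      proof -
        have p: "real p + 1 \<noteq> 0" "real p + 2 \<noteq> 0" by linarith+
        show ?thesis unfolding x_def y_def using p by (simp add: divide_simps) algebra
      qed
      also have "\<dots> \<ge> 0" using assms by simp
      finally show ?thesis using y0 by (simp add: zero_le_mult_iff)
    qed
    with b have "x \<le> (x / y) ^ (p + 1)" by simp
    then have "x * y ^ (p + 1) \<le> x ^ (p + 1)"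
      using y0 by (simp add: field_simps power_divide)
    then have "y ^ (p + 1) \<le> x ^ p" using x0 by simp
    then show ?thesis by (simp add: x_def y_def)
  qed
qed

section \<open>Binomial moments and the slopes for F2\<close>

lemma binomial_moment1:
  "(\<Sum>j\<le>p. real (p choose j) * real j * x ^ j) = real p * x * (1 + x) ^ (p - 1)"
proof -
  have "(\<Sum>j\<le>p. real (p choose j) * real j * x ^ j) =
     x * (\<Sum>j\<le>p. (of_nat j * of_nat (p choose j)) * x ^ (j - 1) * 1 ^ (p - j))"
    unfolding sum_distrib_left
  proof (rule sum.cong)
    fix j
    show "real (p choose j) * real j * x ^ j =
       x * ((of_nat j * of_nat (p choose j)) * x ^ (j - 1) * 1 ^ (p - j))"
      by (cases j) auto
  qed simp
  then show ?thesis by (simp only: binomial_deriv1) (simp add: add.commute)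
qed

lemma binomial_moment2:
  "(\<Sum>j\<le>p. real (p choose j) * real j ^ 2 * x ^ j) =
     real p * x * (1 + x) ^ (p - 1) + real p * (real p - 1) * x ^ 2 * (1 + x) ^ (p - 2)"
proof -
  have "(\<Sum>j\<le>p. real (p choose j) * real j ^ 2 * x ^ j) =
     (\<Sum>j\<le>p. real (p choose j) * real j * x ^ j) +
     x ^ 2 * (\<Sum>j\<le>p. (of_nat j * of_nat (j - 1) * of_nat (p choose j)) * x ^ (j - 2) * 1 ^ (p - j))"
    unfolding sum_distrib_left sum.distrib[symmetric]
  proof (rule sum.cong)
    fix j
    consider "j = 0" | "j = 1" | i where "j = Suc (Suc i)"
      by (metis One_nat_def not0_implies_Suc)
    then show "real (p choose j) * real j ^ 2 * x ^ j = real (p choose j) * real j * x ^ j +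
       x ^ 2 * ((of_nat j * of_nat (j - 1) * of_nat (p choose j)) * x ^ (j - 2) * 1 ^ (p - j))"
      by cases (auto simp: algebra_simps power2_eq_square)
  qed simp
  also have "(\<Sum>j\<le>p. (of_nat j * of_nat (j - 1) * of_nat (p choose j)) * x ^ (j - 2) * 1 ^ (p - j)) =
     of_nat p * of_nat (p - 1) * (x + 1) ^ (p - 2)"
    by (rule binomial_deriv2)
  finally show ?thesis
    unfolding binomial_moment1 by (cases p) (auto simp: algebra_simps)
qed

text \<open>The integral of (1 - (1-t)^p) / t over [0,z]. It collects the terms 1/j of the F2
  coefficients.\<close>

definition harmonic_part :: "nat \<Rightarrow> real \<Rightarrow> real" where
  "harmonic_part p z = (\<Sum>i=1..p. (1 - (1 - z) ^ i) / real i)"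

lemma harmonic_part_binomial:
  "harmonic_part p z = - (\<Sum>j=1..p. real (p choose j) * (- z) ^ j / real j)"
proof (induction p)
  case 0
  then show ?case by (simp add: harmonic_part_def)
next
  case (Suc p)
  \<comment> \<open>Pascal's rule divided by j, with C(p,j-1)/j rewritten as C(p+1,j)/(p+1): the
    increment becomes a plain binomial sum without the factor 1/j.\<close>
  have e: "real (Suc p choose j) / real j = real (p choose j) / real j + real (Suc p choose j) / real (Suc p)"
    if j: "j \<in> {1..Suc p}" for j
  proof -
    obtain i where i: "j = Suc i" using j by (cases j) auto
    have "real (Suc i) * real (Suc p choose Suc i) = real (Suc p) * real (p choose i)"
      by (metis Suc_times_binomial_eq mult.commute of_nat_mult)
    then have "real (Suc p choose Suc i) / real (Suc p) = real (p choose i) / real (Suc i)"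
      by (simp add: frac_eq_eq del: binomial_Suc_Suc of_nat_Suc) (simp add: mult_ac)
    then show ?thesis unfolding i by (simp add: add_divide_distrib del: of_nat_Suc)
  qed
  have "(\<Sum>j=1..Suc p. real (Suc p choose j) * (- z) ^ j / real j) =
     (\<Sum>j=1..Suc p. real (p choose j) * (- z) ^ j / real j) +
     (\<Sum>j=1..Suc p. real (Suc p choose j) * (- z) ^ j) / real (Suc p)"
    unfolding sum_divide_distrib sum.distrib[symmetric]
  proof (rule sum.cong)
    fix j assume "j \<in> {1..Suc p}"
    from e[OF this] show "real (Suc p choose j) * (- z) ^ j / real j =
      real (p choose j) * (- z) ^ j / real j + real (Suc p choose j) * (- z) ^ j / real (Suc p)"
      by (metis (no_types, lifting) distrib_right mult.commute times_divide_eq_right)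
  qed simp
  also have "(\<Sum>j=1..Suc p. real (Suc p choose j) * (- z) ^ j) = (1 - z) ^ Suc p - 1"
  proof -
    have "(- z + 1) ^ Suc p = (\<Sum>j\<le>Suc p. real (Suc p choose j) * (- z) ^ j)"
      by (subst binomial_ring) simp
    also have "\<dots> = 1 + (\<Sum>j=1..Suc p. real (Suc p choose j) * (- z) ^ j)"
      by (simp add: atMost_atLeast0 sum.atLeast_Suc_atMost del: sum.cl_ivl_Suc binomial_Suc_Suc power_Suc)
    finally show ?thesis by simp
  qed
  also have "(\<Sum>j=1..Suc p. real (p choose j) * (- z) ^ j / real j) =
    (\<Sum>j=1..p. real (p choose j) * (- z) ^ j / real j)"
    by (simp add: binomial_eq_0)
  finally have *: "(\<Sum>j=1..Suc p. real (Suc p choose j) * (- z) ^ j / real j) =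
    (\<Sum>j=1..p. real (p choose j) * (- z) ^ j / real j) + ((1 - z) ^ Suc p - 1) / real (Suc p)" .
  have "harmonic_part (Suc p) z = harmonic_part p z - ((1 - z) ^ Suc p - 1) / real (Suc p)"
    by (simp add: harmonic_part_def diff_divide_distrib del: power_Suc of_nat_Suc)
  then show ?case unfolding * Suc.IH by (simp only: minus_add_distrib diff_conv_add_uminus)
qed

text \<open>Since (j+1)^2 / j = j + 2 + 1/j, the coefficients split into a first moment, a plain
  binomial expansion and the harmonic part.\<close>

lemma app_deriv_F2:
  "app_deriv F2_coeff (Suc p) z =
     real p * z * (1 - z) ^ (p - 1) + 2 * (1 - (1 - z) ^ p) + harmonic_part p z"
proof -
  have "app_deriv F2_coeff (Suc p) z = (\<Sum>j=1..p. real (p choose j) * F2_coeff (Suc j) * z ^ j)"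
    unfolding app_deriv_def
    by (simp add: lessThan_Suc_atMost atMost_atLeast0 sum.atLeast_Suc_atMost F2_coeff_def)
  also have "\<dots> = (\<Sum>j=1..p. - (real (p choose j) * real j * (- z) ^ j)
      - 2 * (real (p choose j) * (- z) ^ j) - real (p choose j) * (- z) ^ j / real j)"
  proof (rule sum.cong)
    fix j assume j: "j \<in> {1..p}"
    have "F2_coeff (Suc j) = - ((- 1) ^ j * (real j + 2 + 1 / real j))"
      using j by (simp add: F2_coeff_def field_simps power2_eq_square)
    moreover have "(- z) ^ j = (- 1) ^ j * z ^ j" by (rule power_minus)
    ultimately show "real (p choose j) * F2_coeff (Suc j) * z ^ j =
      - (real (p choose j) * real j * (- z) ^ j)
      - 2 * (real (p choose j) * (- z) ^ j) - real (p choose j) * (- z) ^ j / real j"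
      by (simp only:) (simp add: field_simps)
  qed simp
  also have "\<dots> = - (\<Sum>j=1..p. real (p choose j) * real j * (- z) ^ j)
      - 2 * (\<Sum>j=1..p. real (p choose j) * (- z) ^ j)
      + harmonic_part p z"
    unfolding harmonic_part_binomial by (simp add: sum_subtractf sum_negf sum_distrib_left)
  also have "(\<Sum>j=1..p. real (p choose j) * real j * (- z) ^ j) = - (real p * z * (1 - z) ^ (p - 1))"
    using binomial_moment1[of p "- z"]
    by (simp add: atMost_atLeast0 sum.atLeast_Suc_atMost)
  also have "(\<Sum>j=1..p. real (p choose j) * (- z) ^ j) = (1 - z) ^ p - 1"
    using binomial_ring[of "- z" 1 p]
    by (simp add: atMost_atLeast0 sum.atLeast_Suc_atMost)
  finally show ?thesis by simp
qed

lemma has_real_derivative_harmonic_part: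
  "(harmonic_part p has_real_derivative (\<Sum>i<p. (1 - z) ^ i)) (at z within S)"
proof -
  have "((\<lambda>z. \<Sum>i=1..p. (1 - (1 - z) ^ i) / real i) has_real_derivative
      (\<Sum>i=1..p. (1 - z) ^ (i - 1))) (at z within S)"
    by (auto intro!: derivative_eq_intros sum.cong)
  moreover have "(\<Sum>i=1..p. (1 - z) ^ (i - 1)) = (\<Sum>i<p. (1 - z) ^ i)"
    by (rule sum.reindex_bij_witness[of _ Suc "\<lambda>i. i - 1"]) auto
  ultimately show ?thesis unfolding harmonic_part_def[abs_def] by simp
qed

text \<open>Scale both arguments by u in [0,1]. At u = 0 both sides vanish, and u times the
  derivative of the difference telescopes to (1 - u/(p+1))^p - (1 - u/(p+2))^(p+1), which
  \<open>power_ratio_antimono\<close> makes nonnegative.\<close>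

lemma harmonic_part_scaled_mono:
  "harmonic_part p (1 / (real p + 1)) \<le> harmonic_part (Suc p) (1 / (real p + 2))"
proof -
  define f where "f u = harmonic_part (Suc p) (u / (real p + 2)) - harmonic_part p (u / (real p + 1))" for u
  have "f 0 \<le> f 1"
  proof (rule DERIV_nonneg_imp_nondecreasing[of 0 1 f])
    fix u :: real assume u: "0 \<le> u" "u \<le> 1"
    let ?D = "(\<Sum>i<Suc p. (1 - u / (real p + 2)) ^ i) / (real p + 2) - (\<Sum>i<p. (1 - u / (real p + 1)) ^ i) / (real p + 1)"
    have d: "((\<lambda>u. harmonic_part k (u / c)) has_real_derivative (\<Sum>i<k. (1 - u / c) ^ i) * (1 / c)) (at u)"
      if "c > 0" for c :: real and k
      by (rule DERIV_chain2[OF has_real_derivative_harmonic_part DERIV_cdivide[OF DERIV_ident]])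
    have "(f has_real_derivative ?D) (at u)"
      unfolding f_def using DERIV_diff[OF d[of "real p + 2" "Suc p"] d[of "real p + 1" p]]
      by (simp del: sum.lessThan_Suc)
    moreover have "?D \<ge> 0"
    proof (cases "u = 0")
      case True
      then show ?thesis by (simp add: field_simps)
    next
      case False
      then have u0: "u > 0" using u by simp
      have geo: "u * ((\<Sum>i<k. (1 - u / c) ^ i) / c) = 1 - (1 - u / c) ^ k" if "c > 0" for c :: real and k
      proof -
        have "(1 - (1 - u / c)) * (\<Sum>i<k. (1 - u / c) ^ i) = 1 - (1 - u / c) ^ k"
          by (rule one_diff_power_eq[symmetric])
        then show ?thesis using that by simp
      qed
      have "u * ?D = (1 - u / (real p + 1)) ^ p - (1 - u / (real p + 2)) ^ Suc p"
        unfolding right_diff_distrib by (subst (1 2) geo) auto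
      also have "\<dots> \<ge> 0" using power_ratio_antimono[of u p] u by simp
      finally show ?thesis using u0 by (simp add: zero_le_mult_iff)
    qed
    ultimately show "\<exists>y. (f has_real_derivative y) (at u) \<and> 0 \<le> y" by blast
  qed simp
  then show ?thesis by (simp add: f_def harmonic_part_def)
qed

lemma app_deriv_F2_switch_value:
  assumes "p \<ge> 1"
  shows "app_deriv F2_coeff (Suc p) (1 / (real p + 1)) =
    2 - (1 - 1 / (real p + 1)) ^ p + harmonic_part p (1 / (real p + 1))"
proof -
  obtain q where p: "p = Suc q" using assms by (cases p) auto
  have "real p * (1 / (real p + 1)) * (1 - 1 / (real p + 1)) ^ (p - 1) = (1 - 1 / (real p + 1)) ^ p"
    unfolding p by (simp add: field_simps)
  then show ?thesis unfolding app_deriv_F2 by simp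
qed

text \<open>At the switching point 1 - z = p z, which merges the first summand into the powers
  (1-z)^p. In the resulting closed form both varying terms increase with p.\<close>

lemma app_deriv_F2_switch_mono:
  assumes "1 \<le> p" "p \<le> q"
  shows "app_deriv F2_coeff (Suc p) (1 / (real p + 1)) \<le> app_deriv F2_coeff (Suc q) (1 / (real q + 1))"
  using assms(2)
proof (induction q rule: dec_induct)
  case (step q)
  have "app_deriv F2_coeff (Suc q) (1 / (real q + 1)) \<le> app_deriv F2_coeff (Suc (Suc q)) (1 / (real (Suc q) + 1))"
    using step assms harmonic_part_scaled_mono[of q] power_ratio_antimono[of 1 q]
    by (subst (1 2) app_deriv_F2_switch_value) (auto simp: add.commute)
  then show ?case using step by linarith
qed simp

text \<open>Only the derivative of the summand p z (1-z)^(p-1) has a negative part. It is dominated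
  by the positive part of the same derivative, because (p+1) z \<le> 1 gives (p-1) z \<le> 1 -
  z.\<close>

lemma app_deriv_F2_mono:
  assumes "0 \<le> z" "z \<le> 1 / (real p + 1)"
  shows "app_deriv F2_coeff (Suc p) z \<le> app_deriv F2_coeff (Suc p) (1 / (real p + 1))"
proof (rule DERIV_nonneg_imp_nondecreasing[OF assms(2)])
  fix x assume "z \<le> x" "x \<le> 1 / (real p + 1)"
  then have x: "0 \<le> x" "(real p + 1) * x \<le> 1" using assms by (auto simp: field_simps)
  have x1: "x \<le> 1"
  proof -
    have "0 \<le> real p * x" using x by simp
    moreover have "x + real p * x \<le> 1" using x by (simp add: algebra_simps)
    ultimately show ?thesis by linarith
  qed
  let ?D = "(real p * (1 - x) ^ (p - 1) - real p * x * (real (p - 1) * (1 - x) ^ (p - 2))) +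
      2 * (real p * (1 - x) ^ (p - 1)) + (\<Sum>i<p. (1 - x) ^ i)"
  have "((\<lambda>z. real p * z * (1 - z) ^ (p - 1) + 2 * (1 - (1 - z) ^ p) + harmonic_part p z)
     has_real_derivative ?D) (at x)"
    by (rule derivative_eq_intros has_real_derivative_harmonic_part refl | simp add: numeral_2_eq_2)+
  moreover have "?D \<ge> 0"
  proof -
    have "real p * x * (real (p - 1) * (1 - x) ^ (p - 2)) \<le> real p * (1 - x) ^ (p - 1)"
    proof -
      consider "p = 0" | "p = 1" | q where "p = Suc (Suc q)"
        by (metis One_nat_def not0_implies_Suc)
      then show ?thesis
      proof cases
        case (3 q)
        have "x * real (Suc q) \<le> 1 - x" using x 3 by (simp add: algebra_simps)
        then have "x * real (Suc q) * (1 - x) ^ q \<le> (1 - x) * (1 - x) ^ q"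
          using x1 by (intro mult_right_mono) auto
        then have "real p * (x * real (Suc q) * (1 - x) ^ q) \<le> real p * ((1 - x) * (1 - x) ^ q)"
          by (rule mult_left_mono) simp
        then show ?thesis by (simp add: 3 mult_ac)
      qed auto
    qed
    moreover have "0 \<le> real p * (1 - x) ^ (p - 1)" "0 \<le> (\<Sum>i<p. (1 - x) ^ i)"
      using x1 by (auto intro: sum_nonneg)
    ultimately show ?thesis by linarith
  qed
  ultimately show "\<exists>y. (app_deriv F2_coeff (Suc p) has_real_derivative y) (at x) \<and> 0 \<le> y"
    unfolding app_deriv_F2[abs_def] by blast
qed

lemma app_deriv_F2_nonneg:
  assumes "0 \<le> z" "z \<le> 1"
  shows "0 \<le> app_deriv F2_coeff (Suc p) z"
  unfolding app_deriv_F2 harmonic_part_def using assms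
  by (intro add_nonneg_nonneg sum_nonneg divide_nonneg_nonneg) (auto intro!: power_le_one)

lemma F2_switch:
  assumes "k \<ge> 2"
  shows "app_deriv F2_coeff k (1 / real k) = app_poly F2_coeff k (1 / real k)"
proof -
  define z where "z = 1 / real k"
  obtain p where k: "k = Suc p" using assms by (cases k) auto
  have kz: "real k * z = 1" using assms by (simp add: z_def)
  have "app_deriv F2_coeff k z = z * (real k * app_deriv F2_coeff k z)"
    using kz by (simp add: mult_ac)
  also have "\<dots> = (\<Sum>j\<le>k. real (k choose j) * F2_coeff j * real j * z ^ j)"
  proof -
    have *: "real (Suc p choose Suc j) * real (Suc j) = real (Suc p) * real (p choose j)" for j
      by (metis Suc_times_binomial_eq mult.commute of_nat_mult)
    have "(\<Sum>j\<le>k. real (k choose j) * F2_coeff j * real j * z ^ j) =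
       (\<Sum>j\<le>p. (real (Suc p choose Suc j) * real (Suc j)) * F2_coeff (Suc j) * z ^ Suc j)"
      unfolding k by (subst sum.atMost_Suc_shift) (simp add: mult_ac)
    also have "\<dots> = z * (real k * app_deriv F2_coeff k z)"
      unfolding * by (simp add: k app_deriv_def lessThan_Suc_atMost sum_distrib_left mult_ac)
    finally show ?thesis by simp
  qed
  finally have "app_deriv F2_coeff k z - app_poly F2_coeff k z =
     (\<Sum>j\<le>k. real (k choose j) * F2_coeff j * (real j - 1) * z ^ j)"
    by (simp add: app_poly_def sum_subtractf[symmetric] algebra_simps)
  \<comment> \<open>The rule a_j (j-1) = (-1)^j j^2 fails for j = 0 and j = 1. The two corrections,
    -1 and 1, cancel in the sum.\<close>
  also have "\<dots> = (\<Sum>j\<le>k. real (k choose j) * real j ^ 2 * (- z) ^ j +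
      ((if j = 0 then - 1 else 0) + (if j = 1 then 1 else 0)))"
  proof (rule sum.cong)
    fix j :: nat
    consider "j = 0" | "j = 1" | "j \<ge> 2" by linarith
    then show "real (k choose j) * F2_coeff j * (real j - 1) * z ^ j =
      real (k choose j) * real j ^ 2 * (- z) ^ j + ((if j = 0 then - 1 else 0) + (if j = 1 then 1 else 0))"
    proof cases
      case 3
      then show ?thesis by (simp add: F2_coeff_def power_minus[of z])
    qed (use kz in \<open>auto simp: F2_coeff_def\<close>)
  qed simp
  also have "\<dots> = (\<Sum>j\<le>k. real (k choose j) * real j ^ 2 * (- z) ^ j)"
    using assms by (simp add: sum.distrib)
  also have "\<dots> = 0"
  proof -
    obtain q where q: "k = Suc (Suc q)" using assms by (metis Suc_le_D numeral_2_eq_2 k le_SucE)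
    have "1 - z = (real k - 1) * z" using kz by (simp add: algebra_simps)
    then have "(real k - 1) * z ^ 2 * (1 - z) ^ q = z * (1 - z) ^ Suc q"
      by (simp add: power2_eq_square)
    then show ?thesis
      unfolding binomial_moment2 by (simp add: q mult.assoc)
  qed
  finally show ?thesis by (simp add: z_def)
qed

text \<open>With i/(i-1) = 1 + 1/(i-1) the sum splits into a binomial expansion and the harmonic
  part, the two ingredients of \<open>app_deriv_F2_switch_value\<close>.\<close>

lemma lambda_ratio_eq: 
  assumes "n \<ge> 2"
  shows "lambda_ratio n = app_deriv F2_coeff n (1 / real n)"
proof -
  obtain p where n: "n = Suc p" using assms by (cases n) auto
  define z where "z = 1 / real n"
  have nz: "real n * z = 1" using assms by (simp add: z_def)
  have "(\<Sum>i=2..n. (- 1 / real n) ^ (i - 1) * (real i / (real i - 1)) * real ((n - 1) choose (i - 1)))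
    = (\<Sum>j=1..p. (- z) ^ j * (real (Suc j) / real j) * real (p choose j))"
    by (rule sum.reindex_bij_witness[of _ Suc "\<lambda>i. i - 1"]) (auto simp: n z_def)
  then have l: "lambda_ratio n = 1 - (\<Sum>j=1..p. (- z) ^ j * (real (Suc j) / real j) * real (p choose j))"
    by (simp add: lambda_ratio_def)
  have "(\<Sum>j=1..p. (- z) ^ j * (real (Suc j) / real j) * real (p choose j)) =
    (\<Sum>j=1..p. real (p choose j) * (- z) ^ j) + (\<Sum>j=1..p. real (p choose j) * (- z) ^ j / real j)"
    unfolding sum.distrib[symmetric] by (intro sum.cong) (auto simp: field_simps)
  also have "(\<Sum>j=1..p. real (p choose j) * (- z) ^ j) = (1 - z) ^ p - 1"
    using binomial_ring[of "- z" 1 p]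
    by (simp add: atMost_atLeast0 sum.atLeast_Suc_atMost)
  finally have "lambda_ratio n = 2 - (1 - z) ^ p + harmonic_part p z"
    unfolding l harmonic_part_binomial by simp
  moreover have "app_deriv F2_coeff n z = 2 - (1 - z) ^ p + harmonic_part p z"
    using app_deriv_F2_switch_value[of p] assms by (simp add: n z_def add.commute)
  ultimately show ?thesis by (simp add: z_def)
qed

lemma gamma_ratio_eq: 
  assumes "n \<ge> 2"
  shows "gamma_ratio n = app_deriv maxV_coeff n (1 / (real n - 1))"
proof -
  have "1 + 1 / (real n - 1) = real n / (real n - 1)" using assms by (simp add: field_simps)
  then show ?thesis using assms by (simp add: gamma_ratio_def app_deriv_maxV)
qed

lemma gamma_term_mono:
  assumes "1 \<le> p" "p \<le> q"
  shows "(1 + 1 / real p) ^ p \<le> (1 + 1 / real q) ^ q"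
  using assms(2)
proof (induction q rule: dec_induct)
  case (step q)
  have inv: "(1 - 1 / (real k + 1)) ^ k = inverse ((1 + 1 / real k) ^ k)" if "k \<ge> 1" for k
  proof -
    have "1 - 1 / (real k + 1) = inverse (1 + 1 / real k)" using that by (simp add: field_simps)
    then show ?thesis by (simp add: power_inverse)
  qed
  have "inverse ((1 + 1 / real (Suc q)) ^ Suc q) \<le> inverse ((1 + 1 / real q) ^ q)"
    using power_ratio_antimono[of 1 q] inv[of q] inv[of "Suc q"] step assms by (simp add: add.commute)
  moreover have "0 < (1 + 1 / real (Suc q)) ^ Suc q" "0 < (1 + 1 / real q) ^ q"
    by (intro zero_less_power add_pos_nonneg; simp)+
  ultimately have "(1 + 1 / real q) ^ q \<le> (1 + 1 / real (Suc q)) ^ Suc q"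
    by (metis inverse_le_imp_le)
  then show ?case using step by linarith
qed simp

text \<open>\<open>switch\<close> is the smooth fit. While \<open>c\<close> exceeds
  \<open>(k - d) * y\<close>, the expected benchmark \<open>c * app_poly a k (y / c)\<close> grows
  with slope \<open>k * app_deriv a k (y / c)\<close>; once the price value at \<open>y\<close> is
  the maximum, it is linear with slope \<open>(k - d) * app_poly a k (1 / (k - d))\<close>.
  \<open>deriv_bounds\<close> covers every number \<open>k\<close> of bids that may still be in the
  race.\<close>

locale price_benchmark =
  fixes n :: nat and d :: real and a :: "nat \<Rightarrow> real" and lam :: real
  assumes n2: "n \<ge> 2"
    and d: "0 \<le> d" "d \<le> 1"
    and a01: "a 0 = 1" "a 1 = 0"
    and switch: "\<And>k. 2 \<le> k \<Longrightarrow> k \<le> n \<Longrightarrow>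
       real k * app_deriv a k (1 / (real k - d)) = (real k - d) * app_poly a k (1 / (real k - d))"
    and deriv_bounds: "\<And>k z. 2 \<le> k \<Longrightarrow> k \<le> n \<Longrightarrow> 0 \<le> z \<Longrightarrow> z \<le> 1 / (real k - d) \<Longrightarrow>
       0 \<le> app_deriv a k z \<and> app_deriv a k z \<le> lam"
    and lam_eq: "lam = app_deriv a n (1 / (real n - d))"
    and lam_pos: "lam > 0"

lemma price_benchmark_maxV:
  assumes "n \<ge> 2"
  shows "price_benchmark n 1 maxV_coeff (gamma_ratio n)"
proof
  fix k :: nat assume k: "2 \<le> k" "k \<le> n"
  show "real k * app_deriv maxV_coeff k (1 / (real k - 1)) =
    (real k - 1) * app_poly maxV_coeff k (1 / (real k - 1))"
    using k by (intro maxV_switch)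
  fix z :: real assume z: "0 \<le> z" "z \<le> 1 / (real k - 1)"
  have "(1 + z) ^ (k - 1) \<le> (1 + 1 / real (k - 1)) ^ (k - 1)"
    using z k by (intro power_mono) (auto simp: of_nat_diff)
  also have "\<dots> \<le> (1 + 1 / real (n - 1)) ^ (n - 1)"
    using k by (intro gamma_term_mono) auto
  finally show "0 \<le> app_deriv maxV_coeff k z \<and> app_deriv maxV_coeff k z \<le> gamma_ratio n"
    using k z assms by (simp add: gamma_ratio_eq app_deriv_maxV of_nat_diff)
next
  have "2 \<le> (1 + 1 / real (n - 1)) ^ (n - 1)"
    using gamma_term_mono[of 1 "n - 1"] assms by simp
  then show "0 < gamma_ratio n"
    using assms by (simp add: gamma_ratio_eq app_deriv_maxV of_nat_diff)
qed (use assms in \<open>auto simp: maxV_coeff_def gamma_ratio_eq\<close>)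

lemma price_benchmark_F2:
  assumes "n \<ge> 2"
  shows "price_benchmark n 0 F2_coeff (lambda_ratio n)"
proof
  have mono: "app_deriv F2_coeff k (1 / real k) \<le> lambda_ratio n" if k: "2 \<le> k" "k \<le> n" for k
    using app_deriv_F2_switch_mono[of "k - 1" "n - 1"] k by (simp add: lambda_ratio_eq of_nat_diff)
  fix k :: nat assume k: "2 \<le> k" "k \<le> n"
  show "real k * app_deriv F2_coeff k (1 / (real k - 0)) =
    (real k - 0) * app_poly F2_coeff k (1 / (real k - 0))"
    using k F2_switch[of k] by simp
  fix z :: real assume z: "0 \<le> z" "z \<le> 1 / (real k - 0)"
  have "z \<le> 1" using z k by (auto intro: order_trans)
  then show "0 \<le> app_deriv F2_coeff k z \<and> app_deriv F2_coeff k z \<le> lambda_ratio n"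
    using k z app_deriv_F2_mono[of z "k - 1"] app_deriv_F2_nonneg[of z "k - 1"] mono[OF k]
    by (auto simp: of_nat_diff)
next
  have "app_deriv F2_coeff 2 (1 / 2) = 2"
    by (simp add: app_deriv_def F2_coeff_def numeral_2_eq_2)
  then show "0 < lambda_ratio n"
    using app_deriv_F2_switch_mono[of 1 "n - 1"] assms
    by (simp add: lambda_ratio_eq of_nat_diff numeral_2_eq_2) linarith
qed (use assms in \<open>auto simp: F2_coeff_def lambda_ratio_eq\<close>)

section \<open>The sweep identity\<close>

definition num_ge :: "nat set \<Rightarrow> (nat \<Rightarrow> real) \<Rightarrow> real \<Rightarrow> nat" where
  "num_ge I v y = card {j\<in>I. y \<le> v j}"

definition price_value :: "real \<Rightarrow> nat set \<Rightarrow> (nat \<Rightarrow> real) \<Rightarrow> real \<Rightarrow> real" where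
  "price_value d I v y = (if num_ge I v y \<ge> 2 then y * (real (num_ge I v y) - d) else 0)"

text \<open>The state of the sweep at price \<open>y\<close>. The current price counts although it
  need not be a bid, since raising it to the next bid keeps the demand. \<open>c\<close> carries the
  values found at bids removed earlier. Bids not yet passed enter as 0, which a positive
  \<open>c\<close> absorbs.\<close>

definition best_upto :: "real \<Rightarrow> nat set \<Rightarrow> (nat \<Rightarrow> real) \<Rightarrow> real \<Rightarrow> real \<Rightarrow> real" where
  "best_upto d I v c y = Max (insert c (insert (price_value d I v y)
     ((\<lambda>j. if v j < y then price_value d I v (v j) else 0) ` I)))"

definition best_value :: "real \<Rightarrow> nat set \<Rightarrow> (nat \<Rightarrow> real) \<Rightarrow> real \<Rightarrow> real" where
  "best_value d I v c = Max (insert c ((\<lambda>j. price_value d I v (v j)) ` I))"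

text \<open>
  The derivative, in the current price level \<open>y\<close> of an ascending sweep, of the expected final benchmark
  per bidder still in the race.
\<close>
definition slope :: "(nat \<Rightarrow> real) \<Rightarrow> real \<Rightarrow> nat set \<Rightarrow> (nat \<Rightarrow> real) \<Rightarrow> real \<Rightarrow> real \<Rightarrow> real" where
  "slope a d I v c y = app_deriv a (num_ge I v y) (y / best_upto d I v c y)"

lemma Max_insert_absorb:
  fixes A :: "real set"
  assumes "finite A"
  shows "Max (insert c (insert x (insert y A))) = Max (insert (max c y) (insert x A))"
  using assms by (cases "A = {}") (simp_all add: ac_simps)

lemma num_ge_le: "finite I \<Longrightarrow> num_ge I v y \<le> card I"
  unfolding num_ge_def by (intro card_mono) auto

lemma price_value_le_best_upto: "finite I \<Longrightarrow> price_value d I v y \<le> best_upto d I v c y"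
  unfolding best_upto_def by (rule Max_ge) auto

lemma le_best_upto: "finite I \<Longrightarrow> c \<le> best_upto d I v c y"
  unfolding best_upto_def by (rule Max_ge) auto

context price_benchmark
begin

text \<open>The price value at \<open>y\<close> itself enters \<open>best_upto\<close>, so the
  argument of \<open>app_deriv\<close> is at most \<open>1 / (k - d)\<close>, the range covered by
  \<open>deriv_bounds\<close>.\<close>

lemma slope_bounds:
  assumes "finite I" "card I \<le> n" "y \<ge> 0" "c \<ge> 0"
  shows "0 \<le> slope a d I v c y" "slope a d I v c y \<le> lam"
    "num_ge I v y \<le> 1 \<Longrightarrow> slope a d I v c y = 0"
proof -
  let ?k = "num_ge I v y"
  have k: "?k \<le> n" using num_ge_le[OF assms(1), of v y] assms(2) by simp
  show 0: "slope a d I v c y = 0" if "?k \<le> 1"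
  proof -
    have "?k = 0 \<or> ?k = 1" using that by linarith
    then show ?thesis using a01 by (auto simp: slope_def app_deriv_def)
  qed
  have "0 \<le> slope a d I v c y \<and> slope a d I v c y \<le> lam"
  proof (cases "?k \<le> 1")
    case True
    then show ?thesis using 0 lam_pos by simp
  next
    case False
    then have k2: "2 \<le> ?k" by simp
    have le: "y * (real ?k - d) \<le> best_upto d I v c y"
      using price_value_le_best_upto[OF assms(1), of d v y c] k2 by (simp add: price_value_def)
    have kd: "0 < real ?k - d" using k2 d by linarith
    have "y / best_upto d I v c y \<le> 1 / (real ?k - d)"
    proof (cases "best_upto d I v c y > 0")
      case True
      then show ?thesis using le kd by (simp add: field_simps)
    next
      case False
      then have "best_upto d I v c y = 0" using le_best_upto[OF assms(1), of c d v y] assms(4) by simp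
      then show ?thesis using kd by simp
    qed
    moreover have "0 \<le> y / best_upto d I v c y"
      using le_best_upto[OF assms(1), of c d v y] assms(3,4) by simp
    ultimately show ?thesis
      unfolding slope_def using deriv_bounds[OF k2 k] by blast
  qed
  then show "0 \<le> slope a d I v c y" "slope a d I v c y \<le> lam" by auto
qed

text \<open>The antiderivative is the expected benchmark
  \<open>C y * app_poly a k (y / C y)\<close>. The point where \<open>C\<close> begins to grow is
  left out. Before it the chain rule applies; after it the integrand is constant and
  \<open>switch\<close> identifies it with the derivative.\<close>

lemma has_integral_app_deriv:
  assumes k: "2 \<le> k" "k \<le> n" and c: "c > 0" "(real k - d) * y0 \<le> c" and y: "0 < y0" "y0 \<le> s"
  defines "C \<equiv> \<lambda>y. max c ((real k - d) * y)"
  shows "((\<lambda>y. real k * app_deriv a k (y / C y)) has_integral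
     (C s * app_poly a k (s / C s) - c * app_poly a k (y0 / c))) {y0..s}"
proof -
  have kd: "0 < real k - d" using k d by linarith
  have Cpos: "C y > 0" for y using c by (simp add: C_def less_max_iff_disj)
  have Cy0: "C y0 = c" using c by (simp add: C_def)
  have "((\<lambda>y. real k * app_deriv a k (y / C y)) has_integral
     (C s * app_poly a k (s / C s) - C y0 * app_poly a k (y0 / C y0))) {y0..s}"
  proof (rule fundamental_theorem_of_calculus_interior_strong[of "{c / (real k - d)}"])
    have poly: "continuous_on X (app_poly a k)" for X
      by (rule DERIV_continuous_on) (rule has_real_derivative_app_poly)
    show "continuous_on {y0..s} (\<lambda>y. C y * app_poly a k (y / C y))"
      by (intro continuous_intros continuous_on_compose2[OF poly[of UNIV]]) 
         (use less_imp_neq[OF Cpos] in \<open>auto simp: C_def intro!: continuous_intros\<close>)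
    fix x assume x: "x \<in> {y0<..<s} - {c / (real k - d)}"
    show "((\<lambda>y. C y * app_poly a k (y / C y)) has_vector_derivative real k * app_deriv a k (x / C x)) (at x)"
      unfolding has_real_derivative_iff_has_vector_derivative[symmetric]
    proof (cases "x < c / (real k - d)")
      case True
      have "((\<lambda>y. c * app_poly a k (y / c)) has_real_derivative
          c * ((real k * app_deriv a k (x / c)) * (1 / c))) (at x)"
        by (intro DERIV_cmult DERIV_chain2[OF has_real_derivative_app_poly DERIV_cdivide[OF DERIV_ident]])
      moreover have "C x = c" using True kd by (auto simp: C_def field_simps)
      moreover have "\<forall>\<^sub>F y in nhds x. c * app_poly a k (y / c) = C y * app_poly a k (y / C y)"
      proof -
        have "\<forall>\<^sub>F y in nhds x. y < c / (real k - d)"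
          using True eventually_nhds_in_open[of "{..<c / (real k - d)}"] by simp
        then show ?thesis
          by eventually_elim (use kd in \<open>auto simp: C_def field_simps max_def\<close>)
      qed
      ultimately show "((\<lambda>y. C y * app_poly a k (y / C y)) has_real_derivative real k * app_deriv a k (x / C x)) (at x)"
        using c by (subst DERIV_cong_ev[symmetric, OF refl _ refl]) auto
    next
      case False
      then have xc: "c / (real k - d) < x" using x by auto
      have "((\<lambda>y. (real k - d) * y * app_poly a k (1 / (real k - d))) has_real_derivative
          (real k - d) * app_poly a k (1 / (real k - d))) (at x)"
        by (auto intro!: derivative_eq_intros)
      moreover have "real k * app_deriv a k (x / C x) = (real k - d) * app_poly a k (1 / (real k - d))"
      proof -
        have "C x = (real k - d) * x" using xc kd by (auto simp: C_def field_simps max_def)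
        then have "x / C x = 1 / (real k - d)" using x y by auto
        then show ?thesis using switch[OF k] by simp
      qed
      moreover have "\<forall>\<^sub>F y in nhds x. (real k - d) * y * app_poly a k (1 / (real k - d)) = C y * app_poly a k (y / C y)"
      proof -
        have "\<forall>\<^sub>F y in nhds x. y > c / (real k - d)"
          using xc eventually_nhds_in_open[of "{c / (real k - d)<..}"] by simp
        then show ?thesis
        proof eventually_elim
          case (elim y)
          moreover have "0 < c / (real k - d)" using kd c by simp
          ultimately have "y > 0" by linarith
          moreover have "C y = (real k - d) * y" using elim kd by (auto simp: C_def field_simps max_def)
          ultimately have "C y = (real k - d) * y" "y > 0" by auto
          then show ?case by simp
        qed
      qed
      ultimately show "((\<lambda>y. C y * app_poly a k (y / C y)) has_real_derivative real k * app_deriv a k (x / C x)) (at x)"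
        by (subst DERIV_cong_ev[symmetric, OF refl _ refl]) auto
    qed
  qed (use y in auto)
  then show ?thesis by (simp add: Cy0)
qed

text \<open>Induction on the number of bids, removing the lowest bid \<open>s\<close>. Up to
  \<open>s\<close> all \<open>k\<close> bids are in the race; above \<open>s\<close> the situation
  is the same with \<open>k - 1\<close> bids and the maximum updated to \<open>c'\<close>. The drop
  of the expectation at \<open>s\<close> is \<open>s * slope\<close>, by
  \<open>app_poly_Suc\<close>. Distinct bids guarantee that they leave one at a time.\<close>

lemma has_integral_slope:
  assumes "finite I" "inj_on v I" "card I \<le> n" "0 < y0" "\<And>j. j \<in> I \<Longrightarrow> y0 \<le> v j"
    "\<And>j. j \<in> I \<Longrightarrow> v j \<le> B" "y0 \<le> B" "c > 0" "2 \<le> card I \<Longrightarrow> (real (card I) - d) * y0 \<le> c"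
  shows "((\<lambda>y. real (num_ge I v y) * slope a d I v c y) has_integral
    (best_value d I v c + (\<Sum>j\<in>I. v j * slope a d I v c (v j)) - c * app_poly a (card I) (y0 / c))) {y0..B}"
  using assms
proof (induction "card I" arbitrary: I y0 c)
  case 0
  then have "I = {}" by simp
  then show ?case
    using \<open>c > 0\<close> by (simp add: num_ge_def best_value_def app_poly_def a01)
next
  case (Suc p)
  define k where "k = card I"
  have k: "k = Suc p" using Suc.hyps(2) by (simp add: k_def)
  note fin = Suc.prems(1) and inj = Suc.prems(2)
  have "I \<noteq> {}" using k by (auto simp: k_def)
  then obtain i where i: "i \<in> I" and imin: "\<And>j. j \<in> I \<Longrightarrow> v i \<le> v j"
    using fin by (metis arg_min_if_finite(1) arg_min_least)
  define s where "s = v i"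
  define I' where "I' = I - {i}"
  have I: "I = insert i I'" "i \<notin> I'" and fin': "finite I'" using i fin by (auto simp: I'_def)
  have card': "card I' = p" using k i fin by (simp add: I'_def k_def)
  have s_less: "s < v j" if "j \<in> I'" for j
    using imin[of j] inj i that by (fastforce simp: s_def I'_def inj_on_def less_le)
  have y0s: "y0 \<le> s" using Suc.prems(5)[OF i] by (simp add: s_def)
  have sB: "s \<le> B" using Suc.prems(6)[OF i] by (simp add: s_def)
  have s0: "s > 0" using y0s Suc.prems(4) by simp
  have num_low: "num_ge I v y = k" if "y \<le> s" for y
  proof -
    have "{j \<in> I. y \<le> v j} = I" using that imin by (force simp: s_def)
    then show ?thesis by (simp add: num_ge_def k_def)
  qed
  have num_high: "num_ge I v y = num_ge I' v y" if "s < y" for y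
  proof -
    have "{j \<in> I. y \<le> v j} = {j \<in> I'. y \<le> v j}" using that by (auto simp: I'_def s_def)
    then show ?thesis by (simp add: num_ge_def)
  qed
  have val_high: "price_value d I v y = price_value d I' v y" if "s < y" for y
    using num_high[OF that] by (simp add: price_value_def)
  define c' where "c' = max c (price_value d I v s)"
  have c'0: "c' > 0" using Suc.prems(8) by (simp add: c'_def)
  have best_low: "best_upto d I v c y = max c (price_value d I v y)" if "0 < y" "y \<le> s" for y
  proof -
    have "(\<lambda>j. if v j < y then price_value d I v (v j) else 0) ` I = {0}"
      using that imin \<open>I \<noteq> {}\<close> by (force simp: s_def image_iff)
    then show ?thesis using Suc.prems(8) by (simp add: best_upto_def max_def)
  qed
  have best_high: "best_upto d I v c y = best_upto d I' v c' y" if "s < y" for y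
  proof -
    have im: "(\<lambda>j. if v j < y then price_value d I v (v j) else 0) ` I' =
       (\<lambda>j. if v j < y then price_value d I' v (v j) else 0) ` I'"
      using val_high s_less by (intro image_cong) auto
    have "best_upto d I v c y = Max (insert c (insert (price_value d I' v y) (insert (price_value d I v s)
      ((\<lambda>j. if v j < y then price_value d I' v (v j) else 0) ` I'))))"
      unfolding best_upto_def val_high[OF that, symmetric] unfolding I(1) image_insert
      unfolding I(1)[symmetric] im using that by (simp only: s_def if_True)
    also have "\<dots> = Max (insert (max c (price_value d I v s)) (insert (price_value d I' v y)
      ((\<lambda>j. if v j < y then price_value d I' v (v j) else 0) ` I')))"
      by (rule Max_insert_absorb) (use fin' in simp)
    finally show ?thesis by (simp only: best_upto_def c'_def)
  qed
  have slope_high: "slope a d I v c y = slope a d I' v c' y" if "s < y" for y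
    using num_high[OF that] best_high[OF that] by (simp add: slope_def)
  have top: "best_value d I v c = best_value d I' v c'"
  proof -
    have im: "(\<lambda>j. price_value d I v (v j)) ` I' = (\<lambda>j. price_value d I' v (v j)) ` I'"
      using val_high s_less by (intro image_cong) auto
    have "best_value d I v c = Max (insert c (insert (price_value d I v s) ((\<lambda>j. price_value d I' v (v j)) ` I')))"
      unfolding best_value_def I(1) image_insert
      unfolding I(1)[symmetric] im by (simp add: s_def)
    also have "\<dots> = best_value d I' v c'"
      using fin' by (cases "I' = {}") (simp_all add: best_value_def c'_def ac_simps)
    finally show ?thesis .
  qed
  have IH: "((\<lambda>y. real (num_ge I' v y) * slope a d I' v c' y) has_integral
    (best_value d I' v c' + (\<Sum>j\<in>I'. v j * slope a d I' v c' (v j)) - c' * app_poly a (card I') (s / c'))) {s..B}"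
  proof (rule Suc.hyps(1))
    assume "2 \<le> card I'"
    then have "price_value d I v s = s * (real k - d)"
      using num_low[of s] card' k by (simp add: price_value_def)
    then have "(real k - d) * s \<le> c'" by (simp add: c'_def mult.commute)
    moreover have "(real (card I') - d) * s \<le> (real k - d) * s"
      using s0 card' k by (intro mult_right_mono) auto
    ultimately show "(real (card I') - d) * s \<le> c'" by simp
  next
    show "inj_on v I'" using inj by (simp add: I inj_on_insert)
  qed (use card' fin' s0 sB c'0 s_less Suc.prems(3,6) k k_def I in \<open>auto simp: less_imp_le\<close>)
  have high: "((\<lambda>y. real (num_ge I v y) * slope a d I v c y) has_integral
    (best_value d I v c + (\<Sum>j\<in>I'. v j * slope a d I v c (v j)) - c' * app_poly a p (s / c'))) {s..B}"
  proof -
    have "(\<Sum>j\<in>I'. v j * slope a d I v c (v j)) = (\<Sum>j\<in>I'. v j * slope a d I' v c' (v j))"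
      using s_less slope_high by (intro sum.cong) auto
    then show ?thesis
      using IH unfolding card' top
      by (elim has_integral_spike[of "{s}", rotated 2, THEN has_integral_eq_rhs])
         (auto simp: num_high slope_high)
  qed
  have low: "((\<lambda>y. real (num_ge I v y) * slope a d I v c y) has_integral
     (c' * app_poly a k (s / c') - c * app_poly a k (y0 / c))) {y0..s}"
  proof (cases "k \<ge> 2")
    case True
    have c'_eq: "c' = max c ((real k - d) * s)"
      using True num_low[of s] by (simp add: c'_def price_value_def mult.commute)
    have "((\<lambda>y. real k * app_deriv a k (y / max c ((real k - d) * y))) has_integral
     (c' * app_poly a k (s / c') - c * app_poly a k (y0 / c))) {y0..s}"
      unfolding c'_eq
      by (rule has_integral_app_deriv) (use True Suc.prems k_def y0s in auto)
    then show ?thesis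
    proof (rule has_integral_eq[rotated])
      fix y assume y: "y \<in> {y0..s}"
      then have "best_upto d I v c y = max c ((real k - d) * y)"
        using best_low[of y] num_low[of y] True Suc.prems(4) by (simp add: price_value_def mult.commute)
      then show "real k * app_deriv a k (y / max c ((real k - d) * y)) =
          real (num_ge I v y) * slope a d I v c y"
        using y by (simp add: slope_def num_low)
    qed
  next
    case False
    then have k1: "k = 1" using k by simp
    have "c' = c" using num_low[of s] k1 Suc.prems(8) by (simp add: c'_def price_value_def)
    moreover have "app_poly a k z = 1" for z using k1 a01 by (simp add: app_poly_def)
    moreover have "((\<lambda>y. real (num_ge I v y) * slope a d I v c y) has_integral 0) {y0..s}"
      by (rule has_integral_is_0) (use num_low k1 a01 in \<open>auto simp: slope_def app_deriv_def\<close>)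
    ultimately show ?thesis by simp
  qed
  have "c' * app_poly a k (s / c') = c' * app_poly a p (s / c') + s * slope a d I v c s"
    using num_low[of s] best_low[of s] s0 c'0 by (simp add: k app_poly_Suc slope_def c'_def[symmetric] algebra_simps)
  moreover have "(\<Sum>j\<in>I. v j * slope a d I v c (v j)) =
      s * slope a d I v c s + (\<Sum>j\<in>I'. v j * slope a d I v c (v j))"
    using I fin' by (simp add: s_def)
  ultimately show ?case
    using has_integral_combine[OF y0s sB low high] by (simp add: k_def algebra_simps)
qed

text \<open>The sweep starts at price 1 with maximum \<open>n - d\<close>, the price value of 1 when
  everybody accepts. By \<open>switch\<close> for \<open>k = n\<close> the initial expectation is
  \<open>n * lam\<close>.\<close>

lemma has_integral_slope_total:
  assumes v: "v \<in> {1..n} \<rightarrow>\<^sub>E {1..}" "inj_on v {1..n}" and B: "\<And>j. j \<in> {1..n} \<Longrightarrow> v j \<le> B" "1 \<le> B"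
  shows "((\<lambda>y. real (num_ge {1..n} v y) * slope a d {1..n} v (real n - d) y) has_integral
    (best_value d {1..n} v (real n - d) + (\<Sum>j=1..n. v j * slope a d {1..n} v (real n - d) (v j)) - real n * lam)) {1..B}"
proof -
  have "((\<lambda>y. real (num_ge {1..n} v y) * slope a d {1..n} v (real n - d) y) has_integral
    (best_value d {1..n} v (real n - d) + (\<Sum>j=1..n. v j * slope a d {1..n} v (real n - d) (v j))
      - (real n - d) * app_poly a (card {1..n}) (1 / (real n - d)))) {1..B}"
    by (rule has_integral_slope) (use v B n2 d in auto)
  also have "(real n - d) * app_poly a (card {1..n}) (1 / (real n - d)) = real n * lam"
    using switch[of n] n2 lam_eq by simp
  finally show ?thesis .
qed

lemma num_ge_update:
  assumes "y \<le> x" "y \<le> x'"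
  shows "num_ge I (v(i := x)) y = num_ge I (v(i := x')) y"
  unfolding num_ge_def using assms by (intro arg_cong[of _ _ card]) auto

text \<open>A sweep that has reached only \<open>y\<close> cannot tell how far a bid lies above
  \<open>y\<close>. Along a line in direction \<open>i\<close>, the slope is therefore one function
  of \<open>y\<close>, to which Fubini's theorem can be applied.\<close>

lemma slope_update:
  assumes "y \<le> x" "y \<le> x'"
  shows "slope a d I (v(i := x)) c y = slope a d I (v(i := x')) c y"
proof -
  have "best_upto d I (v(i := x)) c y = best_upto d I (v(i := x')) c y"
  proof -
    have "(\<lambda>j. if (v(i := x)) j < y then price_value d I (v(i := x)) ((v(i := x)) j) else 0) ` I =
       (\<lambda>j. if (v(i := x')) j < y then price_value d I (v(i := x')) ((v(i := x')) j) else 0) ` I"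
      using assms num_ge_update[of _ x x' I v i] by (intro image_cong) (auto simp: price_value_def)
    then show ?thesis
      unfolding best_upto_def price_value_def num_ge_update[OF assms] by simp
  qed
  then show ?thesis unfolding slope_def num_ge_update[OF assms] by simp
qed

end

section \<open>Monotonicity and scaling of the benchmark, and its form by order statistics\<close>

lemma num_ge_mono: "finite I \<Longrightarrow> (\<And>j. j \<in> I \<Longrightarrow> v j \<le> w j) \<Longrightarrow> num_ge I v y \<le> num_ge I w y"
  unfolding num_ge_def by (intro card_mono) (auto intro: order_trans)

text \<open>Raising the price to the lowest bid that accepts it keeps the demand and does not lower
  the value.\<close>

lemma price_value_le_best_value:
  assumes "finite I" "0 \<le> y" "d \<le> 2" "c \<ge> 0"
  shows "price_value d I v y \<le> best_value d I v c"
proof (cases "num_ge I v y \<ge> 2")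
  case False
  have "c \<le> best_value d I v c"
    unfolding best_value_def using assms by (intro Max_ge) auto
  then show ?thesis using False assms by (simp add: price_value_def)
next
  case True
  define A where "A = {j\<in>I. y \<le> v j}"
  have "A \<noteq> {}" using True unfolding num_ge_def A_def by (metis card.empty not_numeral_le_zero)
  moreover have "finite A" using assms(1) by (simp add: A_def)
  ultimately obtain i where "i \<in> A" and imin: "\<And>j. j \<in> A \<Longrightarrow> v i \<le> v j"
    by (metis arg_min_if_finite(1) arg_min_least)
  then have i: "i \<in> I" "y \<le> v i" by (auto simp: A_def)
  have "{j\<in>I. v i \<le> v j} = {j\<in>I. y \<le> v j}" using i imin by (force simp: A_def)
  then have "num_ge I v (v i) = num_ge I v y" by (simp add: num_ge_def)
  then have "price_value d I v y \<le> price_value d I v (v i)"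
    using True i assms by (auto simp: price_value_def intro!: mult_right_mono)
  also have "\<dots> \<le> best_value d I v c"
    unfolding best_value_def using i assms by (intro Max_ge) auto
  finally show ?thesis .
qed

lemma price_value_mono:
  assumes "finite I" "0 \<le> y" "d \<le> 2" "\<And>j. j \<in> I \<Longrightarrow> v j \<le> w j"
  shows "price_value d I v y \<le> price_value d I w y"
  using num_ge_mono[of I v w y] assms
  by (auto simp: price_value_def intro!: mult_left_mono)

lemma best_value_mono:
  assumes "finite I" "d \<le> 2" "c \<ge> 0" "\<And>j. j \<in> I \<Longrightarrow> v j \<le> w j" "\<And>j. j \<in> I \<Longrightarrow> 0 \<le> v j"
  shows "best_value d I v c \<le> best_value d I w c"
proof -
  have "price_value d I v (v j) \<le> best_value d I w c" if "j \<in> I" for j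
    using price_value_mono[of I "v j" d v w] price_value_le_best_value[of I "v j" d c w] assms that
    by fastforce
  moreover have "c \<le> best_value d I w c"
    unfolding best_value_def using assms by (intro Max_ge) auto
  ultimately show ?thesis
    unfolding best_value_def[of d I v] using assms(1) by (subst Max_le_iff) auto
qed

text \<open>Price values are homogeneous in the bids; only \<open>c\<close> stays fixed, hence an
  inequality.\<close>

lemma best_value_scale_le:
  assumes "finite I" "d \<le> 2" "c \<ge> 0" "t \<ge> 1" "\<And>j. j \<in> I \<Longrightarrow> 0 \<le> v j"
  shows "best_value d I (\<lambda>j. t * v j) c \<le> t * best_value d I v c"
proof -
  have "price_value d I (\<lambda>j. t * v j) (t * v j) \<le> t * best_value d I v c" if "j \<in> I" for j
  proof -
    have "price_value d I (\<lambda>j. t * v j) (t * v j) = t * price_value d I v (v j)"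
      using assms(4) by (simp add: price_value_def num_ge_def)
    also have "\<dots> \<le> t * best_value d I v c"
      using assms that by (intro mult_left_mono price_value_le_best_value) auto
    finally show ?thesis .
  qed
  moreover have c: "c \<le> best_value d I v c"
    unfolding best_value_def using assms by (intro Max_ge) auto
  moreover have "best_value d I v c \<le> t * best_value d I v c"
    using assms c mult_right_mono[of 1 t "best_value d I v c"] by simp
  ultimately show ?thesis
    unfolding best_value_def[of d I "\<lambda>j. t * v j"] using assms(1) by (subst Max_le_iff) auto
qed

lemma num_ge_conv_length:
  "num_ge {1..n} v y = length (filter (\<lambda>x. y \<le> x) (rev (sort (map v [1..<Suc n]))))"
proof -
  have "length (filter (\<lambda>x. y \<le> x) (rev (sort (map v [1..<Suc n])))) =
     size (filter_mset (\<lambda>x. y \<le> x) (mset (map v [1..<Suc n])))"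
    by (metis mset_filter mset_rev mset_sort size_mset)
  also have "\<dots> = length (filter (\<lambda>x. y \<le> x) (map v [1..<Suc n]))"
    by (metis mset_filter size_mset)
  also have "\<dots> = length (filter (\<lambda>j. y \<le> v j) [1..<Suc n])"
    by (simp add: filter_map o_def del: upt_Suc)
  also have "\<dots> = card (set (filter (\<lambda>j. y \<le> v j) [1..<Suc n]))"
    by (rule distinct_card[symmetric]) (simp del: upt_Suc)
  also have "set (filter (\<lambda>j. y \<le> v j) [1..<Suc n]) = {j\<in>{1..n}. y \<le> v j}"
    by (auto simp del: upt_Suc)
  finally show ?thesis by (simp add: num_ge_def)
qed

text \<open>The passage from ranks to demand. In this form ties need no separate treatment.\<close>

lemma ordered_bid_ge_iff:
  assumes "1 \<le> k" "k \<le> n"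
  shows "y \<le> ordered_bid n v k \<longleftrightarrow> k \<le> num_ge {1..n} v y"
proof -
  define xs where "xs = rev (sort (map v [1..<Suc n]))"
  have len: "length xs = n" by (simp add: xs_def)
  have ob: "ordered_bid n v k = xs ! (k - 1)" by (simp only: ordered_bid_def xs_def)
  have desc: "xs ! j \<le> xs ! i" if "i \<le> j" "j < n" for i j
  proof -
    have "sorted (rev xs)" by (simp add: xs_def)
    then show ?thesis using that len by (simp add: sorted_rev_nth_mono)
  qed
  have num: "num_ge {1..n} v y = card {i. i < n \<and> y \<le> xs ! i}"
    unfolding num_ge_conv_length xs_def[symmetric] by (simp add: length_filter_conv_card len)
  show ?thesis
  proof
    assume *: "y \<le> ordered_bid n v k"
    have "{..<k} \<subseteq> {i. i < n \<and> y \<le> xs ! i}"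
    proof
      fix i assume i: "i \<in> {..<k}"
      then have "xs ! (k - 1) \<le> xs ! i" using assms by (intro desc) auto
      then show "i \<in> {i. i < n \<and> y \<le> xs ! i}"
        using * i assms by (auto simp: ob)
    qed
    then have "card {..<k} \<le> card {i. i < n \<and> y \<le> xs ! i}" by (intro card_mono) auto
    then show "k \<le> num_ge {1..n} v y" unfolding num by simp
  next
    assume *: "k \<le> num_ge {1..n} v y"
    show "y \<le> ordered_bid n v k"
    proof (rule ccontr)
      assume "\<not> y \<le> ordered_bid n v k"
      then have "{i. i < n \<and> y \<le> xs ! i} \<subseteq> {..<k - 1}"
        using desc[of "k - 1"] by (force simp: ob not_le)
      then have "card {i. i < n \<and> y \<le> xs ! i} \<le> card {..<k - 1}" by (intro card_mono) auto
      then show False using * assms unfolding num by simp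
    qed
  qed
qed

lemma ordered_bid_in: 
  assumes "1 \<le> k" "k \<le> n"
  obtains j where "j \<in> {1..n}" "ordered_bid n v k = v j"
proof -
  have "ordered_bid n v k \<in> set (rev (sort (map v [1..<Suc n])))"
    unfolding ordered_bid_def by (rule nth_mem) (use assms in auto)
  then have "ordered_bid n v k \<in> v ` {1..n}"
    by (simp del: upt_Suc add: atLeastLessThanSuc_atLeastAtMost)
  then show ?thesis using that by blast
qed

text \<open>The \<open>k\<close>-th largest bid taken as a price has demand at least
  \<open>k\<close>, and a price with demand \<open>k\<close> is at most the \<open>k\<close>-th
  largest bid. The floor \<open>n - d\<close> changes nothing: all bids are at least 1, so the term
  for \<open>k = n\<close> reaches it.\<close>

lemma Max_ordered_bid_eq_best_value:
  assumes n: "n \<ge> 2" and d: "d \<le> 1" and v: "\<And>j. j \<in> {1..n} \<Longrightarrow> 1 \<le> v j"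
  shows "Max ((\<lambda>k. (real k - d) * ordered_bid n v k) ` {2..n}) = best_value d {1..n} v (real n - d)"
    (is "Max ?S = _")
proof (rule antisym)
  have S: "finite ?S" "?S \<noteq> {}" using n by auto
  show "Max ?S \<le> best_value d {1..n} v (real n - d)"
  proof (subst Max_le_iff[OF S], clarify)
    fix k assume k: "k \<in> {2..n}"
    then obtain j where j: "j \<in> {1..n}" "ordered_bid n v k = v j" using ordered_bid_in[of k n v] by auto
    have "k \<le> num_ge {1..n} v (v j)" using ordered_bid_ge_iff[of k n "v j" v] k j by auto
    then have "(real k - d) * ordered_bid n v k \<le> price_value d {1..n} v (v j)"
      using k j v[of j] by (auto simp: price_value_def mult.commute intro!: mult_left_mono)
    also have "\<dots> \<le> best_value d {1..n} v (real n - d)"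
      unfolding best_value_def using j by (intro Max_ge) auto
    finally show "(real k - d) * ordered_bid n v k \<le> best_value d {1..n} v (real n - d)" .
  qed
  have low: "real n - d \<le> Max ?S"
  proof -
    obtain j where j: "j \<in> {1..n}" "ordered_bid n v n = v j" using ordered_bid_in[of n n v] n by auto
    have "real n - d \<le> (real n - d) * ordered_bid n v n"
      using j v[of j] n d mult_left_mono[of 1 "v j" "real n - d"] by simp
    also have "\<dots> \<le> Max ?S" using n S by (intro Max_ge) auto
    finally show ?thesis .
  qed
  have "price_value d {1..n} v (v j) \<le> Max ?S" if j: "j \<in> {1..n}" for j
  proof (cases "2 \<le> num_ge {1..n} v (v j)")
    case True
    let ?k = "num_ge {1..n} v (v j)"
    have k: "?k \<le> n" using num_ge_le[of "{1..n}" v "v j"] by simp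
    have "v j \<le> ordered_bid n v ?k" using ordered_bid_ge_iff[of ?k n "v j" v] True k by simp
    then have "price_value d {1..n} v (v j) \<le> (real ?k - d) * ordered_bid n v ?k"
      using True d by (simp add: price_value_def mult.commute mult_left_mono)
    also have "\<dots> \<le> Max ?S" using True k S by (intro Max_ge) auto
    finally show ?thesis .
  next
    case False
    then show ?thesis using low n d by (simp add: price_value_def)
  qed
  then show "best_value d {1..n} v (real n - d) \<le> Max ?S"
    unfolding best_value_def using low by (subst Max_le_iff) auto
qed

lemma benchmark_F2_eq:
  assumes "n \<ge> 2" "v \<in> bid_vectors n"
  shows "benchmark_F2 n v = best_value 0 {1..n} v (real n)"
  using Max_ordered_bid_eq_best_value[of n 0 v] assms
  by (auto simp: benchmark_F2_def bid_vectors_def PiE_iff)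

lemma benchmark_maxV_eq:
  assumes "n \<ge> 2" "v \<in> bid_vectors n"
  shows "benchmark_maxV n v = best_value 1 {1..n} v (real n - 1)"
proof -
  have "(\<lambda>k. real k * ordered_bid n v (k + 1)) ` {1..<n} = (\<lambda>k. (real k - 1) * ordered_bid n v k) ` {2..n}"
    (is "?A = ?B")
  proof -
    have "{2..n} = Suc ` {1..<n}"
      by (simp only: image_Suc_atLeastLessThan) (simp add: atLeastLessThanSuc_atLeastAtMost numeral_2_eq_2)
    then show ?thesis by (simp add: image_image del: image_Suc_atLeastLessThan)
  qed
  then show ?thesis
    using Max_ordered_bid_eq_best_value[of n 1 v] assms
    by (auto simp: benchmark_maxV_def bid_vectors_def PiE_iff)
qed

section \<open>Equal-revenue bids\<close>

lemma PiM_density: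
  fixes M :: "'a measure" and I :: "'i set"
  assumes I: "finite I" and "sigma_finite_measure M" and "sigma_finite_measure (density M h)"
    and h[measurable]: "h \<in> borel_measurable M"
  shows "PiM I (\<lambda>_. density M h) = density (PiM I (\<lambda>_. M)) (\<lambda>v. \<Prod>i\<in>I. h (v i))"
proof -
  interpret M: sigma_finite_measure M by fact
  interpret N: sigma_finite_measure "density M h" by fact
  interpret PM: product_sigma_finite "\<lambda>_::'i. M" by standard
  interpret PN: product_sigma_finite "\<lambda>_::'i. density M h" by standard
  have [measurable]: "(\<lambda>v. \<Prod>i\<in>I. h (v i)) \<in> borel_measurable (PiM I (\<lambda>_. M))"
    by measurable
  show ?thesis
  proof (rule PN.PiM_eqI[OF I, symmetric])
    show "sets (density (PiM I (\<lambda>_. M)) (\<lambda>v. \<Prod>i\<in>I. h (v i))) = sets (PiM I (\<lambda>_. density M h))"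
      by (auto intro!: sets_PiM_cong)
    fix A :: "'i \<Rightarrow> 'a set" assume A: "\<And>i. i \<in> I \<Longrightarrow> A i \<in> sets (density M h)"
    then have A'[measurable]: "A i \<in> sets M" if "i \<in> I" for i using that by simp
    have box: "PiE I A \<in> sets (PiM I (\<lambda>_. M))" using I A' by (intro sets_PiM_I_finite) auto
    have "emeasure (density (PiM I (\<lambda>_. M)) (\<lambda>v. \<Prod>i\<in>I. h (v i))) (PiE I A) =
      (\<integral>\<^sup>+v. (\<Prod>i\<in>I. h (v i)) * indicator (PiE I A) v \<partial>PiM I (\<lambda>_. M))"
      using box by (subst emeasure_density) auto
    also have "\<dots> = (\<integral>\<^sup>+v. (\<Prod>i\<in>I. h (v i) * indicator (A i) (v i)) \<partial>PiM I (\<lambda>_. M))"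
    proof (rule nn_integral_cong)
      fix v assume "v \<in> space (PiM I (\<lambda>_. M))"
      then have ext: "v \<in> extensional I" by (auto simp: space_PiM PiE_def)
      have "indicator (PiE I A) v = (\<Prod>i\<in>I. indicator (A i) (v i) :: ennreal)"
      proof (cases "\<forall>i\<in>I. v i \<in> A i")
        case True
        then have "v \<in> PiE I A" using ext by (auto simp: PiE_iff)
        moreover have "(\<Prod>i\<in>I. indicator (A i) (v i) :: ennreal) = 1"
          using True by (intro prod.neutral) auto
        ultimately show ?thesis by simp
      next
        case False
        then have "v \<notin> PiE I A" by (auto simp: PiE_iff)
        moreover have "(\<Prod>i\<in>I. indicator (A i) (v i) :: ennreal) = 0"
          using False I by (intro prod_zero) (auto simp: indicator_def)
        ultimately show ?thesis by simp
      qed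
      then show "(\<Prod>i\<in>I. h (v i)) * indicator (PiE I A) v = (\<Prod>i\<in>I. h (v i) * indicator (A i) (v i))"
        by (simp add: prod.distrib)
    qed
    also have "\<dots> = (\<Prod>i\<in>I. \<integral>\<^sup>+x. h x * indicator (A i) x \<partial>M)"
      using I by (intro PM.product_nn_integral_prod) auto
    also have "\<dots> = (\<Prod>i\<in>I. emeasure (density M h) (A i))"
      by (intro prod.cong) (auto simp: emeasure_density)
    finally show "emeasure (density (PiM I (\<lambda>_. M)) (\<lambda>v. \<Prod>i\<in>I. h (v i))) (PiE I A) = \<dots>" .
  qed
qed

lemma measurable_PiM_resample:
  assumes I: "i \<in> I" and "prob_space M" and f: "f \<in> borel_measurable (PiM I (\<lambda>_. M))"
  shows "(\<lambda>v. \<integral>\<^sup>+x. f (v(i := x)) \<partial>M) \<in> borel_measurable (PiM I (\<lambda>_. M))"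
proof -
  interpret M: prob_space M by fact
  have upd: "(\<lambda>(v, x). v(i := x)) \<in> PiM I (\<lambda>_. M) \<Otimes>\<^sub>M M \<rightarrow>\<^sub>M PiM I (\<lambda>_. M)"
    unfolding case_prod_beta by (rule measurable_fun_upd[where J = I]) (use I in auto)
  then have "(\<lambda>(v, x). f (v(i := x))) \<in> borel_measurable (PiM I (\<lambda>_. M) \<Otimes>\<^sub>M M)"
    using measurable_compose[OF upd f] by (simp add: case_prod_beta)
  from M.borel_measurable_nn_integral[OF this] show ?thesis by simp
qed

text \<open>Redrawing one coordinate independently preserves the product law. Integrals over the
  lines \<open>v(i := x)\<close> thus appear inside the same product space, without splitting off
  coordinate \<open>i\<close>.\<close>

lemma nn_integral_PiM_resample:
  fixes M :: "'a measure"
  assumes I: "finite I" "i \<in> I" and "prob_space M"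
    and f[measurable]: "f \<in> borel_measurable (PiM I (\<lambda>_. M))"
  shows "(\<integral>\<^sup>+v. f v \<partial>PiM I (\<lambda>_. M)) = (\<integral>\<^sup>+v. \<integral>\<^sup>+x. f (v(i := x)) \<partial>M \<partial>PiM I (\<lambda>_. M))"
proof -
  interpret M: prob_space M by fact
  interpret product_sigma_finite "\<lambda>_. M" by standard
  define J where "J = I - {i}"
  have J: "I = insert i J" "finite J" "i \<notin> J" using I by (auto simp: J_def)
  have [measurable]: "f \<in> borel_measurable (PiM (insert i J) (\<lambda>_. M))" using f by (simp add: J)
  have gm: "(\<lambda>v. \<integral>\<^sup>+x. f (v(i := x)) \<partial>M) \<in> borel_measurable (PiM (insert i J) (\<lambda>_. M))"
    using measurable_PiM_resample[OF I(2) assms(3) f] by (simp add: J)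
  have "(\<integral>\<^sup>+v. \<integral>\<^sup>+x. f (v(i := x)) \<partial>M \<partial>PiM I (\<lambda>_. M)) =
     (\<integral>\<^sup>+w. \<integral>\<^sup>+y. \<integral>\<^sup>+x. f (w(i := x)) \<partial>M \<partial>M \<partial>PiM J (\<lambda>_. M))"
    unfolding J(1) by (subst product_nn_integral_insert[OF J(2,3) gm]) simp
  also have "\<dots> = (\<integral>\<^sup>+w. \<integral>\<^sup>+x. f (w(i := x)) \<partial>M \<partial>PiM J (\<lambda>_. M))"
    by (simp add: M.emeasure_space_1)
  also have "\<dots> = (\<integral>\<^sup>+v. f v \<partial>PiM I (\<lambda>_. M))"
    unfolding J(1) by (rule product_nn_integral_insert[symmetric]) (use J f in auto)
  finally show ?thesis by simp
qed

section \<open>The equal-revenue law and its null sets\<close>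

definition bid_space :: "real measure" where
  "bid_space = restrict_space lborel {1..}"

definition equal_revenue :: "real measure" where
  "equal_revenue = density bid_space (\<lambda>x. ennreal (1 / x\<^sup>2))"

lemma space_bid_space [simp]: "space bid_space = {1..}"
  by (simp add: bid_space_def space_restrict_space)

lemma sets_equal_revenue [simp, measurable_cong]: "sets equal_revenue = sets bid_space"
  by (simp add: equal_revenue_def)

lemma space_equal_revenue [simp]: "space equal_revenue = {1..}"
  by (simp add: equal_revenue_def)

lemma sets_bid_space: "sets bid_space = sets (restrict_space borel {1..})"
  by (simp add: bid_space_def sets_restrict_space)

lemma measurable_bid_space: "f \<in> borel_measurable borel \<Longrightarrow> f \<in> borel_measurable bid_space"
  unfolding bid_space_def by (rule measurable_restrict_space1) simp

lemma measurable_ident_bid_space [measurable]: "(\<lambda>x. x) \<in> borel_measurable bid_space"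
  by (rule measurable_bid_space) simp

lemma measurable_ident_equal_revenue: "(\<lambda>x. x) \<in> borel_measurable equal_revenue"
  using measurable_ident_bid_space by (simp cong: measurable_cong_sets)

lemma sigma_finite_bid_space: "sigma_finite_measure bid_space"
  unfolding bid_space_def by (rule sigma_finite_measure_restrict_space) (auto intro: lborel.sigma_finite_measure_axioms)

lemma nn_integral_bid_space:
  "(\<integral>\<^sup>+x. f x \<partial>bid_space) = (\<integral>\<^sup>+x. f x * indicator {1..} x \<partial>lborel)"
  unfolding bid_space_def by (rule nn_integral_restrict_space) simp

lemma nn_integral_equal_revenue:
  assumes "f \<in> borel_measurable bid_space"
  shows "(\<integral>\<^sup>+x. f x \<partial>equal_revenue) = (\<integral>\<^sup>+x. ennreal (1 / x\<^sup>2) * f x * indicator {1..} x \<partial>lborel)"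
proof -
  have "(\<integral>\<^sup>+x. f x \<partial>equal_revenue) = (\<integral>\<^sup>+x. ennreal (1 / x\<^sup>2) * f x \<partial>bid_space)"
    unfolding equal_revenue_def using assms by (intro nn_integral_density) auto
  then show ?thesis by (simp add: nn_integral_bid_space)
qed

lemma nn_integral_inverse_square:
  assumes "a > 0"
  shows "(\<integral>\<^sup>+x. ennreal (1 / x\<^sup>2) * indicator {a..} x \<partial>lborel) = ennreal (1 / a)"
proof -
  have "(\<integral>\<^sup>+x. ennreal (1 / x\<^sup>2) * indicator {a..} x \<partial>lborel) = ennreal (0 - (- inverse a))"
  proof (rule nn_integral_FTC_atLeast)
    show "DERIV (\<lambda>x. - inverse x) x :> 1 / x\<^sup>2" if "a \<le> x" for x
      using that assms by (auto intro!: derivative_eq_intros simp: power2_eq_square divide_inverse)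
    show "((\<lambda>x::real. - inverse x) \<longlongrightarrow> 0) at_top"
      using tendsto_minus[OF tendsto_inverse_0_at_top[OF filterlim_ident]] by simp
  qed auto
  then show ?thesis by (simp add: inverse_eq_divide)
qed

lemma emeasure_equal_revenue_atLeast:
  assumes "a \<ge> 1"
  shows "emeasure equal_revenue {a..} = ennreal (1 / a)"
proof -
  have m: "{a..} \<in> sets bid_space"
    using assms by (auto simp: sets_bid_space sets_restrict_space_iff)
  then have "emeasure equal_revenue {a..} = (\<integral>\<^sup>+x. indicator {a..} x \<partial>equal_revenue)" by simp
  also have "\<dots> = (\<integral>\<^sup>+x. ennreal (1 / x\<^sup>2) * indicator {a..} x * indicator {1..} x \<partial>lborel)"
    by (rule nn_integral_equal_revenue) auto
  also have "\<dots> = (\<integral>\<^sup>+x. ennreal (1 / x\<^sup>2) * indicator {a..} x \<partial>lborel)"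
    using assms by (intro nn_integral_cong) (auto simp: indicator_def)
  finally show ?thesis using assms by (simp add: nn_integral_inverse_square)
qed

lemma prob_space_equal_revenue: "prob_space equal_revenue"
  by standard (simp add: emeasure_equal_revenue_atLeast)

lemma sigma_finite_equal_revenue: "sigma_finite_measure equal_revenue"
  using prob_space_equal_revenue by (simp add: finite_measure.axioms(1) prob_space_def)

abbreviation bids_measure :: "nat set \<Rightarrow> (nat \<Rightarrow> real) measure" where
  "bids_measure I \<equiv> PiM I (\<lambda>_. equal_revenue)"

lemma prob_space_bids_measure: "prob_space (bids_measure I)"
proof -
  interpret product_prob_space "\<lambda>_. equal_revenue" I
    by (intro product_prob_spaceI prob_space_equal_revenue)
  show ?thesis by (rule prob_space_axioms)
qed

lemma space_bids_measure: "space (bids_measure I) = (I \<rightarrow>\<^sub>E {1..})"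
  by (simp add: space_PiM)

lemma sets_bids_measure: "sets (bids_measure I) = sets (PiM I (\<lambda>_. bid_space))"
  by (rule sets_PiM_cong) auto

lemma measurable_bid_component:
  assumes "i \<in> I"
  shows "(\<lambda>v. v i) \<in> borel_measurable (bids_measure I)"
  by (rule measurable_compose[OF measurable_component_singleton[OF assms] measurable_ident_equal_revenue])

text \<open>Prices are jointly measurable with respect to Lebesgue measure, whereas averages are
  taken over equal-revenue bids. The density between the two is positive, so they have the same null
  sets.\<close>

lemma AE_bids_measure_iff:
  assumes "finite I"
  shows "(AE v in bids_measure I. P v) \<longleftrightarrow> (AE v in PiM I (\<lambda>_. bid_space). P v)"
proof -
  let ?B = "PiM I (\<lambda>_. bid_space)" and ?h = "\<lambda>v. \<Prod>i\<in>I. ennreal (1 / (v i)\<^sup>2)"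
  have m: "?h \<in> borel_measurable ?B" by measurable
  have e: "bids_measure I = density ?B ?h"
    unfolding equal_revenue_def
    using assms sigma_finite_bid_space sigma_finite_equal_revenue
    by (intro PiM_density) (auto simp: equal_revenue_def)
  have "0 < ?h v" if v: "v \<in> space ?B" for v
  proof -
    have "0 < v i" if "i \<in> I" for i using v that by (fastforce simp: space_PiM PiE_iff)
    then have "0 < (\<Prod>i\<in>I. 1 / (v i)\<^sup>2)" by (intro prod_pos) force
    then show ?thesis by (simp add: prod_ennreal)
  qed
  then show ?thesis
    unfolding e AE_density[OF m] by (intro AE_cong) simp
qed

text \<open>Redraw one of two bids: its new value hits the other bid with probability 0.\<close>

lemma AE_bids_measure_inj_on:
  assumes I: "finite I"
  shows "AE v in bids_measure I. inj_on v I"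
proof -
  have "AE v in bids_measure I. v i \<noteq> v j" if ij: "i \<in> I" "j \<in> I" "i \<noteq> j" for i j
  proof -
    have m[measurable]: "(\<lambda>v. v i) \<in> borel_measurable (bids_measure I)" "(\<lambda>v. v j) \<in> borel_measurable (bids_measure I)"
      using ij by (simp_all only: measurable_bid_component)
    let ?A = "{v \<in> space (bids_measure I). v i = v j}"
    have [measurable]: "?A \<in> sets (bids_measure I)" by measurable
    have "emeasure (bids_measure I) ?A = (\<integral>\<^sup>+v. indicator ?A v \<partial>bids_measure I)" by simp
    also have "\<dots> = (\<integral>\<^sup>+v. \<integral>\<^sup>+x. indicator ?A (v(i := x)) \<partial>equal_revenue \<partial>bids_measure I)"
      by (rule nn_integral_PiM_resample) (use I ij prob_space_equal_revenue in auto)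
    also have "\<dots> = 0"
    proof -
      have "(\<integral>\<^sup>+x. indicator ?A (v(i := x)) \<partial>equal_revenue) = 0" for v
      proof -
        have "(\<integral>\<^sup>+x. indicator ?A (v(i := x)) \<partial>equal_revenue) \<le> (\<integral>\<^sup>+x. indicator {v j} x \<partial>equal_revenue)"
          using ij by (intro nn_integral_mono) (auto simp: indicator_def)
        also have "\<dots> = (\<integral>\<^sup>+x. ennreal (1 / x\<^sup>2) * indicator {v j} x * indicator {1..} x \<partial>lborel)"
          by (rule nn_integral_equal_revenue) auto
        also have "\<dots> = 0"
        proof (rule nn_integral_zero')
          have "AE x in lborel. x \<noteq> v j" by (rule AE_lborel_singleton)
          then show "AE x in lborel. ennreal (1 / x\<^sup>2) * indicator {v j} x * indicator {1..} x = 0"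
            by eventually_elim auto
        qed
        finally show ?thesis by simp
      qed
      then show ?thesis by simp
    qed
    finally show ?thesis by (subst AE_iff_measurable[of ?A]) auto
  qed
  then have "AE v in bids_measure I. \<forall>i\<in>I. \<forall>j\<in>I. i \<noteq> j \<longrightarrow> v i \<noteq> v j"
    by (intro AE_finite_allI[OF I] AE_impI)
  then show ?thesis by eventually_elim (auto simp: inj_on_def)
qed

text \<open>Fubini: above \<open>a\<close>, the inner integral of \<open>g\<close> contributes exactly as much as \<open>x * g x\<close>.\<close>
lemma nn_integral_equal_revenue_line:
  fixes g :: "real \<Rightarrow> real"
  assumes [measurable]: "g \<in> borel_measurable borel" and g: "\<And>y. y \<ge> 1 \<Longrightarrow> 0 \<le> g y"
    and a: "a \<ge> 1" and L: "L \<ge> 0"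
  shows "(\<integral>\<^sup>+x. indicator {a..} x * (ennreal L + (\<integral>\<^sup>+y. ennreal (g y) * indicator {1..x} y \<partial>lborel)) \<partial>equal_revenue)
    = (\<integral>\<^sup>+x. indicator {a..} x * ennreal (x * g x) \<partial>equal_revenue) + ennreal (L / a)
      + (\<integral>\<^sup>+y. ennreal (g y / a) * indicator {1..<a} y \<partial>lborel)"
proof -
  have [measurable]: "(\<lambda>x. \<integral>\<^sup>+y. ennreal (g y) * indicator {1..x} y \<partial>lborel) \<in> borel_measurable borel"
  proof -
    have "(\<lambda>(x, y). ennreal (g y) * (if 1 \<le> y \<and> y \<le> x then 1 else 0)) \<in> borel_measurable ((borel :: real measure) \<Otimes>\<^sub>M lborel)"
      by measurable
    from lborel.borel_measurable_nn_integral[OF this]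
    show ?thesis by (simp add: indicator_def)
  qed
  have "(\<integral>\<^sup>+x. indicator {a..} x * (ennreal L + (\<integral>\<^sup>+y. ennreal (g y) * indicator {1..x} y \<partial>lborel)) \<partial>equal_revenue)
    = (\<integral>\<^sup>+x. ennreal L * indicator {a..} x \<partial>equal_revenue)
    + (\<integral>\<^sup>+x. indicator {a..} x * (\<integral>\<^sup>+y. ennreal (g y) * indicator {1..x} y \<partial>lborel) \<partial>equal_revenue)"
    by (subst nn_integral_add[symmetric]) (auto simp: algebra_simps)
  also have "(\<integral>\<^sup>+x. ennreal L * indicator {a..} x \<partial>equal_revenue) = ennreal (L / a)"
  proof -
    have "{a..} \<in> sets equal_revenue" using a by (auto simp: sets_bid_space sets_restrict_space_iff)
    then show ?thesis
      using a L by (simp add: nn_integral_cmult_indicator emeasure_equal_revenue_atLeast ennreal_mult[symmetric])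
  qed
  also have "(\<integral>\<^sup>+x. indicator {a..} x * (\<integral>\<^sup>+y. ennreal (g y) * indicator {1..x} y \<partial>lborel) \<partial>equal_revenue)
    = (\<integral>\<^sup>+x. ennreal (1 / x\<^sup>2) * (indicator {a..} x * (\<integral>\<^sup>+y. ennreal (g y) * indicator {1..x} y \<partial>lborel)) * indicator {1..} x \<partial>lborel)"
    by (rule nn_integral_equal_revenue) auto
  also have "\<dots> = (\<integral>\<^sup>+x. \<integral>\<^sup>+y. ennreal (1 / x\<^sup>2) * ennreal (g y) * (if a \<le> x \<and> 1 \<le> y \<and> y \<le> x then 1 else 0) \<partial>lborel \<partial>lborel)"
  proof (rule nn_integral_cong)
    fix x :: real
    show "ennreal (1 / x\<^sup>2) * (indicator {a..} x * (\<integral>\<^sup>+y. ennreal (g y) * indicator {1..x} y \<partial>lborel)) * indicator {1..} x =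
      (\<integral>\<^sup>+y. ennreal (1 / x\<^sup>2) * ennreal (g y) * (if a \<le> x \<and> 1 \<le> y \<and> y \<le> x then 1 else 0) \<partial>lborel)"
    proof (cases "a \<le> x")
      case True
      have "(\<integral>\<^sup>+y. ennreal (1 / x\<^sup>2) * ennreal (g y) * (if a \<le> x \<and> 1 \<le> y \<and> y \<le> x then 1 else 0) \<partial>lborel) =
        (\<integral>\<^sup>+y. ennreal (1 / x\<^sup>2) * (ennreal (g y) * indicator {1..x} y) \<partial>lborel)"
        using True by (intro nn_integral_cong) (simp add: indicator_def)
      also have "\<dots> = ennreal (1 / x\<^sup>2) * (\<integral>\<^sup>+y. ennreal (g y) * indicator {1..x} y \<partial>lborel)"
        by (rule nn_integral_cmult) simp
      finally show ?thesis using True a by simp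
    qed simp
  qed
  also have "\<dots> = (\<integral>\<^sup>+y. \<integral>\<^sup>+x. ennreal (1 / x\<^sup>2) * ennreal (g y) * (if a \<le> x \<and> 1 \<le> y \<and> y \<le> x then 1 else 0) \<partial>lborel \<partial>lborel)"
  proof -
    have "(\<lambda>(x, y). ennreal (1 / x\<^sup>2) * ennreal (g y) * (if a \<le> x \<and> 1 \<le> y \<and> y \<le> x then 1 else 0)) \<in> borel_measurable (lborel \<Otimes>\<^sub>M lborel)"
      by measurable
    then show ?thesis by (rule lborel_pair.Fubini'[symmetric])
  qed
  \<comment> \<open>For fixed y the variable x runs over the ray from \<open>max a y\<close>, whose
    mass is \<open>1 / max a y\<close>. Cutting the outer integral at \<open>a\<close> gives the
    last term of the claim and the integral of \<open>x * g x\<close>.\<close>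
  also have "\<dots> = (\<integral>\<^sup>+y. ennreal (g y / max a y) * indicator {1..} y \<partial>lborel)"
  proof (rule nn_integral_cong)
    fix y :: real
    show "(\<integral>\<^sup>+x. ennreal (1 / x\<^sup>2) * ennreal (g y) * (if a \<le> x \<and> 1 \<le> y \<and> y \<le> x then 1 else 0) \<partial>lborel)
      = ennreal (g y / max a y) * indicator {1..} y"
    proof (cases "y \<ge> 1")
      case True
      have "(\<integral>\<^sup>+x. ennreal (1 / x\<^sup>2) * ennreal (g y) * (if a \<le> x \<and> 1 \<le> y \<and> y \<le> x then 1 else 0) \<partial>lborel)
        = (\<integral>\<^sup>+x. ennreal (g y) * (ennreal (1 / x\<^sup>2) * indicator {max a y..} x) \<partial>lborel)"
        using True by (intro nn_integral_cong) (auto simp: indicator_def mult_ac)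
      also have "\<dots> = ennreal (g y) * ennreal (1 / max a y)"
        using a by (subst nn_integral_cmult) (auto simp: nn_integral_inverse_square)
      also have "\<dots> = ennreal (g y / max a y)"
        using g[OF True] a by (subst ennreal_mult[symmetric]) auto
      finally show ?thesis using True by simp
    qed simp
  qed
  also have "\<dots> = (\<integral>\<^sup>+y. ennreal (g y / a) * indicator {1..<a} y + ennreal (g y / y) * indicator {a..} y \<partial>lborel)"
    using a by (intro nn_integral_cong) (auto simp: indicator_def max_def)
  also have "\<dots> = (\<integral>\<^sup>+y. ennreal (g y / a) * indicator {1..<a} y \<partial>lborel) + (\<integral>\<^sup>+y. ennreal (g y / y) * indicator {a..} y \<partial>lborel)"
    by (rule nn_integral_add) auto
  also have "(\<integral>\<^sup>+y. ennreal (g y / y) * indicator {a..} y \<partial>lborel) = (\<integral>\<^sup>+x. indicator {a..} x * ennreal (x * g x) \<partial>equal_revenue)"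
  proof -
    have "(\<integral>\<^sup>+x. indicator {a..} x * ennreal (x * g x) \<partial>equal_revenue) =
      (\<integral>\<^sup>+x. ennreal (1 / x\<^sup>2) * (indicator {a..} x * ennreal (x * g x)) * indicator {1..} x \<partial>lborel)"
      by (rule nn_integral_equal_revenue) auto
    also have "\<dots> = (\<integral>\<^sup>+y. ennreal (g y / y) * indicator {a..} y \<partial>lborel)"
    proof (rule nn_integral_cong)
      fix x :: real
      show "ennreal (1 / x\<^sup>2) * (indicator {a..} x * ennreal (x * g x)) * indicator {1..} x = ennreal (g x / x) * indicator {a..} x"
      proof (cases "a \<le> x")
        case True
        have "ennreal (1 / x\<^sup>2) * ennreal (x * g x) = ennreal (g x / x)"
          using True a g[of x] by (subst ennreal_mult[symmetric]) (auto simp: power2_eq_square)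
        then show ?thesis using True a by simp
      qed simp
    qed
    finally show ?thesis by simp
  qed
  finally show ?thesis by (simp add: ac_simps)
qed

text \<open>
  As a general rule it would make the measurability prover look for maps into \<open>bid_space\<close>
  behind every real-valued function.
\<close>
declare measurable_ident_bid_space [measurable del]

section \<open>The expected benchmark\<close>

text \<open>Otherwise the bidders \<open>{1..n}\<close> are rewritten to \<open>{Suc 0..n}\<close>.\<close>
declare One_nat_def [simp del]

section \<open>Measurability of the sweep in bids and price\<close>

lemma measurable_num_ge:
  assumes "finite I" "\<And>j. j \<in> I \<Longrightarrow> (\<lambda>x. V x j) \<in> borel_measurable M" "Y \<in> borel_measurable M"
  shows "(\<lambda>x. num_ge I (V x) (Y x)) \<in> measurable M (count_space UNIV)"
proof -
  have "(\<lambda>x. \<Sum>j\<in>I. if Y x \<le> V x j then 1 else 0 :: nat) \<in> measurable M (count_space UNIV)"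
    using assms(2,3)[measurable] by measurable
  moreover have "num_ge I v y = (\<Sum>j\<in>I. if y \<le> v j then 1 else 0)" for v y
    using assms(1) by (simp add: num_ge_def sum.If_cases Int_def)
  ultimately show ?thesis by simp
qed

lemma measurable_price_value:
  assumes "finite I" "\<And>j. j \<in> I \<Longrightarrow> (\<lambda>x. V x j) \<in> borel_measurable M" "Y \<in> borel_measurable M"
  shows "(\<lambda>x. price_value d I (V x) (Y x)) \<in> borel_measurable M"
proof -
  note [measurable] = measurable_num_ge[OF assms] assms(3)
  show ?thesis unfolding price_value_def by measurable
qed

lemma Max_insert2:
  fixes A :: "real set"
  assumes "finite A" "A \<noteq> {}"
  shows "Max (insert c (insert x A)) = max c (max x (Max A))"
  using assms by simp

lemma measurable_best_upto:
  assumes I: "finite I" and V: "\<And>j. j \<in> I \<Longrightarrow> (\<lambda>x. V x j) \<in> borel_measurable M" and Y: "Y \<in> borel_measurable M"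
  shows "(\<lambda>x. best_upto d I (V x) c (Y x)) \<in> borel_measurable M"
proof (cases "I = {}")
  case True
  then show ?thesis
    using measurable_price_value[OF assms, where d = d] by (simp add: best_upto_def)
next
  case False
  note [measurable] = measurable_price_value[OF assms] Y
  have [measurable]: "(\<lambda>x. if V x j < Y x then price_value d I (V x) (V x j) else 0) \<in> borel_measurable M" if "j \<in> I" for j
    using measurable_price_value[OF I V V[OF that], where d = d] V[OF that] by measurable
  have "(\<lambda>x. Max ((\<lambda>j. if V x j < Y x then price_value d I (V x) (V x j) else 0) ` I)) \<in> borel_measurable M"
    by (rule borel_measurable_Max) (use I in auto)
  then have "(\<lambda>x. max c (max (price_value d I (V x) (Y x))
      (Max ((\<lambda>j. if V x j < Y x then price_value d I (V x) (V x j) else 0) ` I)))) \<in> borel_measurable M"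
    by measurable
  moreover have "best_upto d I v c y = max c (max (price_value d I v y)
      (Max ((\<lambda>j. if v j < y then price_value d I v (v j) else 0) ` I)))" for v y
    unfolding best_upto_def by (rule Max_insert2) (use False I in auto)
  ultimately show ?thesis by simp
qed

lemma measurable_best_value:
  assumes I: "finite I" "I \<noteq> {}" and V: "\<And>j. j \<in> I \<Longrightarrow> (\<lambda>x. V x j) \<in> borel_measurable M"
  shows "(\<lambda>x. best_value d I (V x) c) \<in> borel_measurable M"
proof -
  have "(\<lambda>x. Max ((\<lambda>j. price_value d I (V x) (V x j)) ` I)) \<in> borel_measurable M"
    by (rule borel_measurable_Max) (use I V in \<open>auto intro: measurable_price_value\<close>)
  then have "(\<lambda>x. max c (Max ((\<lambda>j. price_value d I (V x) (V x j)) ` I))) \<in> borel_measurable M"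
    by measurable
  then show ?thesis using I by (simp add: best_value_def)
qed

lemma measurable_slope:
  assumes "finite I" "\<And>j. j \<in> I \<Longrightarrow> (\<lambda>x. V x j) \<in> borel_measurable M" "Y \<in> borel_measurable M"
  shows "(\<lambda>x. slope a d I (V x) c (Y x)) \<in> borel_measurable M"
proof -
  note [measurable] = measurable_best_upto[OF assms] assms(3)
  have "(\<lambda>x. app_deriv a k (Y x / best_upto d I (V x) c (Y x))) \<in> borel_measurable M" for k
    unfolding app_deriv_def by measurable
  from measurable_compose_countable[OF this measurable_num_ge[OF assms]]
  show ?thesis by (simp add: slope_def)
qed

context price_benchmark
begin

abbreviation "bidders \<equiv> {1..n}"
abbreviation "\<nu> \<equiv> bids_measure bidders"
abbreviation "marginal v y \<equiv> slope a d bidders v (real n - d) y"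
abbreviation "bench v \<equiv> best_value d bidders v (real n - d)"

text \<open>The payment that the sweep assigns to bidder \<open>i\<close> is
  \<open>cumulative v i\<close> minus \<open>v i * marginal v (v i)\<close>. Since the integrals
  live in \<open>ennreal\<close>, the two parts are kept apart, and differences are replaced by
  cancelling a finite sum.\<close>

definition cumulative :: "(nat \<Rightarrow> real) \<Rightarrow> nat \<Rightarrow> ennreal" where
  "cumulative v i = ennreal lam + (\<integral>\<^sup>+y. ennreal (marginal v y) * indicator {1..v i} y \<partial>lborel)"

lemma nd_pos: "real n - d > 0"
  using n2 d by linarith

lemma marginal_bounds:
  assumes "y \<ge> 0"
  shows "0 \<le> marginal v y" "marginal v y \<le> lam" "num_ge bidders v y \<le> 1 \<Longrightarrow> marginal v y = 0"
  using slope_bounds[of bidders y "real n - d" v] assms nd_pos by auto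

lemma bench_ge: "real n - d \<le> bench v"
  unfolding best_value_def by (intro Max_ge) auto

lemma measurable_marginal [measurable]:
  "(\<lambda>y. marginal v y) \<in> borel_measurable borel"
  by (rule measurable_slope) simp_all

lemma measurable_marginal_own:
  assumes "i \<in> bidders"
  shows "(\<lambda>v. marginal v (v i)) \<in> borel_measurable \<nu>"
  by (rule measurable_slope) (simp_all only: finite_atLeastAtMost measurable_bid_component assms)

lemma measurable_bench: "(\<lambda>v. bench v) \<in> borel_measurable \<nu>"
proof (rule measurable_best_value)
  show "bidders \<noteq> {}" using n2 by auto
qed (simp_all only: finite_atLeastAtMost measurable_bid_component)

text \<open>The integral of \<open>num_ge * marginal\<close> is shared among the bidders: bidder
  \<open>i\<close> collects the slope as long as \<open>y \<le> v i\<close>. The initial value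
  \<open>n * lam\<close> supplies one \<open>lam\<close> for each of them.\<close>

lemma sum_cumulative:
  assumes v: "v \<in> space \<nu>" and inj: "inj_on v bidders"
  shows "(\<Sum>i\<in>bidders. cumulative v i) = ennreal (bench v) + (\<Sum>i\<in>bidders. ennreal (v i * marginal v (v i)))"
proof -
  have v1: "1 \<le> v i" if "i \<in> bidders" for i using v that by (auto simp: space_bids_measure PiE_iff)
  define B where "B = Max (v ` bidders)"
  have B: "v j \<le> B" if "j \<in> bidders" for j using that by (auto simp: B_def)
  have B1: "1 \<le> B" using B[of 1] v1[of 1] n2 by simp
  let ?X = "bench v + (\<Sum>j\<in>bidders. v j * marginal v (v j)) - real n * lam"
  have int: "((\<lambda>y. real (num_ge bidders v y) * marginal v y) has_integral ?X) {1..B}"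
    using has_integral_slope_total[of v B] v inj B B1 by (simp add: space_bids_measure)
  have "(\<integral>\<^sup>+y. ennreal (real (num_ge bidders v y) * marginal v y) * indicator {1..B} y \<partial>lborel) = ennreal ?X"
    by (rule nn_integral_has_integral_lebesgue'[OF _ int]) (auto intro!: mult_nonneg_nonneg marginal_bounds)
  moreover have "(\<integral>\<^sup>+y. ennreal (real (num_ge bidders v y) * marginal v y) * indicator {1..B} y \<partial>lborel)
    = (\<integral>\<^sup>+y. (\<Sum>i\<in>bidders. ennreal (marginal v y) * indicator {1..v i} y) \<partial>lborel)"
  proof (rule nn_integral_cong)
    fix y :: real
    show "ennreal (real (num_ge bidders v y) * marginal v y) * indicator {1..B} y =
      (\<Sum>i\<in>bidders. ennreal (marginal v y) * indicator {1..v i} y)"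
    proof (cases "1 \<le> y")
      case True
      have *: "(\<Sum>i\<in>bidders. indicator {1..v i} y) = (of_nat (num_ge bidders v y) :: ennreal)"
        using True by (simp add: num_ge_def indicator_def sum.If_cases Int_def)
      have "indicator {1..B} y * of_nat (num_ge bidders v y) = (of_nat (num_ge bidders v y) :: ennreal)"
      proof (cases "y \<le> B")
        case False
        then have "{j\<in>bidders. y \<le> v j} = {}" using B by fastforce
        then show ?thesis by (simp only: num_ge_def) simp
      qed (use True in simp)
      then have "(\<Sum>i\<in>bidders. ennreal (marginal v y) * indicator {1..v i} y) =
        ennreal (marginal v y) * (indicator {1..B} y * of_nat (num_ge bidders v y))"
        unfolding sum_distrib_left[symmetric] * by simp
      also have "\<dots> = ennreal (real (num_ge bidders v y) * marginal v y) * indicator {1..B} y"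
        using True marginal_bounds(1)[of y v] by (simp add: ennreal_mult ennreal_of_nat_eq_real_of_nat mult_ac)
      finally show ?thesis by simp
    qed simp
  qed
  moreover have "(\<integral>\<^sup>+y. (\<Sum>i\<in>bidders. ennreal (marginal v y) * indicator {1..v i} y) \<partial>lborel) =
    (\<Sum>i\<in>bidders. \<integral>\<^sup>+y. ennreal (marginal v y) * indicator {1..v i} y \<partial>lborel)"
    by (rule nn_integral_sum) auto
  ultimately have "(\<Sum>i\<in>bidders. cumulative v i) = ennreal (real n * lam) + ennreal ?X"
    using lam_pos by (simp add: cumulative_def sum.distrib ennreal_mult ennreal_of_nat_eq_real_of_nat)
  also have "\<dots> = ennreal (real n * lam + ?X)"
  proof (rule ennreal_plus[symmetric])
    show "0 \<le> ?X"
      by (rule has_integral_nonneg[OF int]) (auto intro!: mult_nonneg_nonneg marginal_bounds)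
  qed (use lam_pos in auto)
  also have "\<dots> = ennreal (bench v) + (\<Sum>i\<in>bidders. ennreal (v i * marginal v (v i)))"
  proof -
    have nn: "0 \<le> v j * marginal v (v j)" if "j \<in> bidders" for j
      using v1[OF that] by (intro mult_nonneg_nonneg marginal_bounds) auto
    have "real n * lam + ?X = bench v + (\<Sum>j\<in>bidders. v j * marginal v (v j))" by simp
    moreover have "ennreal (bench v + (\<Sum>j\<in>bidders. v j * marginal v (v j))) =
        ennreal (bench v) + ennreal (\<Sum>j\<in>bidders. v j * marginal v (v j))"
      using bench_ge[of v] nd_pos nn by (intro ennreal_plus sum_nonneg) auto
    ultimately show ?thesis using nn by (simp only: sum_ennreal)
  qed
  finally show ?thesis .
qed

text \<open>The marginal vanishes unless another bid exceeds \<open>v i\<close>, which has probability at most \<open>(n - 1) / v i\<close>.\<close>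
lemma nn_integral_marginal_finite:
  assumes i: "i \<in> bidders"
  shows "(\<integral>\<^sup>+v. ennreal (v i * marginal v (v i)) \<partial>\<nu>) < \<infinity>"
proof -
  have measurable_lam_le: "(\<lambda>v. ennreal lam * (ennreal (v i) * (if v i \<le> v j then 1 else 0))) \<in> borel_measurable \<nu>"
    if "j \<in> bidders" for j
    using measurable_bid_component[OF i, measurable] measurable_bid_component[OF that, measurable] by measurable
  have "(\<integral>\<^sup>+v. ennreal (v i * marginal v (v i)) \<partial>\<nu>) \<le>
     (\<integral>\<^sup>+v. (\<Sum>j\<in>bidders - {i}. ennreal lam * (ennreal (v i) * (if v i \<le> v j then 1 else 0))) \<partial>\<nu>)"
  proof (rule nn_integral_mono)
    fix v assume v: "v \<in> space \<nu>"
    then have v1: "1 \<le> v i" using i by (auto simp: space_bids_measure PiE_iff)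
    show "ennreal (v i * marginal v (v i)) \<le> (\<Sum>j\<in>bidders - {i}. ennreal lam * (ennreal (v i) * (if v i \<le> v j then 1 else 0)))"
    proof (cases "\<exists>j\<in>bidders - {i}. v i \<le> v j")
      case True
      then obtain j where j: "j \<in> bidders - {i}" "v i \<le> v j" by blast
      have "ennreal (v i * marginal v (v i)) \<le> ennreal (lam * v i)"
        using marginal_bounds[of "v i" v] v1 by (intro ennreal_leI) (simp add: mult.commute)
      also have "\<dots> = ennreal lam * (ennreal (v i) * (if v i \<le> v j then 1 else 0))"
        using j v1 lam_pos by (simp add: ennreal_mult)
      also have "\<dots> \<le> (\<Sum>j\<in>bidders - {i}. ennreal lam * (ennreal (v i) * (if v i \<le> v j then 1 else 0)))"
        by (rule member_le_sum) (use j in auto)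
      finally show ?thesis .
    next
      case False
      then have "{j\<in>bidders. v i \<le> v j} = {i}" using i by auto
      then have "marginal v (v i) = 0" using v1 by (intro marginal_bounds) (auto simp: num_ge_def)
      then show ?thesis by simp
    qed
  qed
  also have "\<dots> = (\<Sum>j\<in>bidders - {i}. \<integral>\<^sup>+v. ennreal lam * (ennreal (v i) * (if v i \<le> v j then 1 else 0)) \<partial>\<nu>)"
    by (rule nn_integral_sum) (auto intro!: measurable_lam_le)
  also have "\<dots> = (\<Sum>j\<in>bidders - {i}. ennreal lam)"
  proof (rule sum.cong)
    fix j assume j: "j \<in> bidders - {i}"
    have "(\<integral>\<^sup>+v. ennreal lam * (ennreal (v i) * (if v i \<le> v j then 1 else 0)) \<partial>\<nu>) =
      (\<integral>\<^sup>+v. \<integral>\<^sup>+x. ennreal lam * (ennreal ((v(j := x)) i) * (if (v(j := x)) i \<le> (v(j := x)) j then 1 else 0)) \<partial>equal_revenue \<partial>\<nu>)"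
      by (rule nn_integral_PiM_resample) (use i j prob_space_equal_revenue in \<open>auto intro!: measurable_lam_le\<close>)
    also have "\<dots> = (\<integral>\<^sup>+v. ennreal lam \<partial>\<nu>)"
    proof (rule nn_integral_cong)
      fix v assume "v \<in> space \<nu>"
      then have v1: "1 \<le> v i" using i by (auto simp: space_bids_measure PiE_iff)
      have m: "{v i..} \<in> sets equal_revenue" using v1 by (auto simp: sets_bid_space sets_restrict_space_iff)
      have "(\<integral>\<^sup>+x. ennreal lam * (ennreal ((v(j := x)) i) * (if (v(j := x)) i \<le> (v(j := x)) j then 1 else 0)) \<partial>equal_revenue)
        = (\<integral>\<^sup>+x. ennreal (lam * v i) * indicator {v i..} x \<partial>equal_revenue)"
        using j v1 lam_pos by (intro nn_integral_cong) (auto simp: indicator_def ennreal_mult)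
      also have "\<dots> = ennreal (lam * v i) * ennreal (1 / v i)"
        using m v1 by (simp add: nn_integral_cmult_indicator emeasure_equal_revenue_atLeast)
      also have "\<dots> = ennreal lam" using v1 lam_pos by (simp add: ennreal_mult[symmetric])
      finally show "(\<integral>\<^sup>+x. ennreal lam * (ennreal ((v(j := x)) i) * (if (v(j := x)) i \<le> (v(j := x)) j then 1 else 0)) \<partial>equal_revenue) = ennreal lam" .
    qed
    also have "\<dots> = ennreal lam"
      using prob_space.emeasure_space_1[OF prob_space_bids_measure] by simp
    finally show "(\<integral>\<^sup>+v. ennreal lam * (ennreal (v i) * (if v i \<le> v j then 1 else 0)) \<partial>\<nu>) = ennreal lam" .
  qed simp
  also have "\<dots> < \<infinity>" by (simp add: ennreal_mult_less_top of_nat_less_top)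
  finally show ?thesis .
qed

lemma nn_integral_cumulative_line:
  assumes i: "i \<in> bidders" and a1: "a1 \<ge> 1"
  shows "(\<integral>\<^sup>+x. indicator {a1..} x * cumulative (v(i := x)) i \<partial>equal_revenue)
    = (\<integral>\<^sup>+x. indicator {a1..} x * ennreal (x * marginal (v(i := x)) x) \<partial>equal_revenue) + ennreal (lam / a1)
      + (\<integral>\<^sup>+y. ennreal (marginal (v(i := y)) y / a1) * indicator {1..<a1} y \<partial>lborel)"
proof -
  have m: "(\<lambda>y. marginal (v(i := y)) y) \<in> borel_measurable borel"
  proof (rule measurable_slope)
    show "(\<lambda>x. (v(i := x)) j) \<in> borel_measurable borel" for j by (cases "j = i") auto
  qed auto
  have "cumulative (v(i := x)) i = ennreal lam + (\<integral>\<^sup>+y. ennreal (marginal (v(i := y)) y) * indicator {1..x} y \<partial>lborel)" for x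
  proof -
    have "marginal (v(i := x)) y = marginal (v(i := y)) y" if "y \<le> x" for y
      using that by (rule slope_update) simp
    then show ?thesis
      unfolding cumulative_def by (intro arg_cong2[of _ _ _ _ "(+)"] refl nn_integral_cong) (auto simp: indicator_def)
  qed
  then show ?thesis
    using nn_integral_equal_revenue_line[OF m _ a1, of lam] marginal_bounds(1) lam_pos by simp
qed

text \<open>The slope is at most \<open>lam\<close>, so the sweep below \<open>a1\<close>
  contributes at most \<open>lam * (a1 - 1) / a1\<close>. Together with \<open>lam / a1\<close> this
  is \<open>lam\<close>, wherever the ray starts.\<close>

lemma nn_integral_cumulative_line_le:
  assumes i: "i \<in> bidders" and a1: "a1 \<ge> 1"
  shows "(\<integral>\<^sup>+x. indicator {a1..} x * cumulative (v(i := x)) i \<partial>equal_revenue)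
    \<le> (\<integral>\<^sup>+x. indicator {a1..} x * ennreal (x * marginal (v(i := x)) x) \<partial>equal_revenue) + ennreal lam"
proof -
  have "(\<integral>\<^sup>+y. ennreal (marginal (v(i := y)) y / a1) * indicator {1..<a1} y \<partial>lborel) \<le>
     (\<integral>\<^sup>+y. ennreal (lam / a1) * indicator {1..<a1} y \<partial>lborel)"
  proof (rule nn_integral_mono)
    fix y
    show "ennreal (marginal (v(i := y)) y / a1) * indicator {1..<a1} y \<le> ennreal (lam / a1) * indicator {1..<a1} y"
      using a1 marginal_bounds(2)[of y "v(i := y)"]
      by (cases "1 \<le> y") (auto intro!: mult_right_mono ennreal_leI divide_right_mono)
  qed
  also have "\<dots> = ennreal (lam / a1 * (a1 - 1))"
    using a1 lam_pos by (simp add: nn_integral_cmult_indicator ennreal_mult[symmetric])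
  finally have "ennreal (lam / a1) + (\<integral>\<^sup>+y. ennreal (marginal (v(i := y)) y / a1) * indicator {1..<a1} y \<partial>lborel)
      \<le> ennreal (lam / a1) + ennreal (lam / a1 * (a1 - 1))"
    by (rule add_left_mono)
  also have "\<dots> = ennreal lam"
    using a1 lam_pos by (subst ennreal_plus[symmetric]) (auto simp: field_simps)
  finally show ?thesis
    unfolding nn_integral_cumulative_line[OF assms] add.assoc by (rule add_left_mono)
qed

lemma measurable_cumulative:
  assumes i: "i \<in> bidders"
  shows "(\<lambda>v. cumulative v i) \<in> borel_measurable \<nu>"
proof -
  have c: "(\<lambda>z. fst z j) \<in> borel_measurable (\<nu> \<Otimes>\<^sub>M lborel)" if "j \<in> bidders" for j
    by (rule measurable_compose[OF measurable_fst measurable_bid_component[OF that]])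
  have "(\<lambda>z. marginal (fst z) (snd z)) \<in> borel_measurable (\<nu> \<Otimes>\<^sub>M lborel)"
    by (rule measurable_slope) (simp_all only: finite_atLeastAtMost c, simp)
  then have [measurable]: "(\<lambda>(v, y). marginal v y) \<in> borel_measurable (\<nu> \<Otimes>\<^sub>M lborel)"
    by (simp only: case_prod_beta')
  have [measurable]: "(\<lambda>(v, y::real). v i) \<in> borel_measurable (\<nu> \<Otimes>\<^sub>M lborel)"
    using c[OF i] by (simp only: case_prod_beta')
  have "(\<lambda>(v, y). ennreal (marginal v y) * (if 1 \<le> y \<and> y \<le> v i then 1 else 0)) \<in> borel_measurable (\<nu> \<Otimes>\<^sub>M lborel)"
    by measurable
  from lborel.borel_measurable_nn_integral[OF this]
  show ?thesis by (simp add: cumulative_def indicator_def)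
qed

lemma measurable_marginal_payment:
  assumes i: "i \<in> bidders"
  shows "(\<lambda>v. ennreal (v i * marginal v (v i))) \<in> borel_measurable \<nu>"
  using measurable_bid_component[OF i, measurable] measurable_marginal_own[OF i, measurable]
  by measurable

lemma nn_integral_bench_eq:
  assumes A: "A \<in> sets \<nu>"
  shows "(\<integral>\<^sup>+v. indicator A v * ennreal (bench v) \<partial>\<nu>) + (\<Sum>i\<in>bidders. \<integral>\<^sup>+v. indicator A v * ennreal (v i * marginal v (v i)) \<partial>\<nu>)
    = (\<Sum>i\<in>bidders. \<integral>\<^sup>+v. indicator A v * cumulative v i \<partial>\<nu>)"
proof -
  note [measurable] = A measurable_bench
  have mc: "(\<lambda>v. indicator A v * cumulative v i) \<in> borel_measurable \<nu>" if "i \<in> bidders" for i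
    using measurable_cumulative[OF that, measurable] by measurable
  have mm: "(\<lambda>v. indicator A v * ennreal (v i * marginal v (v i))) \<in> borel_measurable \<nu>" if "i \<in> bidders" for i
    using measurable_marginal_payment[OF that, measurable] by measurable
  have "(\<Sum>i\<in>bidders. \<integral>\<^sup>+v. indicator A v * cumulative v i \<partial>\<nu>) = (\<integral>\<^sup>+v. (\<Sum>i\<in>bidders. indicator A v * cumulative v i) \<partial>\<nu>)"
    by (rule nn_integral_sum[symmetric]) (rule mc)
  also have "\<dots> = (\<integral>\<^sup>+v. indicator A v * ennreal (bench v) + (\<Sum>i\<in>bidders. indicator A v * ennreal (v i * marginal v (v i))) \<partial>\<nu>)"
  proof (rule nn_integral_cong_AE)
    have "AE v in \<nu>. inj_on v bidders" by (rule AE_bids_measure_inj_on) simp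
    with AE_space show "AE v in \<nu>. (\<Sum>i\<in>bidders. indicator A v * cumulative v i) =
        indicator A v * ennreal (bench v) + (\<Sum>i\<in>bidders. indicator A v * ennreal (v i * marginal v (v i)))"
      by eventually_elim (simp add: sum_distrib_left[symmetric] sum_cumulative distrib_left)
  qed
  also have "\<dots> = (\<integral>\<^sup>+v. indicator A v * ennreal (bench v) \<partial>\<nu>) + (\<integral>\<^sup>+v. (\<Sum>i\<in>bidders. indicator A v * ennreal (v i * marginal v (v i))) \<partial>\<nu>)"
  proof (rule nn_integral_add)
    show "(\<lambda>v. \<Sum>i\<in>bidders. indicator A v * ennreal (v i * marginal v (v i))) \<in> borel_measurable \<nu>"
      by (rule borel_measurable_sum) (rule mm)
  qed measurable
  also have "(\<integral>\<^sup>+v. (\<Sum>i\<in>bidders. indicator A v * ennreal (v i * marginal v (v i))) \<partial>\<nu>) =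
    (\<Sum>i\<in>bidders. \<integral>\<^sup>+v. indicator A v * ennreal (v i * marginal v (v i)) \<partial>\<nu>)"
    by (rule nn_integral_sum) (rule mm)
  finally show ?thesis by simp
qed

lemma nn_integral_marginal_sum_finite:
  "(\<Sum>i\<in>bidders. \<integral>\<^sup>+v. indicator A v * ennreal (v i * marginal v (v i)) \<partial>\<nu>) < \<infinity>"
proof -
  have "(\<integral>\<^sup>+v. indicator A v * ennreal (v i * marginal v (v i)) \<partial>\<nu>) < \<infinity>" if "i \<in> bidders" for i
  proof (rule le_less_trans[OF _ nn_integral_marginal_finite[OF that]])
    show "(\<integral>\<^sup>+v. indicator A v * ennreal (v i * marginal v (v i)) \<partial>\<nu>) \<le> (\<integral>\<^sup>+v. ennreal (v i * marginal v (v i)) \<partial>\<nu>)"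
      by (intro nn_integral_mono) (auto simp: indicator_def)
  qed
  then show ?thesis by (simp add: ennreal_sum_less_top less_top)
qed

text \<open>On a full line, \<open>a1 = 1\<close>, nothing of the sweep lies below the ray: the
  cumulative part exceeds the marginal one by exactly \<open>lam\<close>. The marginal parts have a
  finite integral and cancel.\<close>

lemma nn_integral_bench:
  "(\<integral>\<^sup>+v. ennreal (bench v) \<partial>\<nu>) = ennreal (real n * lam)"
proof -
  let ?S = "\<Sum>i\<in>bidders. \<integral>\<^sup>+v. indicator (space \<nu>) v * ennreal (v i * marginal v (v i)) \<partial>\<nu>"
  have line: "(\<integral>\<^sup>+v. indicator (space \<nu>) v * cumulative v i \<partial>\<nu>) =
      (\<integral>\<^sup>+v. indicator (space \<nu>) v * ennreal (v i * marginal v (v i)) \<partial>\<nu>) + ennreal lam" if i: "i \<in> bidders" for i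
  proof -
    have m1: "(\<lambda>v. \<integral>\<^sup>+x. ennreal (x * marginal (v(i := x)) x) \<partial>equal_revenue) \<in> borel_measurable \<nu>"
      using measurable_PiM_resample[OF i prob_space_equal_revenue measurable_marginal_payment[OF i]] by simp
    have "(\<integral>\<^sup>+v. indicator (space \<nu>) v * cumulative v i \<partial>\<nu>) = (\<integral>\<^sup>+v. cumulative v i \<partial>\<nu>)"
      by (intro nn_integral_cong) auto
    also have "\<dots> = (\<integral>\<^sup>+v. \<integral>\<^sup>+x. cumulative (v(i := x)) i \<partial>equal_revenue \<partial>\<nu>)"
      by (rule nn_integral_PiM_resample) (use i prob_space_equal_revenue measurable_cumulative in auto)
    also have "\<dots> = (\<integral>\<^sup>+v. (\<integral>\<^sup>+x. ennreal (x * marginal (v(i := x)) x) \<partial>equal_revenue) + ennreal lam \<partial>\<nu>)"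
    proof (rule nn_integral_cong)
      fix v
      have c: "(\<integral>\<^sup>+x. f x \<partial>equal_revenue) = (\<integral>\<^sup>+x. indicator {1..} x * f x \<partial>equal_revenue)" for f
        by (intro nn_integral_cong) auto
      show "(\<integral>\<^sup>+x. cumulative (v(i := x)) i \<partial>equal_revenue) =
        (\<integral>\<^sup>+x. ennreal (x * marginal (v(i := x)) x) \<partial>equal_revenue) + ennreal lam"
        unfolding c[of "\<lambda>x. cumulative (v(i := x)) i"] c[of "\<lambda>x. ennreal (x * marginal (v(i := x)) x)"]
        using nn_integral_cumulative_line[OF i, of 1 v] by simp
    qed
    also have "\<dots> = (\<integral>\<^sup>+v. \<integral>\<^sup>+x. ennreal (x * marginal (v(i := x)) x) \<partial>equal_revenue \<partial>\<nu>) + ennreal lam"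
      using m1 prob_space.emeasure_space_1[OF prob_space_bids_measure[of bidders]]
      by (subst nn_integral_add) simp_all
    also have "(\<integral>\<^sup>+v. \<integral>\<^sup>+x. ennreal (x * marginal (v(i := x)) x) \<partial>equal_revenue \<partial>\<nu>) = (\<integral>\<^sup>+v. ennreal (v i * marginal v (v i)) \<partial>\<nu>)"
      using nn_integral_PiM_resample[OF _ i prob_space_equal_revenue measurable_marginal_payment[OF i]] by simp
    also have "\<dots> = (\<integral>\<^sup>+v. indicator (space \<nu>) v * ennreal (v i * marginal v (v i)) \<partial>\<nu>)"
      by (intro nn_integral_cong) auto
    finally show ?thesis .
  qed
  have "(\<integral>\<^sup>+v. ennreal (bench v) \<partial>\<nu>) = (\<integral>\<^sup>+v. indicator (space \<nu>) v * ennreal (bench v) \<partial>\<nu>)"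
    by (intro nn_integral_cong) auto
  moreover have "?S + (\<integral>\<^sup>+v. indicator (space \<nu>) v * ennreal (bench v) \<partial>\<nu>) = ?S + ennreal (real n * lam)"
  proof -
    have "(\<Sum>i\<in>bidders. \<integral>\<^sup>+v. indicator (space \<nu>) v * cumulative v i \<partial>\<nu>) = ?S + (\<Sum>i\<in>bidders. ennreal lam)"
      using line by (simp add: sum.distrib)
    also have "(\<Sum>i\<in>bidders. ennreal lam) = ennreal (real n * lam)"
      using lam_pos by (simp add: ennreal_mult ennreal_of_nat_eq_real_of_nat)
    finally show ?thesis using nn_integral_bench_eq[of "space \<nu>"] by (simp add: add.commute)
  qed
  ultimately show ?thesis
    using less_imp_neq[OF nn_integral_marginal_sum_finite[of "space \<nu>"]]
    by (simp only: ennreal_add_left_cancel infinity_ennreal_def) simp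
qed

text \<open>\<open>C i\<close> is the cylinder over the projection of \<open>A\<close> along
  coordinate \<open>i\<close>. Lines outside it miss \<open>A\<close>; lines inside it meet
  \<open>A\<close> in a ray, where the excess of the cumulative part is at most
  \<open>lam\<close>.\<close>

lemma nn_integral_bench_upset_le:
  assumes A: "A \<in> sets \<nu>" and C: "\<And>i. i \<in> bidders \<Longrightarrow> C i \<in> sets \<nu>"
    and AC: "\<And>i v x. i \<in> bidders \<Longrightarrow> v \<in> space \<nu> \<Longrightarrow> x \<ge> 1 \<Longrightarrow> v(i := x) \<in> A \<Longrightarrow> v \<in> C i"
    and ray: "\<And>i v. i \<in> bidders \<Longrightarrow> v \<in> C i \<Longrightarrow> \<exists>a1\<ge>1. \<forall>x\<ge>1. v(i := x) \<in> A \<longleftrightarrow> a1 \<le> x"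
  shows "(\<integral>\<^sup>+v. indicator A v * ennreal (bench v) \<partial>\<nu>) \<le> (\<Sum>i\<in>bidders. ennreal lam * emeasure \<nu> (C i))"
proof -
  note [measurable] = A C
  let ?S = "\<Sum>i\<in>bidders. \<integral>\<^sup>+v. indicator A v * ennreal (v i * marginal v (v i)) \<partial>\<nu>"
  have line: "(\<integral>\<^sup>+v. indicator A v * cumulative v i \<partial>\<nu>) \<le>
      (\<integral>\<^sup>+v. indicator A v * ennreal (v i * marginal v (v i)) \<partial>\<nu>) + ennreal lam * emeasure \<nu> (C i)" if i: "i \<in> bidders" for i
  proof -
    have mm: "(\<lambda>v. indicator A v * ennreal (v i * marginal v (v i))) \<in> borel_measurable \<nu>"
      using measurable_marginal_payment[OF i, measurable] by measurable
    have m1: "(\<lambda>v. \<integral>\<^sup>+x. indicator A (v(i := x)) * ennreal (x * marginal (v(i := x)) x) \<partial>equal_revenue) \<in> borel_measurable \<nu>"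
      using measurable_PiM_resample[OF i prob_space_equal_revenue mm] by simp
    have "(\<integral>\<^sup>+v. indicator A v * cumulative v i \<partial>\<nu>) = (\<integral>\<^sup>+v. \<integral>\<^sup>+x. indicator A (v(i := x)) * cumulative (v(i := x)) i \<partial>equal_revenue \<partial>\<nu>)"
      by (rule nn_integral_PiM_resample)
         (use i prob_space_equal_revenue measurable_cumulative[OF i] A in \<open>auto intro!: borel_measurable_times_ennreal borel_measurable_indicator\<close>)
    also have "\<dots> \<le> (\<integral>\<^sup>+v. (\<integral>\<^sup>+x. indicator A (v(i := x)) * ennreal (x * marginal (v(i := x)) x) \<partial>equal_revenue) + ennreal lam * indicator (C i) v \<partial>\<nu>)"
    proof (rule nn_integral_mono)
      fix v assume v: "v \<in> space \<nu>"
      show "(\<integral>\<^sup>+x. indicator A (v(i := x)) * cumulative (v(i := x)) i \<partial>equal_revenue) \<le>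
        (\<integral>\<^sup>+x. indicator A (v(i := x)) * ennreal (x * marginal (v(i := x)) x) \<partial>equal_revenue) + ennreal lam * indicator (C i) v"
      proof (cases "v \<in> C i")
        case False
        have "(\<integral>\<^sup>+x. indicator A (v(i := x)) * cumulative (v(i := x)) i \<partial>equal_revenue) = (\<integral>\<^sup>+x. 0 \<partial>equal_revenue)"
          using AC[OF i v] False by (intro nn_integral_cong) (auto simp: indicator_def)
        then show ?thesis by simp
      next
        case True
        from ray[OF i this] obtain a1 where a1: "a1 \<ge> 1" "\<And>x. x \<ge> 1 \<Longrightarrow> v(i := x) \<in> A \<longleftrightarrow> a1 \<le> x" by blast
        have c: "(\<integral>\<^sup>+x. indicator A (v(i := x)) * f x \<partial>equal_revenue) = (\<integral>\<^sup>+x. indicator {a1..} x * f x \<partial>equal_revenue)" for f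
          using a1(2) by (intro nn_integral_cong) (auto simp: indicator_def)
        show ?thesis
          unfolding c[of "\<lambda>x. cumulative (v(i := x)) i"] c[of "\<lambda>x. ennreal (x * marginal (v(i := x)) x)"]
          using nn_integral_cumulative_line_le[OF i a1(1), of v] True by simp
      qed
    qed
    also have "\<dots> = (\<integral>\<^sup>+v. \<integral>\<^sup>+x. indicator A (v(i := x)) * ennreal (x * marginal (v(i := x)) x) \<partial>equal_revenue \<partial>\<nu>) + ennreal lam * emeasure \<nu> (C i)"
      using m1 C[OF i] by (subst nn_integral_add) (simp_all add: nn_integral_cmult_indicator)
    also have "(\<integral>\<^sup>+v. \<integral>\<^sup>+x. indicator A (v(i := x)) * ennreal (x * marginal (v(i := x)) x) \<partial>equal_revenue \<partial>\<nu>) = (\<integral>\<^sup>+v. indicator A v * ennreal (v i * marginal v (v i)) \<partial>\<nu>)"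
      using nn_integral_PiM_resample[OF _ i prob_space_equal_revenue mm] by simp
    finally show ?thesis .
  qed
  have "?S + (\<integral>\<^sup>+v. indicator A v * ennreal (bench v) \<partial>\<nu>) \<le> ?S + (\<Sum>i\<in>bidders. ennreal lam * emeasure \<nu> (C i))"
  proof -
    have "(\<Sum>i\<in>bidders. \<integral>\<^sup>+v. indicator A v * cumulative v i \<partial>\<nu>) \<le>
      (\<Sum>i\<in>bidders. (\<integral>\<^sup>+v. indicator A v * ennreal (v i * marginal v (v i)) \<partial>\<nu>) + ennreal lam * emeasure \<nu> (C i))"
      by (rule sum_mono) (rule line)
    then show ?thesis using nn_integral_bench_eq[OF A] by (simp only: sum.distrib add.commute)
  qed
  then show ?thesis
    using less_imp_neq[OF nn_integral_marginal_sum_finite[of A]]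
    by (simp only: ennreal_add_left_cancel_le infinity_ennreal_def) simp
qed

end

section \<open>No auction does better\<close>

definition posted_payment :: "ennreal \<Rightarrow> real \<Rightarrow> ennreal" where
  "posted_payment p x = (if p \<le> ennreal x then p else 0)"

lemma ennreal_payment:
  "ennreal (payment n g \<omega> v i) = posted_payment (g i \<omega> (others n i v)) (v i)"
  by (auto simp: payment_def wins_def posted_payment_def le_less_trans[OF _ ennreal_less_top]
      intro!: ennreal_enn2real)

lemma measurable_posted_payment [measurable]:
  assumes [measurable]: "f \<in> borel_measurable M" "h \<in> borel_measurable M"
  shows "(\<lambda>x. posted_payment (f x) (h x)) \<in> borel_measurable M"
  unfolding posted_payment_def by measurable

text \<open>A price \<open>q \<ge> 1\<close> is accepted with probability \<open>1 / q\<close> and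
  earns 1 on average. A price below 1 is always accepted and earns \<open>q\<close>, an infinite one
  earns nothing.\<close>

lemma nn_integral_posted_payment_le: "(\<integral>\<^sup>+x. posted_payment p x \<partial>equal_revenue) \<le> 1"
proof (cases p)
  case top
  have "(\<integral>\<^sup>+x. posted_payment p x \<partial>equal_revenue) = (\<integral>\<^sup>+x. 0 \<partial>equal_revenue)"
    using top by (intro nn_integral_cong) (auto simp: posted_payment_def top_unique)
  then show ?thesis by simp
next
  case (real q)
  have m: "{max 1 q..} \<in> sets equal_revenue" by (auto simp: sets_bid_space sets_restrict_space_iff)
  have "(\<integral>\<^sup>+x. posted_payment p x \<partial>equal_revenue) = (\<integral>\<^sup>+x. ennreal q * indicator {max 1 q..} x \<partial>equal_revenue)"
    using real by (intro nn_integral_cong) (auto simp: posted_payment_def indicator_def)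
  also have "\<dots> = ennreal (q / max 1 q)"
    using m real by (simp add: nn_integral_cmult_indicator emeasure_equal_revenue_atLeast ennreal_mult[symmetric])
  also have "\<dots> \<le> 1" using real by (simp add: field_simps)
  finally show ?thesis .
qed

lemma others_measure_eq: "others_measure n i = PiM ({1..n} - {i}) (\<lambda>_. bid_space)"
  by (simp add: others_measure_def bid_space_def)

lemma sigma_finite_others_measure: "sigma_finite_measure (others_measure n i)"
proof -
  interpret B: sigma_finite_measure bid_space by (rule sigma_finite_bid_space)
  interpret product_sigma_finite "\<lambda>_. bid_space" by standard
  show ?thesis unfolding others_measure_eq by (rule sigma_finite) simp
qed

lemma bid_vectors_eq_space: "bid_vectors n = space (bids_measure {1..n})"
  by (simp add: bid_vectors_def space_bids_measure)

lemma measurable_others [measurable]: "others n i \<in> bids_measure {1..n} \<rightarrow>\<^sub>M bids_measure ({1..n} - {i})"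
  unfolding others_def[abs_def] by (rule measurable_restrict_subset) auto

lemma AE_others:
  assumes "AE w in others_measure n i. P w"
  shows "AE v in bids_measure {1..n}. P (others n i v)"
proof -
  interpret product_prob_space "\<lambda>_. equal_revenue" "{1..n}"
    by (intro product_prob_spaceI prob_space_equal_revenue)
  have "AE w in bids_measure ({1..n} - {i}). P w"
    using assms unfolding others_measure_eq by (simp add: AE_bids_measure_iff)
  also have "bids_measure ({1..n} - {i}) = distr (bids_measure {1..n}) (bids_measure ({1..n} - {i})) (others n i)"
    unfolding others_def[abs_def] by (rule distr_restrict) auto
  finally show ?thesis by (rule AE_distrD[OF measurable_others])
qed

lemma others_fun_upd [simp]: "others n i (v(i := x)) = others n i v"
  by (auto simp: others_def fun_eq_iff)

text \<open>\<open>P\<close> may fail to be measurable, so the order of the variables is exchanged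
  for a measurable null set that contains the exceptions.\<close>

lemma AE_pair_swap:
  assumes "sigma_finite_measure M" "sigma_finite_measure N" and ae: "AE z in M \<Otimes>\<^sub>M N. P z"
  shows "AE y in N. AE x in M. P (x, y)"
proof -
  interpret M: sigma_finite_measure M by fact
  interpret N: sigma_finite_measure N by fact
  interpret pair_sigma_finite M N by standard
  from ae obtain X where X: "X \<in> sets (M \<Otimes>\<^sub>M N)" "emeasure (M \<Otimes>\<^sub>M N) X = 0" "{z \<in> space (M \<Otimes>\<^sub>M N). \<not> P z} \<subseteq> X"
    unfolding eventually_ae_filter by auto
  have "AE z in M \<Otimes>\<^sub>M N. z \<notin> X" using X by (intro AE_not_in) auto
  then have "AE x in M. AE y in N. (x, y) \<notin> X" by (rule AE_pair)
  moreover have "{z \<in> space (M \<Otimes>\<^sub>M N). (fst z, snd z) \<notin> X} \<in> sets (M \<Otimes>\<^sub>M N)"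
    using X(1) by (simp add: sets.Diff set_diff_eq[symmetric])
  ultimately have "AE y in N. AE x in M. (x, y) \<notin> X" using AE_commute[of "\<lambda>x y. (x, y) \<notin> X"] by simp
  with AE_space show ?thesis
  proof eventually_elim
    case (elim y)
    from elim(2) AE_space show ?case
      by eventually_elim (use elim(1) X(3) in \<open>auto simp: space_pair_measure\<close>)
  qed
qed

lemma ennreal_expected_revenue:
  assumes A: "truthful_auction n M g" and v: "v \<in> bid_vectors n"
  shows "ennreal (expected_revenue n M g v) =
    (\<Sum>i=1..n. \<integral>\<^sup>+\<omega>. posted_payment (g i \<omega> (others n i v)) (v i) \<partial>M)"
proof -
  have pay: "0 \<le> payment n g \<omega> v i" for \<omega> i by (simp add: payment_def)
  have "ennreal (expected_revenue n M g v) = (\<integral>\<^sup>+\<omega>. ennreal (revenue n g \<omega> v) \<partial>M)"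
    unfolding expected_revenue_def
    by (rule nn_integral_eq_integral[symmetric])
       (use integrable_revenue[OF A v] pay in \<open>auto simp: revenue_def intro!: sum_nonneg\<close>)
  also have "\<dots> = (\<integral>\<^sup>+\<omega>. (\<Sum>i=1..n. posted_payment (g i \<omega> (others n i v)) (v i)) \<partial>M)"
    unfolding revenue_def ennreal_payment[symmetric] using pay by (subst sum_ennreal) auto
  also have "\<dots> = (\<Sum>i=1..n. \<integral>\<^sup>+\<omega>. posted_payment (g i \<omega> (others n i v)) (v i) \<partial>M)"
  proof (rule nn_integral_sum)
    fix i assume "i \<in> {1..n}"
    then have [measurable]: "(\<lambda>\<omega>. g i \<omega> (others n i v)) \<in> borel_measurable M"
      using A v by (auto simp: truthful_auction_def)
    show "(\<lambda>\<omega>. posted_payment (g i \<omega> (others n i v)) (v i)) \<in> borel_measurable M"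
      by measurable
  qed
  finally show ?thesis .
qed

text \<open>The price is jointly measurable only for the completion, so the expected payment may
  fail to be a measurable function of the bids. A Borel version \<open>h\<close> of the price
  changes it on a null set of bids at most. The bound follows by redrawing the own bid, on which the
  price does not depend.\<close>

lemma expected_payment_bound:
  assumes A: "truthful_auction n M g" and i: "i \<in> {1..n}"
  obtains E where "E \<in> borel_measurable (bids_measure {1..n})"
    "AE v in bids_measure {1..n}. (\<integral>\<^sup>+\<omega>. posted_payment (g i \<omega> (others n i v)) (v i) \<partial>M) = E v"
    "(\<integral>\<^sup>+v. E v \<partial>bids_measure {1..n}) \<le> 1"
proof -
  let ?\<nu> = "bids_measure {1..n}"
  interpret M: prob_space M using A by (simp add: truthful_auction_def)
  interpret R: prob_space equal_revenue by (rule prob_space_equal_revenue)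
  interpret RM: pair_sigma_finite M equal_revenue by standard
  have "(\<lambda>(\<omega>, w). g i \<omega> w) \<in> borel_measurable (completion (M \<Otimes>\<^sub>M others_measure n i))"
    using A i by (auto simp: truthful_auction_def)
  then obtain h where h: "h \<in> borel_measurable (M \<Otimes>\<^sub>M others_measure n i)"
    "AE z in M \<Otimes>\<^sub>M others_measure n i. (case z of (\<omega>, w) \<Rightarrow> g i \<omega> w) = h z"
    using completion_ex_borel_measurable by blast
  have sets_O: "sets (others_measure n i) = sets (bids_measure ({1..n} - {i}))"
    by (simp add: others_measure_eq sets_bids_measure)
  have oth: "others n i \<in> ?\<nu> \<rightarrow>\<^sub>M others_measure n i"
    using measurable_others[of n i] by (simp add: measurable_cong_sets[OF refl sets_O])
  define E where "E v = (\<integral>\<^sup>+\<omega>. posted_payment (h (\<omega>, others n i v)) (v i) \<partial>M)" for v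
  have hm: "(\<lambda>(v, \<omega>). h (\<omega>, others n i v)) \<in> borel_measurable (?\<nu> \<Otimes>\<^sub>M M)"
    unfolding case_prod_beta'
    by (rule measurable_compose[OF measurable_Pair[OF measurable_snd measurable_compose[OF measurable_fst oth]] h(1)])
  have vm: "(\<lambda>(v, \<omega>). v i) \<in> borel_measurable (?\<nu> \<Otimes>\<^sub>M M)"
    unfolding case_prod_beta' by (rule measurable_compose[OF measurable_fst measurable_bid_component[OF i]])
  have "(\<lambda>(v, \<omega>). posted_payment (h (\<omega>, others n i v)) (v i)) \<in> borel_measurable (?\<nu> \<Otimes>\<^sub>M M)"
    using measurable_posted_payment[OF hm vm] by (simp add: case_prod_beta')
  from M.borel_measurable_nn_integral[OF this] have Em: "E \<in> borel_measurable ?\<nu>"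
    unfolding E_def[abs_def] .
  have "AE w in others_measure n i. AE \<omega> in M. g i \<omega> w = h (\<omega>, w)"
    using AE_pair_swap[OF M.sigma_finite_measure_axioms sigma_finite_others_measure h(2)] by simp
  then have "AE v in ?\<nu>. AE \<omega> in M. g i \<omega> (others n i v) = h (\<omega>, others n i v)"
    by (rule AE_others)
  then have eq: "AE v in ?\<nu>. (\<integral>\<^sup>+\<omega>. posted_payment (g i \<omega> (others n i v)) (v i) \<partial>M) = E v"
    unfolding E_def by eventually_elim (auto intro!: nn_integral_cong_AE elim: eventually_mono)
  have "(\<integral>\<^sup>+v. E v \<partial>?\<nu>) = (\<integral>\<^sup>+v. \<integral>\<^sup>+x. E (v(i := x)) \<partial>equal_revenue \<partial>?\<nu>)"
    by (rule nn_integral_PiM_resample) (use i Em prob_space_equal_revenue in auto)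
  also have "\<dots> \<le> (\<integral>\<^sup>+v. 1 \<partial>?\<nu>)"
  proof (rule nn_integral_mono)
    fix v assume v: "v \<in> space ?\<nu>"
    have w: "others n i v \<in> space (others_measure n i)" using measurable_space[OF oth v] .
    have hw: "(\<lambda>z. h (fst z, others n i v)) \<in> borel_measurable (M \<Otimes>\<^sub>M equal_revenue)"
      by (rule measurable_compose[OF measurable_Pair[OF measurable_fst measurable_const[OF w]] h(1)])
    have "(\<lambda>z. posted_payment (h (fst z, others n i v)) (snd z)) \<in> borel_measurable (M \<Otimes>\<^sub>M equal_revenue)"
      using hw measurable_compose[OF measurable_snd measurable_ident_equal_revenue]
      by (rule measurable_posted_payment)
    then have mp: "(\<lambda>(\<omega>, x). posted_payment (h (\<omega>, others n i v)) x) \<in> borel_measurable (M \<Otimes>\<^sub>M equal_revenue)"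
      by (simp add: case_prod_beta')
    have "(\<integral>\<^sup>+x. E (v(i := x)) \<partial>equal_revenue) = (\<integral>\<^sup>+\<omega>. \<integral>\<^sup>+x. posted_payment (h (\<omega>, others n i v)) x \<partial>equal_revenue \<partial>M)"
      unfolding E_def others_fun_upd fun_upd_same by (rule RM.Fubini'[OF mp])
    also have "\<dots> \<le> (\<integral>\<^sup>+\<omega>. 1 \<partial>M)"
      by (intro nn_integral_mono nn_integral_posted_payment_le)
    also have "\<dots> = 1" by (simp add: M.emeasure_space_1)
    finally show "(\<integral>\<^sup>+x. E (v(i := x)) \<partial>equal_revenue) \<le> 1" .
  qed
  also have "\<dots> = 1" using prob_space.emeasure_space_1[OF prob_space_bids_measure] by simp
  finally show ?thesis using that Em eq by blast
qed

text \<open>Averaging over equal-revenue bids: the benchmark has mean \<open>n * lam\<close>, and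
  each of the \<open>n\<close> expected payments has mean at most 1.\<close>

lemma (in price_benchmark) competitive_ratio_ge:
  assumes A: "truthful_auction n M g"
    and r: "\<And>v. v \<in> bid_vectors n \<Longrightarrow> bench v \<le> r * expected_revenue n M g v"
  shows "lam \<le> r"
proof -
  have "\<forall>i\<in>bidders. \<exists>E. E \<in> borel_measurable \<nu> \<and>
    (AE v in \<nu>. (\<integral>\<^sup>+\<omega>. posted_payment (g i \<omega> (others n i v)) (v i) \<partial>M) = E v) \<and>
    (\<integral>\<^sup>+v. E v \<partial>\<nu>) \<le> 1"
  proof
    fix i assume "i \<in> bidders"
    from expected_payment_bound[OF A this]
    show "\<exists>E. E \<in> borel_measurable \<nu> \<and>
      (AE v in \<nu>. (\<integral>\<^sup>+\<omega>. posted_payment (g i \<omega> (others n i v)) (v i) \<partial>M) = E v) \<and>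
      (\<integral>\<^sup>+v. E v \<partial>\<nu>) \<le> 1"
      by blast
  qed
  then obtain E where E: "\<And>i. i \<in> bidders \<Longrightarrow> E i \<in> borel_measurable \<nu>"
    "\<And>i. i \<in> bidders \<Longrightarrow> AE v in \<nu>. (\<integral>\<^sup>+\<omega>. posted_payment (g i \<omega> (others n i v)) (v i) \<partial>M) = E i v"
    "\<And>i. i \<in> bidders \<Longrightarrow> (\<integral>\<^sup>+v. E i v \<partial>\<nu>) \<le> 1"
    unfolding bchoice_iff by blast
  have rev_nonneg: "0 \<le> expected_revenue n M g v" for v
    unfolding expected_revenue_def revenue_def
    by (intro integral_nonneg_AE AE_I2 sum_nonneg) (simp add: payment_def)
  \<comment> \<open>Moving the inequality to \<open>ennreal\<close> requires a nonnegative factor.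
    The benchmark is positive at the vector of ones, whereas the revenue is never negative.\<close>
  have "r > 0"
  proof (rule ccontr)
    assume "\<not> r > 0"
    have "(\<lambda>i\<in>{1..n}. 1) \<in> bid_vectors n" by (auto simp: bid_vectors_def)
    from r[OF this] bench_ge[of "\<lambda>i\<in>{1..n}. 1"] nd_pos
    have "0 < r * expected_revenue n M g (\<lambda>i\<in>{1..n}. 1)" by linarith
    then show False using \<open>\<not> r > 0\<close> rev_nonneg[of "\<lambda>i\<in>{1..n}. 1"] by (simp add: zero_less_mult_iff)
  qed
  have "AE v in \<nu>. \<forall>i\<in>bidders. (\<integral>\<^sup>+\<omega>. posted_payment (g i \<omega> (others n i v)) (v i) \<partial>M) = E i v"
    using E(2) by (intro AE_finite_allI) auto
  with AE_space have ae: "AE v in \<nu>. ennreal (bench v) \<le> ennreal r * (\<Sum>i\<in>bidders. E i v)"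
  proof eventually_elim
    case (elim v)
    then have v: "v \<in> bid_vectors n" by (simp add: bid_vectors_eq_space)
    have "ennreal (bench v) \<le> ennreal r * ennreal (expected_revenue n M g v)"
      using r[OF v] \<open>r > 0\<close> rev_nonneg[of v] by (simp add: ennreal_mult[symmetric] ennreal_leI)
    then show ?case unfolding ennreal_expected_revenue[OF A v] using elim by simp
  qed
  have "ennreal (real n * lam) = (\<integral>\<^sup>+v. ennreal (bench v) \<partial>\<nu>)" by (rule nn_integral_bench[symmetric])
  also have "\<dots> \<le> (\<integral>\<^sup>+v. ennreal r * (\<Sum>i\<in>bidders. E i v) \<partial>\<nu>)" by (rule nn_integral_mono_AE[OF ae])
  also have "\<dots> = ennreal r * (\<integral>\<^sup>+v. (\<Sum>i\<in>bidders. E i v) \<partial>\<nu>)"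
    by (rule nn_integral_cmult) (rule borel_measurable_sum, rule E(1))
  also have "(\<integral>\<^sup>+v. (\<Sum>i\<in>bidders. E i v) \<partial>\<nu>) = (\<Sum>i\<in>bidders. \<integral>\<^sup>+v. E i v \<partial>\<nu>)"
    by (rule nn_integral_sum) (rule E(1))
  also have "\<dots> \<le> (\<Sum>i\<in>bidders. 1)" by (rule sum_mono) (rule E(3))
  also have "ennreal r * (\<Sum>i\<in>bidders. 1) = ennreal (real n * r)"
    using \<open>r > 0\<close> by (simp add: ennreal_mult ennreal_of_nat_eq_real_of_nat mult.commute)
  finally have "real n * lam \<le> real n * r"
    using \<open>r > 0\<close> by (simp add: mult_left_mono ennreal_le_iff)
  then show ?thesis using n2 by simp
qed

section \<open>Proportional sharing on a finite grid\<close>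

text \<open>A line of the grid with weight \<beta>: \<open>c j\<close> is mass times benchmark of
  its \<open>j\<close>-th cell, and \<open>S j\<close> is the total weight of the other lines
  through that cell, so the line receives the fraction \<beta> / (\<beta> + \<open>S j\<close>) of
  it.\<close>

definition line_load :: "nat \<Rightarrow> (nat \<Rightarrow> real) \<Rightarrow> (nat \<Rightarrow> real) \<Rightarrow> real \<Rightarrow> real" where
  "line_load N c S \<beta> = (\<Sum>j\<le>N. c j * (\<beta> / (\<beta> + S j)))"

text \<open>The largest weight in (0,1] whose load does not exceed \<open>L\<close>. It is below 1
  only for lines that would be overloaded at weight 1, and these are then loaded with exactly
  \<open>L\<close>.\<close>

definition line_weight :: "real \<Rightarrow> nat \<Rightarrow> (nat \<Rightarrow> real) \<Rightarrow> (nat \<Rightarrow> real) \<Rightarrow> real" where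
  "line_weight L N c S = (SOME \<beta>. 0 < \<beta> \<and> \<beta> \<le> 1 \<and> line_load N c S \<beta> \<le> L \<and> (\<beta> < 1 \<longrightarrow> line_load N c S \<beta> = L) \<and>
     (\<forall>\<beta>'. 0 < \<beta>' \<longrightarrow> \<beta>' \<le> 1 \<longrightarrow> line_load N c S \<beta>' \<le> L \<longrightarrow> \<beta>' \<le> \<beta>))"

lemma share_mono:
  fixes x y S T :: real
  assumes "0 \<le> x" "x \<le> y" "0 < T" "T \<le> S"
  shows "x / (x + S) \<le> y / (y + T)"
proof -
  have "x * (y + T) \<le> y * (x + S)"
    using mult_mono[of x y T S] assms by (simp add: algebra_simps)
  then show ?thesis using assms by (simp add: field_simps)
qed

lemma line_load_strict_mono:
  assumes "\<And>j. j \<le> N \<Longrightarrow> 0 < c j" "\<And>j. j \<le> N \<Longrightarrow> 0 < S j" "0 < \<beta>" "\<beta> < \<beta>'"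
  shows "line_load N c S \<beta> < line_load N c S \<beta>'"
  unfolding line_load_def
proof (rule sum_strict_mono)
  fix j assume "j \<in> {..N}"
  then have "0 < c j" "0 < S j" using assms by auto
  moreover from this have "\<beta> / (\<beta> + S j) < \<beta>' / (\<beta>' + S j)"
    using assms by (simp add: field_simps)
  ultimately show "c j * (\<beta> / (\<beta> + S j)) < c j * (\<beta>' / (\<beta>' + S j))" by (simp only: mult_less_cancel_left_pos)
qed auto

lemma line_load_mono:
  assumes "\<And>j. j \<le> N \<Longrightarrow> 0 < c j \<and> c j \<le> c' j" "\<And>j. j \<le> N \<Longrightarrow> 0 < S' j \<and> S' j \<le> S j" "0 < \<beta>"
  shows "line_load N c S \<beta> \<le> line_load N c' S' \<beta>"
  unfolding line_load_def
proof (rule sum_mono)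
  fix j assume "j \<in> {..N}"
  then have j: "0 < c j" "c j \<le> c' j" "0 < S' j" "S' j \<le> S j" using assms by auto
  then show "c j * (\<beta> / (\<beta> + S j)) \<le> c' j * (\<beta> / (\<beta> + S' j))"
    using assms(3) by (intro mult_mono share_mono) auto
qed

lemma line_weight:
  assumes c: "\<And>j. j \<le> N \<Longrightarrow> 0 < c j" and S: "\<And>j. j \<le> N \<Longrightarrow> 0 < S j" and L: "L > 0"
  defines "\<beta> \<equiv> line_weight L N c S"
  shows "0 < \<beta>" "\<beta> \<le> 1" "line_load N c S \<beta> \<le> L" "\<beta> < 1 \<Longrightarrow> line_load N c S \<beta> = L"
    "\<And>\<beta>'. 0 < \<beta>' \<Longrightarrow> \<beta>' \<le> 1 \<Longrightarrow> line_load N c S \<beta>' \<le> L \<Longrightarrow> \<beta>' \<le> \<beta>"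
proof -
  have "\<exists>\<beta>. 0 < \<beta> \<and> \<beta> \<le> 1 \<and> line_load N c S \<beta> \<le> L \<and> (\<beta> < 1 \<longrightarrow> line_load N c S \<beta> = L) \<and>
     (\<forall>\<beta>'. 0 < \<beta>' \<longrightarrow> \<beta>' \<le> 1 \<longrightarrow> line_load N c S \<beta>' \<le> L \<longrightarrow> \<beta>' \<le> \<beta>)"
  proof (cases "line_load N c S 1 \<le> L")
    case True
    then show ?thesis by (intro exI[of _ 1]) auto
  next
    case False
    have "\<exists>x\<ge>0. x \<le> 1 \<and> line_load N c S x = L"
    proof (rule IVT')
      show "line_load N c S 0 \<le> L" using L by (simp add: line_load_def)
      have "\<beta> + S j \<noteq> 0" if "0 \<le> \<beta>" "j \<le> N" for \<beta> j using S[OF that(2)] that by simp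
      then show "continuous_on {0..1} (line_load N c S)"
        unfolding line_load_def[abs_def] by (auto intro!: continuous_intros)
    qed (use False in auto)
    then obtain x where x: "0 \<le> x" "x \<le> 1" "line_load N c S x = L" by blast
    have "x \<noteq> 0" using x(3) L by (auto simp: line_load_def)
    then have x0: "0 < x" using x by simp
    have "\<beta>' \<le> x" if "0 < \<beta>'" "line_load N c S \<beta>' \<le> L" for \<beta>'
      using line_load_strict_mono[of N c S x \<beta>'] c S x0 x(3) that by fastforce
    then show ?thesis using x x0 by (intro exI[of _ x]) auto
  qed
  from someI_ex[OF this]
  show "0 < \<beta>" "\<beta> \<le> 1" "line_load N c S \<beta> \<le> L" "\<beta> < 1 \<Longrightarrow> line_load N c S \<beta> = L"
    "\<And>\<beta>'. 0 < \<beta>' \<Longrightarrow> \<beta>' \<le> 1 \<Longrightarrow> line_load N c S \<beta>' \<le> L \<Longrightarrow> \<beta>' \<le> \<beta>"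
    unfolding \<beta>_def line_weight_def by blast+
qed

text \<open>The load increases with \<open>c\<close> and decreases with \<open>S\<close>. A weight
  that is feasible for \<open>c'\<close> and \<open>S'\<close> is therefore feasible for
  \<open>c\<close> and \<open>S\<close>, where the largest feasible one is at least as big.\<close>

lemma line_weight_antimono:
  assumes "\<And>j. j \<le> N \<Longrightarrow> 0 < c j \<and> c j \<le> c' j" "\<And>j. j \<le> N \<Longrightarrow> 0 < S' j \<and> S' j \<le> S j" "L > 0"
  shows "line_weight L N c' S' \<le> line_weight L N c S"
proof (rule line_weight(5))
  have c': "0 < c' j" if "j \<le> N" for j using assms(1)[OF that] by simp
  have S': "0 < S' j" if "j \<le> N" for j using assms(2)[OF that] by simp
  note w = line_weight[of N c' S' L, OF c' S' assms(3)]
  show "0 < line_weight L N c' S'" "line_weight L N c' S' \<le> 1" using w(1,2) by auto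
  have "line_load N c S (line_weight L N c' S') \<le> line_load N c' S' (line_weight L N c' S')"
    using assms w(1) by (intro line_load_mono) auto
  also have "\<dots> \<le> L" by (rule w(3))
  finally show "line_load N c S (line_weight L N c' S') \<le> L" .
qed (use assms in \<open>auto intro: less_le_trans\<close>)

text \<open>\<open>w\<close> is the law of one bid on the grid. \<open>hall\<close> compares the
  mean of the benchmark over an upward closed set of cells with \<open>L\<close> times the masses of
  the cylinders over its projections. Upward closed sets suffice, because the cells in which all
  weights tend to 0 form such a set.\<close>

locale grid_hall =
  fixes I :: "nat set" and N :: nat and w :: "nat \<Rightarrow> real" and F :: "(nat \<Rightarrow> nat) \<Rightarrow> real" and L :: real
  assumes I: "finite I" "card I \<ge> 2"
    and w: "\<And>j. j \<le> N \<Longrightarrow> 0 < w j" "(\<Sum>j\<le>N. w j) = 1"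
    and Fpos: "\<And>J. J \<in> I \<rightarrow>\<^sub>E {..N} \<Longrightarrow> 0 < F J"
    and Fmono: "\<And>J J'. J \<in> I \<rightarrow>\<^sub>E {..N} \<Longrightarrow> J' \<in> I \<rightarrow>\<^sub>E {..N} \<Longrightarrow> (\<And>i. i \<in> I \<Longrightarrow> J i \<le> J' i) \<Longrightarrow> F J \<le> F J'"
    and L: "L > 0"
    and hall: "\<And>A. A \<subseteq> I \<rightarrow>\<^sub>E {..N} \<Longrightarrow>
       (\<And>J J'. J \<in> A \<Longrightarrow> J' \<in> I \<rightarrow>\<^sub>E {..N} \<Longrightarrow> (\<And>i. i \<in> I \<Longrightarrow> J i \<le> J' i) \<Longrightarrow> J' \<in> A) \<Longrightarrow>
       (\<Sum>J\<in>A. (\<Prod>i\<in>I. w (J i)) * F J) \<le>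
       L * (\<Sum>i\<in>I. \<Sum>J | J \<in> I \<rightarrow>\<^sub>E {..N} \<and> (\<exists>j\<le>N. J(i := j) \<in> A). \<Prod>i\<in>I. w (J i))"
begin

abbreviation "D \<equiv> I \<rightarrow>\<^sub>E {..N}"

definition W :: "(nat \<Rightarrow> nat) \<Rightarrow> real" where
  "W J = (\<Prod>i\<in>I. w (J i))"

text \<open>\<open>wt m i J\<close> depends on the line through \<open>J\<close> in direction \<open>i\<close> only, that is, not on \<open>J i\<close>.\<close>
fun wt :: "nat \<Rightarrow> nat \<Rightarrow> (nat \<Rightarrow> nat) \<Rightarrow> real" where
  "wt 0 i J = 1"
| "wt (Suc m) i J = line_weight L N (\<lambda>j. w j * F (J(i := j))) (\<lambda>j. \<Sum>l\<in>I - {i}. wt m l (J(i := j)))"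

definition rest :: "nat \<Rightarrow> nat \<Rightarrow> (nat \<Rightarrow> nat) \<Rightarrow> real" where
  "rest m i J = (\<Sum>l\<in>I - {i}. wt m l J)"

text \<open>The own weight is already updated, the others are those of round \<open>m\<close>. The
  sums along lines are then exactly the loads that \<open>line_weight\<close> controls; in exchange,
  the shares of a cell may fall short of \<open>F J\<close>.\<close>

definition share :: "nat \<Rightarrow> nat \<Rightarrow> (nat \<Rightarrow> nat) \<Rightarrow> real" where
  "share m i J = F J * (wt (Suc m) i J / (wt (Suc m) i J + rest m i J))"

lemma finite_D: "finite D"
  using I by (intro finite_PiE) auto

lemma upd_D: "J \<in> D \<Longrightarrow> i \<in> I \<Longrightarrow> j \<le> N \<Longrightarrow> J(i := j) \<in> D"
  by (auto simp: PiE_iff extensional_def)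

lemma Wpos: "J \<in> D \<Longrightarrow> W J > 0"
  unfolding W_def using w(1) by (intro prod_pos) auto

lemma cpos: "J \<in> D \<Longrightarrow> i \<in> I \<Longrightarrow> j \<le> N \<Longrightarrow> 0 < w j * F (J(i := j))"
  using w(1) Fpos[OF upd_D] by simp

lemma wt_upd: "wt m i (J(i := x)) = wt m i J"
  by (cases m) auto

declare wt.simps(2) [simp del]

lemma others_nonempty: "I - {i} \<noteq> {}"
proof
  assume "I - {i} = {}"
  then have "I \<subseteq> {i}" by blast
  then have "card I \<le> 1" using card_mono[of "{i}" I] by simp
  then show False using I by simp
qed

lemma wt_pos: "J \<in> D \<Longrightarrow> i \<in> I \<Longrightarrow> 0 < wt m i J \<and> wt m i J \<le> 1"
proof (induction m arbitrary: i J)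
  case (Suc m)
  have "0 < (\<Sum>l\<in>I - {i}. wt m l (J(i := j)))" if "j \<le> N" for j
  proof (rule sum_pos)
    fix l assume "l \<in> I - {i}"
    moreover have "J(i := j) \<in> D" using Suc.prems that by (rule upd_D)
    ultimately show "0 < wt m l (J(i := j))" using Suc.IH by blast
  qed (use I others_nonempty in auto)
  then show ?case using line_weight(1,2)[OF cpos[OF Suc.prems] _ L] by (simp add: wt.simps)
qed simp

lemma rest_pos: "J \<in> D \<Longrightarrow> 0 < rest m i J"
  unfolding rest_def by (rule sum_pos) (use wt_pos I others_nonempty in auto)

lemma wt_Suc: "wt (Suc m) i J = line_weight L N (\<lambda>j. w j * F (J(i := j))) (\<lambda>j. rest m i (J(i := j)))"
  by (simp add: rest_def wt.simps)

lemma wt_decreasing: "J \<in> D \<Longrightarrow> i \<in> I \<Longrightarrow> wt (Suc m) i J \<le> wt m i J"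
proof (induction m arbitrary: i J)
  case 0
  then show ?case using wt_pos[of J i "Suc 0"] by simp
next
  case (Suc m)
  have "rest (Suc m) i (J(i := j)) \<le> rest m i (J(i := j))" if "j \<le> N" for j
    unfolding rest_def
  proof (rule sum_mono)
    fix l assume "l \<in> I - {i}"
    moreover have "J(i := j) \<in> D" using Suc.prems that by (rule upd_D)
    ultimately show "wt (Suc m) l (J(i := j)) \<le> wt m l (J(i := j))" using Suc.IH by blast
  qed
  then show ?case
    unfolding wt_Suc[of "Suc m"] wt_Suc[of m] using Suc.prems
    by (intro line_weight_antimono) (auto simp: L rest_pos upd_D cpos)
qed

text \<open>Higher bids mean a larger benchmark and, by induction, smaller competing weights. Both
  raise the load of a line and so lower its weight.\<close>

lemma wt_antimono:
  assumes "J \<in> D" "J' \<in> D" "\<And>i. i \<in> I \<Longrightarrow> J i \<le> J' i" "i \<in> I"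
  shows "wt m i J' \<le> wt m i J"
  using assms
proof (induction m arbitrary: i J J')
  case (Suc m)
  have "rest m i (J'(i := j)) \<le> rest m i (J(i := j))" if "j \<le> N" for j
    unfolding rest_def
  proof (rule sum_mono)
    fix l assume "l \<in> I - {i}"
    then show "wt m l (J'(i := j)) \<le> wt m l (J(i := j))"
      using Suc.prems that by (intro Suc.IH upd_D) auto
  qed
  moreover have "w j * F (J(i := j)) \<le> w j * F (J'(i := j))" if "j \<le> N" for j
    using Suc.prems that w(1)[OF that] by (intro mult_left_mono Fmono upd_D) auto
  ultimately show ?case
    unfolding wt_Suc using Suc.prems
    by (intro line_weight_antimono) (auto simp: L rest_pos upd_D cpos)
qed simp

lemma share_nonneg: "J \<in> D \<Longrightarrow> i \<in> I \<Longrightarrow> 0 \<le> share m i J"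
  unfolding share_def using wt_pos[of J i "Suc m"] rest_pos[of J m i] Fpos[of J]
  by (intro mult_nonneg_nonneg divide_nonneg_pos) auto

text \<open>Along the own line the own weight is constant, the benchmark grows and the competing
  weights shrink. This monotonicity is what a posted price requires.\<close>

lemma share_line_mono:
  assumes "J \<in> D" "i \<in> I" "j \<le> j'" "j' \<le> N"
  shows "share m i (J(i := j)) \<le> share m i (J(i := j'))"
proof -
  have D: "J(i := j) \<in> D" "J(i := j') \<in> D" using assms upd_D by auto
  have "rest m i (J(i := j')) \<le> rest m i (J(i := j))"
    unfolding rest_def using assms D by (intro sum_mono wt_antimono) auto
  then show ?thesis
    unfolding share_def wt_upd using assms D wt_pos[of J i "Suc m"] rest_pos[OF D(2)] Fpos[OF D(2)]
    by (intro mult_mono share_mono Fmono divide_nonneg_pos add_pos_pos) (auto intro: rest_pos)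
qed

lemma share_line_sum:
  assumes "J \<in> D" "i \<in> I"
  shows "(\<Sum>j\<le>N. w j * share m i (J(i := j))) \<le> L"
    "wt (Suc m) i J < 1 \<Longrightarrow> (\<Sum>j\<le>N. w j * share m i (J(i := j))) = L"
proof -
  have e: "(\<Sum>j\<le>N. w j * share m i (J(i := j))) = line_load N (\<lambda>j. w j * F (J(i := j))) (\<lambda>j. rest m i (J(i := j))) (wt (Suc m) i J)"
    unfolding line_load_def share_def wt_upd by (simp add: mult.assoc)
  show "(\<Sum>j\<le>N. w j * share m i (J(i := j))) \<le> L"
    unfolding e wt_Suc by (rule line_weight(3)) (use assms rest_pos upd_D cpos L in auto)
  assume "wt (Suc m) i J < 1"
  then show "(\<Sum>j\<le>N. w j * share m i (J(i := j))) = L"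
    unfolding e wt_Suc by (rule line_weight(4)[rotated 3]) (use assms rest_pos upd_D cpos L in auto)
qed

text \<open>The next weight is no larger than the present one, so each share is at most the
  proportional share of round \<open>m\<close>, and those add up to \<open>F J\<close>.\<close>

lemma sum_share_le:
  assumes J: "J \<in> D"
  shows "(\<Sum>i\<in>I. share m i J) \<le> F J"
proof -
  define T where "T = (\<Sum>l\<in>I. wt m l J)"
  have Tpos: "0 < T"
    unfolding T_def by (rule sum_pos) (use wt_pos J I others_nonempty in auto)
  have "share m i J \<le> F J * (wt m i J / T)" if i: "i \<in> I" for i
  proof -
    have "wt (Suc m) i J / (wt (Suc m) i J + rest m i J) \<le> wt m i J / (wt m i J + rest m i J)"
      using wt_decreasing[OF J i] wt_pos[OF J i, of "Suc m"] rest_pos[OF J] by (intro share_mono) auto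
    moreover have "wt m i J + rest m i J = T"
      unfolding T_def rest_def using i I by (simp add: sum.remove)
    ultimately show ?thesis
      unfolding share_def using Fpos[OF J] by (intro mult_left_mono) auto
  qed
  then have "(\<Sum>i\<in>I. share m i J) \<le> (\<Sum>i\<in>I. F J * (wt m i J / T))" by (rule sum_mono)
  also have "\<dots> = F J * (T / T)"
    by (simp only: T_def sum_distrib_left sum_divide_distrib)
  also have "\<dots> = F J" using Tpos by simp
  finally show ?thesis .
qed

lemma W_upd:
  assumes "i \<in> I"
  shows "W J * w j = W (J(i := j)) * w (J i)"
proof -
  have "W J = w (J i) * (\<Prod>l\<in>I - {i}. w (J l))" for J
    unfolding W_def using assms I by (intro prod.remove) auto
  moreover have "(\<Prod>l\<in>I - {i}. w ((J(i := j)) l)) = (\<Prod>l\<in>I - {i}. w (J l))"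
    by (intro prod.cong) auto
  ultimately show ?thesis by (simp add: mult_ac)
qed

text \<open>The discrete form of redrawing coordinate \<open>i\<close>. The involution that
  exchanges the old and the new value of this coordinate preserves the weights, by
  \<open>W_upd\<close>.\<close>

lemma resample:
  assumes X: "X \<subseteq> D" "\<And>J j. J \<in> X \<Longrightarrow> j \<le> N \<Longrightarrow> J(i := j) \<in> X" and i: "i \<in> I"
  shows "(\<Sum>J\<in>X. W J * (\<Sum>j\<le>N. w j * h (J(i := j)))) = (\<Sum>J\<in>X. W J * h J)"
proof -
  have "(\<Sum>J\<in>X. W J * (\<Sum>j\<le>N. w j * h (J(i := j)))) = (\<Sum>(J, j)\<in>X \<times> {..N}. W J * w j * h (J(i := j)))"
    unfolding sum.cartesian_product[symmetric] by (simp add: sum_distrib_left mult.assoc)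
  also have "\<dots> = (\<Sum>(J, j)\<in>X \<times> {..N}. W J * w j * h J)"
  proof (rule sum.reindex_bij_witness[of _ "\<lambda>(J, j). (J(i := j), J i)" "\<lambda>(J, j). (J(i := j), J i)"])
    fix z assume z: "z \<in> X \<times> {..N}"
    obtain J j where zz: "z = (J, j)" by (cases z)
    then have J: "J \<in> X" "j \<le> N" "J i \<le> N" using z X(1) i by auto
    show "(case case z of (J, j) \<Rightarrow> (J(i := j), J i) of (J, j) \<Rightarrow> (J(i := j), J i)) = z"
      "(case z of (J, j) \<Rightarrow> (J(i := j), J i)) \<in> X \<times> {..N}"
      using J X(2) by (auto simp: zz)
    show "(case case z of (J, j) \<Rightarrow> (J(i := j), J i) of (J, j) \<Rightarrow> W J * w j * h J) =
        (case z of (J, j) \<Rightarrow> W J * w j * h (J(i := j)))"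
      using W_upd[OF i, of J j] by (simp add: zz)
    show "(case case z of (J, j) \<Rightarrow> (J(i := j), J i) of (J, j) \<Rightarrow> (J(i := j), J i)) = z"
      "(case z of (J, j) \<Rightarrow> (J(i := j), J i)) \<in> X \<times> {..N}"
      using J X(2) by (auto simp: zz)
  qed
  also have "\<dots> = (\<Sum>J\<in>X. W J * h J * (\<Sum>j\<le>N. w j))"
    unfolding sum.cartesian_product[symmetric]
  proof (rule sum.cong)
    fix J
    have "(\<Sum>j\<le>N. W J * w j * h J) = (\<Sum>j\<le>N. W J * h J * w j)" by (simp only: mult_ac)
    then show "(\<Sum>j\<le>N. W J * w j * h J) = W J * h J * (\<Sum>j\<le>N. w j)" by (simp only: sum_distrib_left)
  qed simp
  finally show ?thesis by (simp add: w(2))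
qed

definition limit_wt :: "nat \<Rightarrow> (nat \<Rightarrow> nat) \<Rightarrow> real" where
  "limit_wt i J = lim (\<lambda>m. wt m i J)"

lemma wt_tendsto:
  assumes "J \<in> D" "i \<in> I"
  shows "(\<lambda>m. wt m i J) \<longlonglongrightarrow> limit_wt i J" "0 \<le> limit_wt i J"
proof -
  have "decseq (\<lambda>m. wt m i J)" using wt_decreasing[OF assms] by (rule decseq_SucI)
  then obtain l where l: "(\<lambda>m. wt m i J) \<longlonglongrightarrow> l" "\<forall>m. l \<le> wt m i J"
    by (rule decseq_convergent[of _ 0]) (use wt_pos[OF assms] in \<open>auto intro: less_imp_le\<close>)
  then have "limit_wt i J = l" unfolding limit_wt_def by (intro limI)
  then show "(\<lambda>m. wt m i J) \<longlonglongrightarrow> limit_wt i J" using l by simp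
  then show "0 \<le> limit_wt i J"
    by (rule LIMSEQ_le_const) (use wt_pos[OF assms] in \<open>auto intro: less_imp_le\<close>)
qed

lemma share_tendsto:
  assumes J: "J \<in> D" and i: "i \<in> I" and pos: "0 < (\<Sum>l\<in>I. limit_wt l J)"
  shows "(\<lambda>m. share m i J) \<longlonglongrightarrow> F J * (limit_wt i J / (\<Sum>l\<in>I. limit_wt l J))"
proof -
  have S: "(\<lambda>m. wt (Suc m) i J) \<longlonglongrightarrow> limit_wt i J" using wt_tendsto(1)[OF J i] by (rule LIMSEQ_Suc)
  have "(\<lambda>m. rest m i J) \<longlonglongrightarrow> (\<Sum>l\<in>I - {i}. limit_wt l J)"
    unfolding rest_def by (intro tendsto_sum wt_tendsto J) auto
  moreover have "limit_wt i J + (\<Sum>l\<in>I - {i}. limit_wt l J) = (\<Sum>l\<in>I. limit_wt l J)"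
    using i I by (simp add: sum.remove)
  ultimately have "(\<lambda>m. wt (Suc m) i J + rest m i J) \<longlonglongrightarrow> (\<Sum>l\<in>I. limit_wt l J)"
    using tendsto_add[OF S, of "\<lambda>m. rest m i J" "\<Sum>l\<in>I - {i}. limit_wt l J"] by simp
  then show ?thesis
    unfolding share_def using pos by (intro tendsto_mult tendsto_const tendsto_divide S) auto
qed

text \<open>Only the set \<open>A\<close> of cells where all weights tend to 0 is in doubt. A line
  whose weight tends to 0 is eventually saturated, so direction \<open>i\<close> collects
  \<open>L\<close> times the mass of \<open>Z i\<close>; cells of \<open>Z i\<close> outside
  \<open>A\<close> receive nothing from it in the limit, since another weight stays positive there.
  Hence in the limit \<open>A\<close> collects at least the bound in Hall's condition, thus at least
  its whole benchmark, while no cell ever gets more than its own.\<close>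

lemma sum_share_tendsto:
  assumes J: "J \<in> D"
  shows "(\<lambda>m. \<Sum>i\<in>I. share m i J) \<longlonglongrightarrow> F J"
proof -
  define Z where "Z i = {J \<in> D. limit_wt i J = 0}" for i
  define A where "A = {J \<in> D. \<forall>i\<in>I. limit_wt i J = 0}"
  have pos: "0 < (\<Sum>l\<in>I. limit_wt l J)" if JA: "J \<in> D - A" for J
  proof -
    obtain i where "i \<in> I" "limit_wt i J \<noteq> 0" using JA by (auto simp: A_def)
    then show ?thesis
      using JA wt_tendsto(2)[of J] I by (intro sum_pos2[of I i]) (auto simp: less_le)
  qed
  show ?thesis
  proof (cases "J \<in> A")
    case False
    then have p: "0 < (\<Sum>l\<in>I. limit_wt l J)" using pos J by simp
    have "(\<lambda>m. \<Sum>i\<in>I. share m i J) \<longlonglongrightarrow> (\<Sum>i\<in>I. F J * (limit_wt i J / (\<Sum>l\<in>I. limit_wt l J)))"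
      by (intro tendsto_sum share_tendsto J p)
    also have "(\<Sum>i\<in>I. F J * (limit_wt i J / (\<Sum>l\<in>I. limit_wt l J))) = F J"
      using p by (simp flip: sum_distrib_left sum_divide_distrib)
    finally show ?thesis .
  next
    case True
    have AD: "A \<subseteq> D" by (auto simp: A_def)
    have finA: "finite A" using finite_D AD by (rule rev_finite_subset)
    have ZD: "Z i \<subseteq> D" and AZ: "i \<in> I \<Longrightarrow> A \<subseteq> Z i" for i by (auto simp: Z_def A_def)
    have finZ: "finite (Z i)" for i using finite_D ZD by (rule rev_finite_subset)
    have limit_upd: "limit_wt i (J(i := x)) = limit_wt i J" for i J x
      by (simp only: limit_wt_def wt_upd)
    have Zupd: "J(i := j) \<in> Z i" if "J \<in> Z i" "i \<in> I" "j \<le> N" for i J j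
      using that upd_D by (simp add: Z_def limit_upd)
    have limit_anti: "limit_wt i J' \<le> limit_wt i J"
      if "J \<in> D" "J' \<in> D" "\<And>i. i \<in> I \<Longrightarrow> J i \<le> J' i" "i \<in> I" for i J J'
      by (rule LIMSEQ_le[OF wt_tendsto(1) wt_tendsto(1)]) (use that wt_antimono in auto)
    have "(\<Sum>J\<in>A. W J * F J) \<le> L * (\<Sum>i\<in>I. \<Sum>J | J \<in> D \<and> (\<exists>j\<le>N. J(i := j) \<in> A). W J)"
      unfolding W_def
    proof (rule hall[OF AD])
      fix J J' assume *: "J \<in> A" "J' \<in> D" "\<And>i. i \<in> I \<Longrightarrow> J i \<le> J' i"
      then show "J' \<in> A"
        using limit_anti[of J J'] wt_tendsto(2)[of J'] by (fastforce simp: A_def intro: antisym)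
    qed
    also have "\<dots> \<le> L * (\<Sum>i\<in>I. \<Sum>J\<in>Z i. W J)"
    proof (intro mult_left_mono sum_mono sum_mono2 finZ)
      fix i assume i: "i \<in> I"
      \<comment> \<open>The limit weight is constant along lines in direction \<open>i\<close>, so
        \<open>Z i\<close> contains every line that meets \<open>A\<close>.\<close>
      show "{J \<in> D. \<exists>j\<le>N. J(i := j) \<in> A} \<subseteq> Z i"
        using AZ[OF i] i by (auto simp: Z_def limit_upd subset_eq)
      show "0 \<le> W J" if "J \<in> Z i - {J \<in> D. \<exists>j\<le>N. J(i := j) \<in> A}" for J
        using that Wpos[of J] by (auto simp: Z_def intro: less_imp_le)
    qed (use L in auto)
    finally have cap: "(\<Sum>J\<in>A. W J * F J) \<le> (\<Sum>i\<in>I. L * (\<Sum>J\<in>Z i. W J))" by (simp add: sum_distrib_left)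
    have line: "(\<lambda>m. \<Sum>J\<in>Z i. W J * share m i J) \<longlonglongrightarrow> L * (\<Sum>J\<in>Z i. W J)" if i: "i \<in> I" for i
    proof -
      have "\<forall>\<^sub>F m in sequentially. \<forall>J\<in>Z i. wt (Suc m) i J < 1"
      proof (intro eventually_ball_finite finZ ballI)
        fix J assume "J \<in> Z i"
        then have "(\<lambda>m. wt (Suc m) i J) \<longlonglongrightarrow> 0" using wt_tendsto(1)[of J i] i LIMSEQ_Suc by (fastforce simp: Z_def)
        then show "\<forall>\<^sub>F m in sequentially. wt (Suc m) i J < 1" by (rule order_tendstoD) simp
      qed
      then have "\<forall>\<^sub>F m in sequentially. (\<Sum>J\<in>Z i. W J * share m i J) = L * (\<Sum>J\<in>Z i. W J)"
      proof eventually_elim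
        case (elim m)
        have "(\<Sum>J\<in>Z i. W J * share m i J) = (\<Sum>J\<in>Z i. W J * (\<Sum>j\<le>N. w j * share m i (J(i := j))))"
          by (rule resample[symmetric]) (use ZD Zupd i in auto)
        also have "\<dots> = (\<Sum>J\<in>Z i. W J * L)"
        proof (rule sum.cong)
          fix J assume "J \<in> Z i"
          then show "W J * (\<Sum>j\<le>N. w j * share m i (J(i := j))) = W J * L"
            using share_line_sum(2)[of J i m] elim i ZD by auto
        qed simp
        finally show ?case by (simp add: sum_distrib_left mult.commute)
      qed
      then show ?thesis by (rule tendsto_eventually)
    qed
    have off: "(\<lambda>m. \<Sum>J\<in>Z i - A. W J * share m i J) \<longlonglongrightarrow> 0" if i: "i \<in> I" for i
    proof -
      have "(\<lambda>m. \<Sum>J\<in>Z i - A. W J * share m i J) \<longlonglongrightarrow>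
        (\<Sum>J\<in>Z i - A. W J * (F J * (limit_wt i J / (\<Sum>l\<in>I. limit_wt l J))))"
        by (intro tendsto_sum tendsto_mult tendsto_const share_tendsto i pos) (auto simp: Z_def)
      also have "(\<Sum>J\<in>Z i - A. W J * (F J * (limit_wt i J / (\<Sum>l\<in>I. limit_wt l J)))) = 0"
        by (intro sum.neutral) (auto simp: Z_def)
      finally show ?thesis .
    qed
    have split: "(\<Sum>J\<in>A. W J * share m i J) = (\<Sum>J\<in>Z i. W J * share m i J) - (\<Sum>J\<in>Z i - A. W J * share m i J)"
      if "i \<in> I" for i m
      using AZ[OF that] finZ by (simp add: sum_diff)
    have "(\<lambda>m. \<Sum>i\<in>I. \<Sum>J\<in>A. W J * share m i J) \<longlonglongrightarrow> (\<Sum>i\<in>I. L * (\<Sum>J\<in>Z i. W J) - 0)"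
    proof (rule tendsto_sum)
      fix i assume i: "i \<in> I"
      show "(\<lambda>m. \<Sum>J\<in>A. W J * share m i J) \<longlonglongrightarrow> L * (\<Sum>J\<in>Z i. W J) - 0"
        unfolding split[OF i] by (intro tendsto_diff line off i)
    qed
    moreover have "(\<Sum>i\<in>I. \<Sum>J\<in>A. W J * share m i J) = (\<Sum>J\<in>A. W J * (\<Sum>i\<in>I. share m i J))" for m
      by (subst sum.swap) (simp add: sum_distrib_left)
    ultimately have "(\<lambda>m. \<Sum>J\<in>A. W J * (\<Sum>i\<in>I. share m i J)) \<longlonglongrightarrow> (\<Sum>i\<in>I. L * (\<Sum>J\<in>Z i. W J))"
      by simp
    then have lim: "(\<lambda>m. (\<Sum>J\<in>A. W J * F J) - (\<Sum>J\<in>A. W J * (\<Sum>i\<in>I. share m i J))) \<longlonglongrightarrow>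
        (\<Sum>J\<in>A. W J * F J) - (\<Sum>i\<in>I. L * (\<Sum>J\<in>Z i. W J))"
      by (intro tendsto_diff tendsto_const)
    \<comment> \<open>All cells of \<open>A\<close> have a nonnegative deficit, so each single
      deficit is controlled by the total, which tends to 0.\<close>
    have gap: "W J * (F J - (\<Sum>i\<in>I. share m i J)) \<le> (\<Sum>J\<in>A. W J * F J) - (\<Sum>J\<in>A. W J * (\<Sum>i\<in>I. share m i J))" for m
    proof -
      have "W J * (F J - (\<Sum>i\<in>I. share m i J)) \<le> (\<Sum>J\<in>A. W J * (F J - (\<Sum>i\<in>I. share m i J)))"
      proof (rule member_le_sum[OF True])
        fix K assume "K \<in> A - {J}"
        then have "K \<in> D" using AD by auto
        then show "0 \<le> W K * (F K - (\<Sum>i\<in>I. share m i K))"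
          using Wpos[of K] sum_share_le[of K m] by simp
      qed (rule finA)
      then show ?thesis by (simp add: algebra_simps sum_subtractf)
    qed
    have gap0: "0 \<le> W J * (F J - (\<Sum>i\<in>I. share m i J))" for m
      using Wpos[OF J] sum_share_le[OF J, of m] by simp
    have "0 \<le> (\<Sum>J\<in>A. W J * F J) - (\<Sum>i\<in>I. L * (\<Sum>J\<in>Z i. W J))"
      by (rule LIMSEQ_le_const[OF lim]) (use gap gap0 order_trans in blast)
    then have "(\<Sum>J\<in>A. W J * F J) - (\<Sum>i\<in>I. L * (\<Sum>J\<in>Z i. W J)) = 0" using cap by simp
    with lim have "(\<lambda>m. (\<Sum>J\<in>A. W J * F J) - (\<Sum>J\<in>A. W J * (\<Sum>i\<in>I. share m i J))) \<longlonglongrightarrow> 0" by simp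
    then have "(\<lambda>m. W J * (F J - (\<Sum>i\<in>I. share m i J))) \<longlonglongrightarrow> 0"
      by (rule tendsto_sandwich[OF _ _ tendsto_const, rotated 2]) (use gap gap0 in auto)
    then have "(\<lambda>m. F J - (W J * (F J - (\<Sum>i\<in>I. share m i J))) / W J) \<longlonglongrightarrow> F J - 0 / W J"
      using Wpos[OF J] by (intro tendsto_intros) auto
    then show ?thesis using Wpos[OF J] by simp
  qed
qed

lemma exists_monotone_shares:
  assumes "\<epsilon> > 0"
  obtains R where "\<And>i J. i \<in> I \<Longrightarrow> J \<in> D \<Longrightarrow> 0 \<le> R i J"
    "\<And>i J j j'. i \<in> I \<Longrightarrow> J \<in> D \<Longrightarrow> j \<le> j' \<Longrightarrow> j' \<le> N \<Longrightarrow> R i (J(i := j)) \<le> R i (J(i := j'))"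
    "\<And>i J. i \<in> I \<Longrightarrow> J \<in> D \<Longrightarrow> (\<Sum>j\<le>N. w j * R i (J(i := j))) \<le> L"
    "\<And>J. J \<in> D \<Longrightarrow> F J - \<epsilon> \<le> (\<Sum>i\<in>I. R i J)"
proof -
  have "\<forall>\<^sub>F m in sequentially. \<forall>J\<in>D. F J - \<epsilon> < (\<Sum>i\<in>I. share m i J)"
  proof (intro eventually_ball_finite finite_D ballI)
    fix J assume "J \<in> D"
    then show "\<forall>\<^sub>F m in sequentially. F J - \<epsilon> < (\<Sum>i\<in>I. share m i J)"
      using assms by (intro order_tendstoD(1)[OF sum_share_tendsto]) auto
  qed
  from eventually_happens'[OF sequentially_bot this]
  obtain m where m: "\<forall>J\<in>D. F J - \<epsilon> < (\<Sum>i\<in>I. share m i J)" by blast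
  show ?thesis
  proof (rule that[of "share m"])
    show "F J - \<epsilon> \<le> (\<Sum>i\<in>I. share m i J)" if "J \<in> D" for J
      using m that by (auto intro: less_imp_le)
  qed (rule share_nonneg share_line_mono share_line_sum(1); assumption)+
qed

end

section \<open>Auctions with prices on a grid\<close>

text \<open>For bids from 1 on, this is the integer part of the logarithm to base \<open>t\<close>,
  cut off at \<open>N\<close>. Counting grid points gives monotonicity and measurability at
  once.\<close>

definition grid_index :: "real \<Rightarrow> nat \<Rightarrow> real \<Rightarrow> nat" where
  "grid_index t N x = card {j \<in> {1..N}. t ^ j \<le> x}"

lemma grid_index_le: "grid_index t N x \<le> N"
proof -
  have "card {j \<in> {1..N}. t ^ j \<le> x} \<le> card {1..N}" by (intro card_mono) auto
  then show ?thesis by (simp add: grid_index_def)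
qed

lemma le_grid_index_iff:
  assumes t: "t > 1" and x: "x \<ge> 1" and j: "j \<le> N"
  shows "j \<le> grid_index t N x \<longleftrightarrow> t ^ j \<le> x"
proof (cases "t ^ j \<le> x")
  case True
  have "{1..j} \<subseteq> {j \<in> {1..N}. t ^ j \<le> x}"
  proof
    fix l assume l: "l \<in> {1..j}"
    then have "t ^ l \<le> t ^ j" using t by (intro power_increasing) auto
    then show "l \<in> {j \<in> {1..N}. t ^ j \<le> x}" using True l j by auto
  qed
  then have "card {1..j} \<le> card {j \<in> {1..N}. t ^ j \<le> x}" by (intro card_mono) auto
  then show ?thesis using True by (simp add: grid_index_def)
next
  case False
  then have j0: "j \<noteq> 0" using x by (cases j) auto
  have "{j \<in> {1..N}. t ^ j \<le> x} \<subseteq> {1..<j}"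
  proof
    fix l assume l: "l \<in> {j \<in> {1..N}. t ^ j \<le> x}"
    have "l < j"
    proof (rule ccontr)
      assume "\<not> l < j"
      then have "t ^ j \<le> t ^ l" using t by (intro power_increasing) auto
      then show False using l False by auto
    qed
    then show "l \<in> {1..<j}" using l by auto
  qed
  then have "card {j \<in> {1..N}. t ^ j \<le> x} \<le> card {1..<j}" by (intro card_mono) auto
  then show ?thesis using False j0 by (simp add: grid_index_def)
qed

lemma grid_index_power:
  assumes "t > 1" "j \<le> N"
  shows "grid_index t N (t ^ j) = j"
proof (rule antisym)
  have x: "1 \<le> t ^ j" using assms by (simp add: one_le_power)
  show "j \<le> grid_index t N (t ^ j)" using le_grid_index_iff[OF assms(1) x assms(2)] by simp
  have "t ^ grid_index t N (t ^ j) \<le> t ^ j"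
    using le_grid_index_iff[OF assms(1) x grid_index_le[of t N "t ^ j"]] by simp
  then show "grid_index t N (t ^ j) \<le> j" using assms by (simp add: power_increasing_iff)
qed

lemma power_grid_index_le:
  assumes "t > 1" "x \<ge> 1"
  shows "t ^ grid_index t N x \<le> x"
  using le_grid_index_iff[OF assms grid_index_le] by blast

lemma less_power_Suc_grid_index:
  assumes "t > 1" "x \<ge> 1" "x < t ^ N"
  shows "x < t ^ Suc (grid_index t N x)"
proof -
  have "grid_index t N x < N"
    using le_grid_index_iff[OF assms(1,2), of N N] assms(3) grid_index_le[of t N x] by linarith
  then show ?thesis
    using le_grid_index_iff[OF assms(1,2), of "Suc (grid_index t N x)" N] by simp
qed

lemma grid_index_mono: "x \<le> y \<Longrightarrow> grid_index t N x \<le> grid_index t N y"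
  unfolding grid_index_def by (intro card_mono) auto

lemma measurable_grid_index: "grid_index t N \<in> measurable borel (count_space UNIV)"
proof -
  have "(\<lambda>x. \<Sum>j\<in>{1..N}. if t ^ j \<le> x then 1 else 0 :: nat) \<in> measurable borel (count_space UNIV)"
    by measurable
  moreover have "grid_index t N x = (\<Sum>j\<in>{1..N}. if t ^ j \<le> x then 1 else 0)" for x
    by (simp add: grid_index_def sum.If_cases Int_def)
  ultimately show ?thesis by (simp add: fun_eq_iff[of "grid_index t N"] cong: measurable_cong)
qed

text \<open>The equal-revenue mass of the cell from \<open>t ^ j\<close> up to the next grid point;
  the last cell is unbounded.\<close>

definition grid_mass :: "real \<Rightarrow> nat \<Rightarrow> nat \<Rightarrow> real" where
  "grid_mass t N j = (if j < N then 1 / t ^ j - 1 / t ^ Suc j else 1 / t ^ j)"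

lemma grid_mass_pos: "t > 1 \<Longrightarrow> 0 < grid_mass t N j"
  by (auto simp: grid_mass_def field_simps)

lemma sum_grid_mass:
  shows "(\<Sum>j\<le>N. grid_mass t N j) = 1"
proof -
  have "(\<Sum>j<k. 1 / t ^ j - 1 / t ^ Suc j) = 1 - 1 / t ^ k" for k
    by (induction k) auto
  then have "(\<Sum>j<N. grid_mass t N j) = 1 - 1 / t ^ N" by (simp add: grid_mass_def)
  then show ?thesis by (simp add: lessThan_Suc_atMost[symmetric] grid_mass_def)
qed

lemma emeasure_grid_cell:
  assumes t: "t > 1" and j: "j \<le> N"
  shows "emeasure equal_revenue {x. 1 \<le> x \<and> grid_index t N x = j} = ennreal (grid_mass t N j)"
proof -
  have p1: "1 \<le> t ^ j" for j using t by (simp add: one_le_power)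
  have m: "{a..} \<in> sets equal_revenue" if "a \<ge> 1" for a
    using that by (auto simp: sets_bid_space sets_restrict_space_iff)
  show ?thesis
  proof (cases "j < N")
    case True
    have "{x. 1 \<le> x \<and> grid_index t N x = j} = {t ^ j..} - {t ^ Suc j..}"
    proof (intro set_eqI iffI)
      fix x assume x: "x \<in> {x. 1 \<le> x \<and> grid_index t N x = j}"
      then show "x \<in> {t ^ j..} - {t ^ Suc j..}"
        using le_grid_index_iff[OF t, of x j N] le_grid_index_iff[OF t, of x "Suc j" N] True by auto
    next
      fix x assume x: "x \<in> {t ^ j..} - {t ^ Suc j..}"
      then have "1 \<le> x" using p1[of j] by (meson DiffD1 atLeast_iff order_trans)
      then show "x \<in> {x. 1 \<le> x \<and> grid_index t N x = j}"
        using x le_grid_index_iff[OF t, of x j N] le_grid_index_iff[OF t, of x "Suc j" N] True by auto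
    qed
    moreover have "emeasure equal_revenue ({t ^ j..} - {t ^ Suc j..}) =
        emeasure equal_revenue {t ^ j..} - emeasure equal_revenue {t ^ Suc j..}"
    proof (rule emeasure_Diff)
      show "{t ^ Suc j..} \<subseteq> {t ^ j..}" using t power_increasing[of j "Suc j" t] by auto
    qed (use m[OF p1[of j]] m[OF p1[of "Suc j"]] emeasure_equal_revenue_atLeast[OF p1[of "Suc j"]] in \<open>auto simp del: power_Suc\<close>)
    ultimately show ?thesis
      using True t by (simp add: emeasure_equal_revenue_atLeast[OF p1] grid_mass_def ennreal_minus del: power_Suc)
  next
    case False
    then have "j = N" using j by simp
    have "{x. 1 \<le> x \<and> grid_index t N x = j} = {t ^ j..}"
    proof (intro set_eqI iffI)
      fix x assume "x \<in> {x. 1 \<le> x \<and> grid_index t N x = j}"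
      then show "x \<in> {t ^ j..}" using le_grid_index_iff[OF t, of x j N] j by simp
    next
      fix x assume x: "x \<in> {t ^ j..}"
      then have "1 \<le> x" using p1[of j] by (meson atLeast_iff order_trans)
      then show "x \<in> {x. 1 \<le> x \<and> grid_index t N x = j}"
        using x le_grid_index_iff[OF t, of x j N] grid_index_le[of t N x] \<open>j = N\<close> by auto
    qed
    then show ?thesis using \<open>j = N\<close> by (simp add: emeasure_equal_revenue_atLeast[OF p1] grid_mass_def)
  qed
qed

text \<open>The distribution function of the posted price whose revenue from a bid in cell \<open>k\<close> is \<open>r k\<close>.\<close>
definition grid_cdf :: "real \<Rightarrow> (nat \<Rightarrow> real) \<Rightarrow> nat \<Rightarrow> real" where
  "grid_cdf t r k = r k / t ^ k + (\<Sum>j<k. (1 / t ^ j - 1 / t ^ Suc j) * r j)"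

text \<open>The price \<open>t ^ Suc k\<close> carries the jump of \<open>r\<close> divided by that
  price, a nonnegative mass when \<open>r\<close> increases.\<close>

lemma grid_cdf_Suc:
  assumes "t > 1"
  shows "grid_cdf t r (Suc k) = grid_cdf t r k + (r (Suc k) - r k) / t ^ Suc k"
  using assms by (simp add: grid_cdf_def field_simps)

lemma grid_cdf_mono:
  assumes "t > 1" "\<And>k. k < k' \<Longrightarrow> r k \<le> r (Suc k)" "k \<le> k'"
  shows "grid_cdf t r k \<le> grid_cdf t r k'"
  using assms(3,2)
proof (induction k' rule: dec_induct)
  case (step m)
  have "0 \<le> (r (Suc m) - r m) / t ^ Suc m" using step.prems[of m] assms(1) by simp
  then show ?case using step by (simp add: grid_cdf_Suc[OF assms(1)])
qed simp

text \<open>The total mass of the prices is the mean of \<open>r\<close> over the cells, exactly the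
  line sum that the shares keep below the ratio.\<close>

lemma grid_cdf_top: "grid_cdf t r N = (\<Sum>j\<le>N. grid_mass t N j * r j)"
  by (simp add: grid_cdf_def lessThan_Suc_atMost[symmetric] grid_mass_def)

text \<open>Integration by parts for the revenue: with G the distribution function of the price, x
  G(x) minus the integral of G over [1,x] equals \<open>r\<close> in the cell of x. The grid points
  are treated by induction; on the last, partial cell G is constant.\<close>

lemma has_integral_grid_cdf:
  assumes t: "t > 1" and x: "x \<ge> 1"
  shows "((\<lambda>z. grid_cdf t r (grid_index t N z)) has_integral
    (x * grid_cdf t r (grid_index t N x) - r (grid_index t N x))) {1..x}"
proof -
  have p1: "1 \<le> t ^ j" for j using t by (simp add: one_le_power)
  have knots: "((\<lambda>z. grid_cdf t r (grid_index t N z)) has_integral (t ^ k * grid_cdf t r k - r k)) {1..t ^ k}" if "k \<le> N" for k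
    using that
  proof (induction k)
    case 0
    have "t ^ 0 * grid_cdf t r 0 - r 0 = 0" by (simp add: grid_cdf_def)
    then show ?case using has_integral_null_real[of 1 "1::real" "\<lambda>z. grid_cdf t r (grid_index t N z)"] by simp
  next
    case (Suc k)
    have le: "t ^ k \<le> t ^ Suc k" using t by (intro power_increasing) auto
    have "((\<lambda>z. grid_cdf t r (grid_index t N z)) has_integral ((t ^ Suc k - t ^ k) * grid_cdf t r k)) {t ^ k..t ^ Suc k}"
    proof (rule has_integral_spike[of "{t ^ Suc k}"])
      show "((\<lambda>z. grid_cdf t r k) has_integral ((t ^ Suc k - t ^ k) * grid_cdf t r k)) {t ^ k..t ^ Suc k}"
        using has_integral_const_real[of "grid_cdf t r k" "t ^ k" "t ^ Suc k"] le by simp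
      fix z assume z: "z \<in> {t ^ k..t ^ Suc k} - {t ^ Suc k}"
      then have "1 \<le> z" using p1[of k] by auto
      then have "grid_index t N z = k"
        using z le_grid_index_iff[OF t, of z k N] le_grid_index_iff[OF t, of z "Suc k" N] Suc.prems by auto
      then show "grid_cdf t r (grid_index t N z) = grid_cdf t r k" by simp
    qed simp
    from has_integral_combine[OF p1 le _ this] Suc
    have "((\<lambda>z. grid_cdf t r (grid_index t N z)) has_integral
      (t ^ k * grid_cdf t r k - r k + (t ^ Suc k - t ^ k) * grid_cdf t r k)) {1..t ^ Suc k}" by simp
    also have "t ^ k * grid_cdf t r k - r k + (t ^ Suc k - t ^ k) * grid_cdf t r k = t ^ Suc k * grid_cdf t r (Suc k) - r (Suc k)"
    proof -
      have "t ^ Suc k * ((r (Suc k) - r k) / t ^ Suc k) = r (Suc k) - r k" using t by simp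
      then show ?thesis unfolding grid_cdf_Suc[OF t] distrib_left by (simp add: algebra_simps)
    qed
    finally show ?case .
  qed
  define k where "k = grid_index t N x"
  have k: "k \<le> N" "t ^ k \<le> x" using grid_index_le power_grid_index_le[OF t x] by (auto simp: k_def)
  have "((\<lambda>z. grid_cdf t r (grid_index t N z)) has_integral ((x - t ^ k) * grid_cdf t r k)) {t ^ k..x}"
  proof (rule has_integral_eq[rotated])
    show "((\<lambda>z. grid_cdf t r k) has_integral ((x - t ^ k) * grid_cdf t r k)) {t ^ k..x}"
      using has_integral_const_real[of "grid_cdf t r k" "t ^ k" x] k by simp
    fix z assume z: "z \<in> {t ^ k..x}"
    have "grid_index t N z = k"
      using grid_index_mono[of z x t N] grid_index_mono[of "t ^ k" z t N] grid_index_power[OF t k(1)] z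
      by (auto simp: k_def)
    then show "grid_cdf t r k = grid_cdf t r (grid_index t N z)" by simp
  qed
  from has_integral_combine[OF p1 k(2) knots[OF k(1)] this] show ?thesis
    by (simp add: k_def[symmetric] algebra_simps)
qed

context price_benchmark
begin

section \<open>Bid cells, Hall's condition on the grid, and almost optimal price
  distributions\<close>

definition cell :: "real \<Rightarrow> nat \<Rightarrow> (nat \<Rightarrow> real) \<Rightarrow> nat \<Rightarrow> nat" where
  "cell t N v = (\<lambda>i\<in>bidders. grid_index t N (v i))"

definition corner :: "real \<Rightarrow> (nat \<Rightarrow> nat) \<Rightarrow> nat \<Rightarrow> real" where
  "corner t J = (\<lambda>i\<in>bidders. t ^ J i)"

lemma cell_in: "cell t N v \<in> bidders \<rightarrow>\<^sub>E {..N}"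
  using grid_index_le by (auto simp: cell_def)

lemma cell_upd: "i \<in> bidders \<Longrightarrow> cell t N (v(i := x)) = (cell t N v)(i := grid_index t N x)"
  by (auto simp: cell_def fun_eq_iff)

lemma upd_space: "v \<in> space \<nu> \<Longrightarrow> i \<in> bidders \<Longrightarrow> x \<ge> 1 \<Longrightarrow> v(i := x) \<in> space \<nu>"
  by (auto simp: space_bids_measure PiE_iff extensional_def)

lemma cell_eq_box:
  assumes "J \<in> bidders \<rightarrow>\<^sub>E {..N}"
  shows "{v \<in> space \<nu>. cell t N v = J} = Pi\<^sub>E bidders (\<lambda>i. {x. 1 \<le> x \<and> grid_index t N x = J i})"
  using assms by (auto simp: cell_def space_bids_measure PiE_iff fun_eq_iff extensional_def split: if_splits)

lemma sets_grid_cell: "{x. 1 \<le> x \<and> grid_index t N x = j} \<in> sets equal_revenue"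
proof -
  have "{x. grid_index t N x = j} \<in> sets borel"
    using measurable_sets[OF measurable_grid_index, of "{j}" t N] by (simp add: vimage_def)
  then have "{x. grid_index t N x = j} \<inter> {1..} \<in> sets borel" by simp
  moreover have "{x. grid_index t N x = j} \<inter> {1..} = {x. 1 \<le> x \<and> grid_index t N x = j}" by auto
  ultimately show ?thesis by (auto simp: sets_bid_space sets_restrict_space_iff)
qed

lemma sets_cell: "J \<in> bidders \<rightarrow>\<^sub>E {..N} \<Longrightarrow> {v \<in> space \<nu>. cell t N v = J} \<in> sets \<nu>"
  unfolding cell_eq_box using sets_grid_cell by (intro sets_PiM_I_finite) auto

lemma emeasure_cell:
  assumes "t > 1" and J: "J \<in> bidders \<rightarrow>\<^sub>E {..N}"
  shows "emeasure \<nu> {v \<in> space \<nu>. cell t N v = J} = ennreal (\<Prod>i\<in>bidders. grid_mass t N (J i))"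
proof -
  interpret E: prob_space equal_revenue by (rule prob_space_equal_revenue)
  interpret product_sigma_finite "\<lambda>_. equal_revenue" by standard
  have "emeasure \<nu> {v \<in> space \<nu>. cell t N v = J} =
    (\<Prod>i\<in>bidders. emeasure equal_revenue {x. 1 \<le> x \<and> grid_index t N x = J i})"
    unfolding cell_eq_box[OF J] using sets_grid_cell by (intro emeasure_PiM) auto
  also have "\<dots> = (\<Prod>i\<in>bidders. ennreal (grid_mass t N (J i)))"
    using J assms(1) by (intro prod.cong emeasure_grid_cell) auto
  also have "\<dots> = ennreal (\<Prod>i\<in>bidders. grid_mass t N (J i))"
    using grid_mass_pos[OF assms(1)] by (intro prod_ennreal) (auto intro: less_imp_le)
  finally show ?thesis .
qed

lemma cells_Union:
  assumes "A \<subseteq> bidders \<rightarrow>\<^sub>E {..N}"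
  shows "{v \<in> space \<nu>. cell t N v \<in> A} = (\<Union>J\<in>A. {v \<in> space \<nu>. cell t N v = J})"
  by auto

lemma finite_cells: "A \<subseteq> bidders \<rightarrow>\<^sub>E {..N::nat} \<Longrightarrow> finite A"
  by (rule finite_subset[OF _ finite_PiE]) auto

lemma sets_cells:
  assumes "A \<subseteq> bidders \<rightarrow>\<^sub>E {..N}"
  shows "{v \<in> space \<nu>. cell t N v \<in> A} \<in> sets \<nu>"
  unfolding cells_Union[OF assms] using assms finite_cells[OF assms]
  by (intro sets.finite_UN sets_cell) auto

lemma emeasure_cells:
  assumes "t > 1" "A \<subseteq> bidders \<rightarrow>\<^sub>E {..N}"
  shows "emeasure \<nu> {v \<in> space \<nu>. cell t N v \<in> A} = ennreal (\<Sum>J\<in>A. \<Prod>i\<in>bidders. grid_mass t N (J i))"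
proof -
  have "emeasure \<nu> {v \<in> space \<nu>. cell t N v \<in> A} = (\<Sum>J\<in>A. emeasure \<nu> {v \<in> space \<nu>. cell t N v = J})"
    unfolding cells_Union[OF assms(2)]
    by (rule sum_emeasure[symmetric])
       (use assms finite_cells sets_cell in \<open>auto simp: disjoint_family_on_def\<close>)
  also have "\<dots> = (\<Sum>J\<in>A. ennreal (\<Prod>i\<in>bidders. grid_mass t N (J i)))"
    using assms by (intro sum.cong emeasure_cell) auto
  also have "\<dots> = ennreal (\<Sum>J\<in>A. \<Prod>i\<in>bidders. grid_mass t N (J i))"
    using grid_mass_pos[OF assms(1)] by (intro sum_ennreal prod_nonneg) (auto intro: less_imp_le)
  finally show ?thesis .
qed

lemma bench_mono:
  assumes "\<And>j. j \<in> bidders \<Longrightarrow> v j \<le> v' j" "\<And>j. j \<in> bidders \<Longrightarrow> 0 \<le> v j"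
  shows "bench v \<le> bench v'"
  using assms nd_pos d by (intro best_value_mono) auto

text \<open>The estimate for upward closed sets is applied to a union of cells. The benchmark at the
  lower corner of a cell is at most the benchmark in the cell, which is the favourable
  direction.\<close>

lemma grid_hall_bench:
  assumes t: "t > 1"
  shows "grid_hall bidders N (grid_mass t N) (\<lambda>J. bench (corner t J)) lam"
proof
  have p1: "1 \<le> t ^ j" for j using t by (simp add: one_le_power)
  show "finite bidders" "2 \<le> card bidders" using n2 by auto
  show "0 < grid_mass t N j" for j using t by (rule grid_mass_pos)
  show "(\<Sum>j\<le>N. grid_mass t N j) = 1" by (rule sum_grid_mass)
  show bpos: "0 < bench (corner t J)" for J using bench_ge[of "corner t J"] nd_pos by linarith
  show "bench (corner t J) \<le> bench (corner t J')" if "\<And>i. i \<in> bidders \<Longrightarrow> J i \<le> J' i" for J J'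
    using that t p1 by (intro bench_mono) (auto simp: corner_def intro: power_increasing order_trans[OF zero_le_one])
  show "lam > 0" by (rule lam_pos)
  fix A assume A: "A \<subseteq> bidders \<rightarrow>\<^sub>E {..N}"
    and up: "\<And>J J'. J \<in> A \<Longrightarrow> J' \<in> bidders \<rightarrow>\<^sub>E {..N} \<Longrightarrow> (\<And>i. i \<in> bidders \<Longrightarrow> J i \<le> J' i) \<Longrightarrow> J' \<in> A"
  define A' where "A' = {v \<in> space \<nu>. cell t N v \<in> A}"
  define C where "C i = {J \<in> bidders \<rightarrow>\<^sub>E {..N}. \<exists>j\<le>N. J(i := j) \<in> A}" for i
  define C' where "C' i = {v \<in> space \<nu>. cell t N v \<in> C i}" for i
  have CD: "C i \<subseteq> bidders \<rightarrow>\<^sub>E {..N}" for i by (auto simp: C_def)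
  let ?W = "\<lambda>J. \<Prod>i\<in>bidders. grid_mass t N (J i)"
  have W0: "0 \<le> ?W J" for J using grid_mass_pos[OF t] by (intro prod_nonneg) (auto intro: less_imp_le)
  have "ennreal (\<Sum>J\<in>A. ?W J * bench (corner t J)) =
     (\<Sum>J\<in>A. ennreal (bench (corner t J)) * emeasure \<nu> {v \<in> space \<nu>. cell t N v = J})"
  proof -
    have "ennreal (\<Sum>J\<in>A. ?W J * bench (corner t J)) = (\<Sum>J\<in>A. ennreal (?W J * bench (corner t J)))"
      using W0 bpos by (intro sum_ennreal[symmetric] mult_nonneg_nonneg) (auto intro: less_imp_le)
    also have "\<dots> = (\<Sum>J\<in>A. ennreal (bench (corner t J)) * emeasure \<nu> {v \<in> space \<nu>. cell t N v = J})"
    proof (rule sum.cong)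
      fix J assume "J \<in> A"
      then have "J \<in> bidders \<rightarrow>\<^sub>E {..N}" using A by auto
      then show "ennreal (?W J * bench (corner t J)) = ennreal (bench (corner t J)) * emeasure \<nu> {v \<in> space \<nu>. cell t N v = J}"
        using emeasure_cell[OF t] W0 less_imp_le[OF bpos] by (simp add: ennreal_mult mult.commute)
    qed simp
    finally show ?thesis .
  qed
  also have "\<dots> = (\<Sum>J\<in>A. \<integral>\<^sup>+v. ennreal (bench (corner t J)) * indicator {v \<in> space \<nu>. cell t N v = J} v \<partial>\<nu>)"
    using A sets_cell by (intro sum.cong nn_integral_cmult_indicator[symmetric]) auto
  also have "\<dots> = (\<integral>\<^sup>+v. (\<Sum>J\<in>A. ennreal (bench (corner t J)) * indicator {v \<in> space \<nu>. cell t N v = J} v) \<partial>\<nu>)"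
    using A sets_cell by (intro nn_integral_sum[symmetric] borel_measurable_times_ennreal borel_measurable_const borel_measurable_indicator) auto
  also have "\<dots> \<le> (\<integral>\<^sup>+v. indicator A' v * ennreal (bench v) \<partial>\<nu>)"
  proof (rule nn_integral_mono)
    fix v assume v: "v \<in> space \<nu>"
    have "(\<Sum>J\<in>A. ennreal (bench (corner t J)) * indicator {v \<in> space \<nu>. cell t N v = J} v) =
       (\<Sum>J\<in>A. if J = cell t N v then ennreal (bench (corner t J)) else 0)"
      using v by (intro sum.cong) (auto simp: indicator_def)
    also have "\<dots> = indicator A' v * ennreal (bench (corner t (cell t N v)))"
      using finite_cells[OF A] v by (simp add: A'_def indicator_def)
    also have "\<dots> \<le> indicator A' v * ennreal (bench v)"
    proof (intro mult_left_mono ennreal_leI bench_mono)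
      fix j assume j: "j \<in> bidders"
      then have "1 \<le> v j" using v by (auto simp: space_bids_measure PiE_iff)
      then show "corner t (cell t N v) j \<le> v j"
        using j power_grid_index_le[OF t] by (simp add: corner_def cell_def)
      show "0 \<le> corner t (cell t N v) j" using j t by (simp add: corner_def)
    qed auto
    finally show "(\<Sum>J\<in>A. ennreal (bench (corner t J)) * indicator {v \<in> space \<nu>. cell t N v = J} v) \<le> indicator A' v * ennreal (bench v)" .
  qed
  also have "\<dots> \<le> (\<Sum>i\<in>bidders. ennreal lam * emeasure \<nu> (C' i))"
  proof (rule nn_integral_bench_upset_le)
    show "A' \<in> sets \<nu>" unfolding A'_def using A by (rule sets_cells)
    show "C' i \<in> sets \<nu>" for i unfolding C'_def by (rule sets_cells[OF CD])
    show "v \<in> C' i" if "i \<in> bidders" "v \<in> space \<nu>" "x \<ge> 1" "v(i := x) \<in> A'" for i v x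
      using that cell_in[of t N v] grid_index_le[of t N x] by (auto simp: C'_def C_def A'_def cell_upd)
    show "\<exists>a1\<ge>1. \<forall>x\<ge>1. v(i := x) \<in> A' \<longleftrightarrow> a1 \<le> x" if i: "i \<in> bidders" and v: "v \<in> C' i" for i v
    proof -
      \<comment> \<open>Since \<open>A\<close> is upward closed, the indices of the line that lead
        into \<open>A\<close> are exactly those from \<open>j0\<close> on, and the ray starts at
        \<open>t ^ j0\<close>.\<close>
      define j0 where "j0 = (LEAST j. j \<le> N \<and> (cell t N v)(i := j) \<in> A)"
      have "\<exists>j. j \<le> N \<and> (cell t N v)(i := j) \<in> A" using v by (auto simp: C'_def C_def)
      then have j0: "j0 \<le> N \<and> (cell t N v)(i := j0) \<in> A" unfolding j0_def by (rule LeastI_ex)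
      have "v(i := x) \<in> A' \<longleftrightarrow> t ^ j0 \<le> x" if x: "x \<ge> 1" for x
      proof -
        have "v(i := x) \<in> A' \<longleftrightarrow> (cell t N v)(i := grid_index t N x) \<in> A"
          using v i x upd_space[of v i x] by (simp add: A'_def C'_def cell_upd)
        also have "\<dots> \<longleftrightarrow> j0 \<le> grid_index t N x"
        proof
          assume "(cell t N v)(i := grid_index t N x) \<in> A"
          then show "j0 \<le> grid_index t N x" unfolding j0_def by (intro Least_le) (simp add: grid_index_le)
        next
          assume le: "j0 \<le> grid_index t N x"
          show "(cell t N v)(i := grid_index t N x) \<in> A"
          proof (rule up)
            show "(cell t N v)(i := j0) \<in> A" using j0 by simp
            show "(cell t N v)(i := grid_index t N x) \<in> bidders \<rightarrow>\<^sub>E {..N}"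
              using cell_in[of t N v] i grid_index_le[of t N x] by (auto simp: PiE_iff extensional_def)
          qed (use le in auto)
        qed
        also have "\<dots> \<longleftrightarrow> t ^ j0 \<le> x" using j0 by (intro le_grid_index_iff t x) simp
        finally show ?thesis .
      qed
      then show ?thesis using p1[of j0] by blast
    qed
  qed
  also have "\<dots> = (\<Sum>i\<in>bidders. ennreal (lam * (\<Sum>J\<in>C i. ?W J)))"
    unfolding C'_def emeasure_cells[OF t CD] using lam_pos W0
    by (intro sum.cong ennreal_mult[symmetric] sum_nonneg) auto
  also have "\<dots> = ennreal (\<Sum>i\<in>bidders. lam * (\<Sum>J\<in>C i. ?W J))"
    using lam_pos W0 by (intro sum_ennreal mult_nonneg_nonneg sum_nonneg) auto
  finally have "(\<Sum>J\<in>A. ?W J * bench (corner t J)) \<le> (\<Sum>i\<in>bidders. lam * (\<Sum>J\<in>C i. ?W J))"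
    using lam_pos W0 by (subst (asm) ennreal_le_iff) (auto intro!: sum_nonneg mult_nonneg_nonneg)
  then show "(\<Sum>J\<in>A. ?W J * bench (corner t J)) \<le>
    lam * (\<Sum>i\<in>bidders. \<Sum>J | J \<in> bidders \<rightarrow>\<^sub>E {..N} \<and> (\<exists>j\<le>N. J(i := j) \<in> A). ?W J)"
    by (simp add: sum_distrib_left C_def)
qed

text \<open>The expected payment of a bid \<open>v i\<close> if the price has distribution function
  \<open>Q\<close>, that is the Stieltjes integral of p dQ(p) up to \<open>v i\<close>, integrated
  by parts. In this form it is linear in \<open>Q\<close>.\<close>

definition line_revenue :: "(nat \<Rightarrow> (nat \<Rightarrow> real) \<Rightarrow> real) \<Rightarrow> nat \<Rightarrow> (nat \<Rightarrow> real) \<Rightarrow> real" where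
  "line_revenue Q i v = v i * Q i v - integral {1..v i} (\<lambda>z. Q i (v(i := z)))"

text \<open>\<open>Q i v\<close> is the probability that bidder \<open>i\<close>, facing the other bids, is offered a price of at most \<open>v i\<close>.\<close>
definition almost_optimal :: "nat \<Rightarrow> (nat \<Rightarrow> (nat \<Rightarrow> real) \<Rightarrow> real) \<Rightarrow> bool" where
  "almost_optimal m Q \<longleftrightarrow>
    (\<forall>i\<in>bidders. Q i \<in> borel_measurable \<nu>) \<and>
    (\<forall>i\<in>bidders. \<forall>v\<in>space \<nu>. 0 \<le> Q i v \<and> Q i v \<le> 1) \<and>
    (\<forall>i\<in>bidders. \<forall>v\<in>space \<nu>. \<forall>x y. 1 \<le> x \<longrightarrow> x \<le> y \<longrightarrow> Q i (v(i := x)) \<le> Q i (v(i := y))) \<and>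
    (\<forall>v\<in>space \<nu>. (\<forall>i\<in>bidders. v i < real m) \<longrightarrow>
       (1 - 1 / real m) * bench v \<le> lam * (\<Sum>i\<in>bidders. line_revenue Q i v))"

text \<open>The loss 1/m is divided evenly: one half pays for rounding bids down to a grid of ratio
  \<open>t\<close>, the other for stopping the weight iteration within \<epsilon>. The choice
  \<open>t ^ N > m\<close> keeps the unbounded last cell out of reach of bids below
  \<open>m\<close>.\<close>

lemma exists_almost_optimal:
  assumes m: "m \<ge> 1"
  shows "\<exists>Q. almost_optimal m Q"
proof -
  define t where "t = 1 + 1 / (2 * real m)"
  have t: "t > 1" using m by (simp add: t_def)
  obtain N where N: "real m < t ^ N" using real_arch_pow[OF t] by blast
  interpret G: grid_hall bidders N "grid_mass t N" "\<lambda>J. bench (corner t J)" lam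
    using t by (rule grid_hall_bench)
  define \<epsilon> where "\<epsilon> = (real n - d) / (2 * real m)"
  have e: "\<epsilon> > 0" using m nd_pos by (simp add: \<epsilon>_def)
  let ?D = "bidders \<rightarrow>\<^sub>E {..N}"
  obtain R where R: "\<And>i J. i \<in> bidders \<Longrightarrow> J \<in> ?D \<Longrightarrow> 0 \<le> R i J"
    "\<And>i J j j'. i \<in> bidders \<Longrightarrow> J \<in> ?D \<Longrightarrow> j \<le> j' \<Longrightarrow> j' \<le> N \<Longrightarrow> R i (J(i := j)) \<le> R i (J(i := j'))"
    "\<And>i J. i \<in> bidders \<Longrightarrow> J \<in> ?D \<Longrightarrow> (\<Sum>j\<le>N. grid_mass t N j * R i (J(i := j))) \<le> lam"
    "\<And>J. J \<in> ?D \<Longrightarrow> bench (corner t J) - \<epsilon> \<le> (\<Sum>i\<in>bidders. R i J)"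
    using G.exists_monotone_shares[OF e] by blast
  define q where "q i J k = grid_cdf t (\<lambda>j. R i (J(i := j))) k" for i J k
  \<comment> \<open>Dividing by \<open>lam\<close> turns a total mass of at most \<open>lam\<close>
    into at most 1. The missing mass stands for an infinite price.\<close>
  define Q where "Q i v = q i (cell t N v) (grid_index t N (v i)) / lam" for i v
  have q0: "0 \<le> q i J k" if "i \<in> bidders" "J \<in> ?D" "k \<le> N" for i J k
  proof -
    have "0 \<le> 1 / t ^ j - 1 / t ^ Suc j" for j using t by (simp add: field_simps)
    moreover have "0 \<le> R i (J(i := j))" if "j \<le> N" for j
      using G.upd_D[of J i j] R(1) \<open>i \<in> bidders\<close> \<open>J \<in> ?D\<close> that by blast
    ultimately show ?thesis
      unfolding q_def grid_cdf_def using t that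
      by (intro add_nonneg_nonneg sum_nonneg mult_nonneg_nonneg divide_nonneg_nonneg) auto
  qed
  have qmono: "q i J k \<le> q i J k'" if "i \<in> bidders" "J \<in> ?D" "k \<le> k'" "k' \<le> N" for i J k k'
    unfolding q_def using that R(2) by (intro grid_cdf_mono t) auto
  have q1: "q i J k \<le> lam" if "i \<in> bidders" "J \<in> ?D" "k \<le> N" for i J k
  proof -
    have "q i J k \<le> q i J N" using that by (intro qmono) auto
    also have "\<dots> \<le> lam" unfolding q_def grid_cdf_top using that R(3) by blast
    finally show ?thesis .
  qed
  have qupd: "q i (J(i := x)) k = q i J k" for i J x k by (simp add: q_def)
  have Qupd: "Q i (v(i := x)) = q i (cell t N v) (grid_index t N x) / lam" if "i \<in> bidders" for i v x
    by (simp add: Q_def cell_upd[OF that] qupd)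
  have line: "lam * line_revenue Q i v = R i (cell t N v)" if i: "i \<in> bidders" and v: "v \<in> space \<nu>" for i v
  proof -
    have vi: "1 \<le> v i" using v i by (auto simp: space_bids_measure PiE_iff)
    let ?r = "\<lambda>j. R i ((cell t N v)(i := j))"
    have "((\<lambda>z. grid_cdf t ?r (grid_index t N z)) has_integral
       (v i * grid_cdf t ?r (grid_index t N (v i)) - ?r (grid_index t N (v i)))) {1..v i}"
      by (rule has_integral_grid_cdf[OF t vi])
    then have "((\<lambda>z. Q i (v(i := z))) has_integral
       ((v i * grid_cdf t ?r (grid_index t N (v i)) - ?r (grid_index t N (v i))) / lam)) {1..v i}"
      unfolding Qupd[OF i] q_def by (rule has_integral_divide)
    then have "integral {1..v i} (\<lambda>z. Q i (v(i := z))) =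
       (v i * grid_cdf t ?r (grid_index t N (v i)) - ?r (grid_index t N (v i))) / lam"
      by (rule integral_unique)
    moreover have "Q i v = grid_cdf t ?r (grid_index t N (v i)) / lam"
      by (simp add: Q_def q_def)
    moreover have "?r (grid_index t N (v i)) = R i (cell t N v)"
    proof -
      have "(cell t N v)(i := grid_index t N (v i)) = cell t N v" using i by (auto simp: cell_def fun_eq_iff)
      then show ?thesis by simp
    qed
    ultimately have "line_revenue Q i v = R i (cell t N v) / lam"
      unfolding line_revenue_def by (simp add: diff_divide_distrib)
    then show ?thesis using lam_pos by simp
  qed
  have "almost_optimal m Q"
    unfolding almost_optimal_def
  proof (intro conjI ballI allI impI)
    fix i assume i: "i \<in> bidders"
    have "(\<lambda>v. \<Sum>J\<in>?D. (q i J (J i) / lam) * indicator {v \<in> space \<nu>. cell t N v = J} v) \<in> borel_measurable \<nu>"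
      by (intro borel_measurable_sum borel_measurable_times borel_measurable_const borel_measurable_indicator sets_cell)
    moreover have "Q i v = (\<Sum>J\<in>?D. (q i J (J i) / lam) * indicator {v \<in> space \<nu>. cell t N v = J} v)" if v: "v \<in> space \<nu>" for v
    proof -
      have "(\<Sum>J\<in>?D. (q i J (J i) / lam) * indicator {v \<in> space \<nu>. cell t N v = J} v) =
        (\<Sum>J\<in>?D. if J = cell t N v then q i J (J i) / lam else 0)"
        using v by (intro sum.cong) (auto simp: indicator_def)
      also have "\<dots> = q i (cell t N v) (cell t N v i) / lam"
        using cell_in[of t N v] finite_cells[of ?D N] by simp
      also have "\<dots> = Q i v" using i by (simp add: Q_def cell_def)
      finally show ?thesis by simp
    qed
    ultimately show "Q i \<in> borel_measurable \<nu>" by (simp cong: measurable_cong)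
  next
    fix i v assume "i \<in> bidders" "v \<in> space \<nu>"
    then show "0 \<le> Q i v" "Q i v \<le> 1"
      using q0[of i "cell t N v" "grid_index t N (v i)"] q1[of i "cell t N v" "grid_index t N (v i)"]
        cell_in grid_index_le lam_pos by (auto simp: Q_def)
  next
    fix i v and x y :: real assume "i \<in> bidders" "v \<in> space \<nu>" "1 \<le> x" "x \<le> y"
    then show "Q i (v(i := x)) \<le> Q i (v(i := y))"
      using lam_pos by (simp add: Qupd divide_right_mono qmono cell_in grid_index_mono grid_index_le)
  next
    fix v assume v: "v \<in> space \<nu>" and vm: "\<forall>i\<in>bidders. v i < real m"
    let ?c = "corner t (cell t N v)"
    have "bench v \<le> bench (\<lambda>j. t * ?c j)"
    proof (rule bench_mono)
      fix j assume j: "j \<in> bidders"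
      then have v1: "1 \<le> v j" using v by (auto simp: space_bids_measure PiE_iff)
      then show "0 \<le> v j" by simp
      have "v j < t ^ N" using vm j N by (metis less_trans)
      then show "v j \<le> t * ?c j"
        using less_power_Suc_grid_index[OF t v1] j by (simp add: corner_def cell_def less_imp_le)
    qed
    also have "\<dots> \<le> t * bench ?c"
      by (rule best_value_scale_le) (use t d nd_pos in \<open>auto simp: corner_def\<close>)
    finally have bt: "bench v \<le> t * bench ?c" .
    have b: "bench v \<ge> real n - d" by (rule bench_ge)
    \<comment> \<open>(1 - h)(1 + h) \<le> 1 undoes the rounding, and \<epsilon> is h times the
      lower bound \<open>n - d\<close> of every benchmark. Together they cost 2 h = 1/m.\<close>
    define h where "h = 1 / (2 * real m)"
    have h: "0 < h" "h < 1" "1 / real m = 2 * h" "t = 1 + h" "\<epsilon> = h * (real n - d)"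
      using m by (auto simp: h_def t_def \<epsilon>_def)
    have "(1 - h) * bench v \<le> (1 - h) * (t * bench ?c)"
      using bt h by (intro mult_left_mono) auto
    also have "\<dots> = (1 - h\<^sup>2) * bench ?c"
      unfolding h(4) by (simp add: algebra_simps power2_eq_square)
    also have "\<dots> \<le> 1 * bench ?c"
      using bench_ge[of ?c] nd_pos by (intro mult_right_mono) auto
    finally have "(1 - h) * bench v \<le> bench ?c" by simp
    moreover have "\<epsilon> \<le> h * bench v"
      using b h by (simp add: mult_left_mono)
    ultimately have "(1 - 1 / real m) * bench v \<le> bench ?c - \<epsilon>"
      unfolding h(3) by (simp add: algebra_simps)
    also have "\<dots> \<le> (\<Sum>i\<in>bidders. R i (cell t N v))" by (rule R(4)[OF cell_in])
    also have "\<dots> = (\<Sum>i\<in>bidders. lam * line_revenue Q i v)" using line v by (intro sum.cong) auto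
    finally show "(1 - 1 / real m) * bench v \<le> lam * (\<Sum>i\<in>bidders. line_revenue Q i v)"
      by (simp add: sum_distrib_left)
  qed
  then show ?thesis by blast
qed

end

section \<open>Compactness\<close>

text \<open>
  Almost norm-minimal elements of a decreasing sequence of convex sets form a Cauchy sequence in \<open>L2\<close>
  by the parallelogram law; this replaces weak compactness.
\<close>
lemma ae_convergent_selection:
  fixes K :: "nat \<Rightarrow> ('i \<Rightarrow> 'a \<Rightarrow> real) set"
  assumes "prob_space M" and I: "finite I"
    and ne: "\<And>m. K m \<noteq> {}" and dec: "\<And>m. K (Suc m) \<subseteq> K m"
    and mid: "\<And>m P Q. P \<in> K m \<Longrightarrow> Q \<in> K m \<Longrightarrow> (\<lambda>i x. (P i x + Q i x) / 2) \<in> K m"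
    and meas: "\<And>m Q i. Q \<in> K m \<Longrightarrow> i \<in> I \<Longrightarrow> Q i \<in> borel_measurable M"
    and bnd: "\<And>m Q i x. Q \<in> K m \<Longrightarrow> i \<in> I \<Longrightarrow> x \<in> space M \<Longrightarrow> 0 \<le> Q i x \<and> Q i x \<le> 1"
  obtains Z where "\<And>m. Z m \<in> K m" "AE x in M. \<forall>i\<in>I. convergent (\<lambda>m. Z m i x)"
proof -
  interpret prob_space M by fact
  define energy where "energy Q = (\<Sum>i\<in>I. \<integral>x. (Q i x)\<^sup>2 \<partial>M)" for Q :: "'i \<Rightarrow> 'a \<Rightarrow> real"
  have decK: "K l \<subseteq> K m" if "m \<le> l" for m l
    using that by (rule lift_Suc_antimono_le[of K, OF dec])
  have int: "integrable M (\<lambda>x. Q i x * P i x)" if "Q \<in> K m" "P \<in> K l" "i \<in> I" for Q P m l i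
  proof (rule integrable_const_bound[where B = 1])
    show "AE x in M. norm (Q i x * P i x) \<le> 1"
      using bnd[OF that(1,3)] bnd[OF that(2,3)] by (intro AE_I2) (simp add: abs_mult mult_le_one)
  qed (use meas[OF that(1,3)] meas[OF that(2,3)] in auto)
  have e0: "0 \<le> energy Q" for Q unfolding energy_def by (intro sum_nonneg integral_nonneg_AE) auto
  have bdd: "bdd_below (energy ` K m)" for m using e0 by (intro bdd_belowI[of _ 0]) auto
  define low where "low m = Inf (energy ` K m)" for m
  have low_le: "low m \<le> energy Q" if "Q \<in> K m" for m Q
    unfolding low_def using that bdd by (intro cInf_lower) auto
  have "incseq low"
    unfolding low_def using ne dec bdd by (intro incseq_SucI cInf_superset_mono) auto
  moreover have "low m \<le> real (card I)" for m
  proof -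
    obtain Q where Q: "Q \<in> K m" using ne[of m] by auto
    have "energy Q \<le> (\<Sum>i\<in>I. 1)"
      unfolding energy_def
    proof (rule sum_mono)
      fix i assume i: "i \<in> I"
      have "(\<integral>x. (Q i x)\<^sup>2 \<partial>M) \<le> (\<integral>x. 1 \<partial>M)"
        using int[OF Q Q i] bnd[OF Q i] by (intro integral_mono) (auto simp: power2_eq_square mult_le_one)
      then show "(\<integral>x. (Q i x)\<^sup>2 \<partial>M) \<le> 1" by (simp add: prob_space)
    qed
    then show ?thesis using low_le[OF Q] by simp
  qed
  ultimately obtain hi where hi: "low \<longlonglongrightarrow> hi" "\<And>m. low m \<le> hi"
    using incseq_convergent[of low "real (card I)"] by blast
  \<comment> \<open>Energy gaps of order 16^(-k) give L2 distances of order 4^(-k) between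
    consecutive elements, which are summable.\<close>
  define e where "e k = (1 / 16 :: real) ^ k" for k :: nat
  have e: "0 < e k" for k by (simp add: e_def)
  have "\<exists>r. k \<le> r \<and> hi - low r \<le> e k" for k
  proof -
    have "\<forall>\<^sub>F m in sequentially. hi - e k < low m" using e[of k] by (intro order_tendstoD(1)[OF hi(1)]) auto
    then have "\<forall>\<^sub>F m in sequentially. k \<le> m \<and> hi - e k < low m" using eventually_ge_at_top[of k] by (rule eventually_conj[rotated])
    from eventually_happens'[OF sequentially_bot this] show ?thesis by (auto intro!: less_imp_le simp: algebra_simps) 
  qed
  then obtain r0 where r0: "\<And>k. k \<le> r0 k" "\<And>k. hi - low (r0 k) \<le> e k" by metis
  \<comment> \<open>A running maximum makes the indices increase, so that \<open>Z (Suc k)\<close>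
    also lies in \<open>K (r k)\<close> and can be averaged with \<open>Z k\<close> there.\<close>
  define r where "r k = Max (r0 ` {..k})" for k
  have r: "k \<le> r k" "hi - low (r k) \<le> e k" "r k \<le> r (Suc k)" for k
  proof -
    have le: "r0 k \<le> r k" by (auto simp: r_def)
    then show "k \<le> r k" using r0(1)[of k] by simp
    show "hi - low (r k) \<le> e k" using r0(2)[of k] incseqD[OF \<open>incseq low\<close> le] by simp
    show "r k \<le> r (Suc k)" unfolding r_def by (intro Max_mono) auto
  qed
  have "\<exists>Q. Q \<in> K (r k) \<and> energy Q \<le> low (r k) + e k" for k
  proof -
    have "\<exists>y\<in>energy ` K (r k). y < low (r k) + e k"
      using ne bdd e[of k] by (subst cInf_less_iff[symmetric]) (auto simp: low_def)
    then show ?thesis by (auto intro: less_imp_le)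
  qed
  then obtain Z where Z: "\<And>k. Z k \<in> K (r k)" "\<And>k. energy (Z k) \<le> low (r k) + e k" by metis
  have ZK: "Z k \<in> K k" for k using Z(1) decK[OF r(1)] by blast
  have close: "(\<Sum>i\<in>I. \<integral>x. (Z (Suc k) i x - Z k i x)\<^sup>2 \<partial>M) \<le> 8 * e k" for k
  proof -
    have Zs: "Z (Suc k) \<in> K (r k)" using Z(1)[of "Suc k"] decK[OF r(3)[of k]] by blast
    define Q where "Q = (\<lambda>i x. (Z k i x + Z (Suc k) i x) / 2)"
    have Q: "Q \<in> K (r k)" unfolding Q_def by (rule mid) (use Z Zs in auto)
    \<comment> \<open>The parallelogram law. The midpoint \<open>Q\<close> lies in
      \<open>K (r k)\<close>, so its energy is at least \<open>low (r k)\<close>, while both ends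
      are nearly minimal.\<close>
    have "(\<Sum>i\<in>I. \<integral>x. (Z (Suc k) i x - Z k i x)\<^sup>2 \<partial>M) = 2 * energy (Z k) + 2 * energy (Z (Suc k)) - 4 * energy Q"
      unfolding energy_def sum_distrib_left sum.distrib[symmetric] sum_subtractf[symmetric]
    proof (rule sum.cong)
      fix i assume i: "i \<in> I"
      note ints = int[OF Z(1)[of k] Z(1)[of k] i] int[OF Zs Zs i] int[OF Q Q i]
      have "(\<integral>x. (Z (Suc k) i x - Z k i x)\<^sup>2 \<partial>M) =
        (\<integral>x. 2 * (Z k i x * Z k i x) + 2 * (Z (Suc k) i x * Z (Suc k) i x) - 4 * (Q i x * Q i x) \<partial>M)"
        by (intro Bochner_Integration.integral_cong) (auto simp: Q_def power2_eq_square algebra_simps)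
      then show "(\<integral>x. (Z (Suc k) i x - Z k i x)\<^sup>2 \<partial>M) =
        2 * (\<integral>x. (Z k i x)\<^sup>2 \<partial>M) + 2 * (\<integral>x. (Z (Suc k) i x)\<^sup>2 \<partial>M) - 4 * (\<integral>x. (Q i x)\<^sup>2 \<partial>M)"
        using ints by (simp add: power2_eq_square)
    qed simp
    also have "\<dots> \<le> 2 * (low (r k) + e k) + 2 * (hi + e k) - 4 * low (r k)"
    proof -
      have "e (Suc k) \<le> e k" by (simp add: e_def)
      then show ?thesis using Z(2)[of k] Z(2)[of "Suc k"] low_le[OF Q] hi(2)[of "r (Suc k)"] by simp
    qed
    also have "\<dots> = 2 * (hi - low (r k)) + 4 * e k" by (simp add: algebra_simps)
    also have "\<dots> \<le> 2 * e k + 4 * e k" using r(2)[of k] by (intro add_right_mono mult_left_mono) auto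
    also have "\<dots> \<le> 8 * e k" using less_imp_le[OF e[of k]] by (simp add: algebra_simps)
    finally show ?thesis .
  qed
  have step: "(\<integral>\<^sup>+x. ennreal \<bar>Z (Suc k) i x - Z k i x\<bar> \<partial>M) \<le> ennreal (5 * (1 / 4) ^ k)" if i: "i \<in> I" for i k
  proof -
    have int2: "integrable M (\<lambda>x. (Z (Suc k) i x - Z k i x)\<^sup>2)"
      using int[OF Z(1)[of k] Z(1)[of k] i] int[OF Z(1)[of "Suc k"] Z(1)[of "Suc k"] i] int[OF Z(1)[of "Suc k"] Z(1)[of k] i]
      by (auto simp: power2_eq_square algebra_simps)
    have "(\<integral>\<^sup>+x. ennreal \<bar>Z (Suc k) i x - Z k i x\<bar> \<partial>M) \<le>
      (\<integral>\<^sup>+x. ennreal ((4 ^ k * (Z (Suc k) i x - Z k i x)\<^sup>2 + (1 / 4) ^ k) / 2) \<partial>M)"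
    proof (intro nn_integral_mono ennreal_leI)
      fix x
      define u where "u = \<bar>Z (Suc k) i x - Z k i x\<bar>"
      \<comment> \<open>The weights are balanced so that, after integration against the bound 8 *
        16^(-k), both terms are of order 4^(-k): together 9/2 of it, hence the factor 5.\<close>
      have "0 \<le> (2 ^ k * u - (1 / 2) ^ k)\<^sup>2" by simp
      also have "\<dots> = 4 ^ k * u\<^sup>2 + (1 / 4) ^ k - 2 * u"
      proof -
        have "(2 ^ k)\<^sup>2 = (4 :: real) ^ k" "((1 / 2) ^ k)\<^sup>2 = (1 / 4 :: real) ^ k" "(2 :: real) ^ k * (1 / 2) ^ k = 1"
          by (simp_all add: power2_eq_square power_mult_distrib[symmetric])
        then show ?thesis by (simp add: power2_diff power_mult_distrib algebra_simps)
      qed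
      finally show "\<bar>Z (Suc k) i x - Z k i x\<bar> \<le> (4 ^ k * (Z (Suc k) i x - Z k i x)\<^sup>2 + (1 / 4) ^ k) / 2"
        by (simp add: u_def)
    qed
    also have "\<dots> = ennreal (\<integral>x. (4 ^ k * (Z (Suc k) i x - Z k i x)\<^sup>2 + (1 / 4) ^ k) / 2 \<partial>M)"
      using int2 by (intro nn_integral_eq_integral) auto
    also have "\<dots> \<le> ennreal (5 * (1 / 4) ^ k)"
    proof (rule ennreal_leI)
      have "(\<integral>x. (Z (Suc k) i x - Z k i x)\<^sup>2 \<partial>M) \<le> (\<Sum>i\<in>I. \<integral>x. (Z (Suc k) i x - Z k i x)\<^sup>2 \<partial>M)"
        by (rule member_le_sum[OF i]) (use I in auto)
      then have b: "(\<integral>x. (Z (Suc k) i x - Z k i x)\<^sup>2 \<partial>M) \<le> 8 * e k" using close[of k] by simp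
      have "(\<integral>x. (4 ^ k * (Z (Suc k) i x - Z k i x)\<^sup>2 + (1 / 4) ^ k) / 2 \<partial>M) =
        (4 ^ k * (\<integral>x. (Z (Suc k) i x - Z k i x)\<^sup>2 \<partial>M) + (1 / 4) ^ k) / 2"
        using int2 by (simp add: prob_space)
      also have "\<dots> \<le> (4 ^ k * (8 * e k) + (1 / 4) ^ k) / 2"
        using b by (intro divide_right_mono add_right_mono mult_left_mono) auto
      also have "(4 :: real) ^ k * (8 * e k) = 8 * (1 / 4) ^ k"
        by (simp add: e_def power_mult_distrib[symmetric] mult.left_commute)
      also have "(8 * (1 / 4) ^ k + (1 / 4) ^ k) / 2 \<le> 5 * (1 / 4 :: real) ^ k"
        using zero_le_power[of "1 / 4 :: real" k] by simp
      finally show "(\<integral>x. (4 ^ k * (Z (Suc k) i x - Z k i x)\<^sup>2 + (1 / 4) ^ k) / 2 \<partial>M) \<le> 5 * (1 / 4) ^ k" .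
    qed
    finally show ?thesis .
  qed
  have "AE x in M. convergent (\<lambda>m. Z m i x)" if i: "i \<in> I" for i
  proof -
    have m[measurable]: "Z k i \<in> borel_measurable M" for k using meas[OF Z(1) i] .
    have "(\<integral>\<^sup>+x. (\<Sum>k. ennreal \<bar>Z (Suc k) i x - Z k i x\<bar>) \<partial>M) = (\<Sum>k. \<integral>\<^sup>+x. ennreal \<bar>Z (Suc k) i x - Z k i x\<bar> \<partial>M)"
      by (rule nn_integral_suminf) measurable
    also have "\<dots> \<le> (\<Sum>k. ennreal (5 * (1 / 4) ^ k))"
      by (intro suminf_le step i) auto
    also have "\<dots> = ennreal (\<Sum>k. 5 * (1 / 4) ^ k)"
      by (intro suminf_ennreal2 summable_mult summable_geometric) auto
    finally have "(\<integral>\<^sup>+x. (\<Sum>k. ennreal \<bar>Z (Suc k) i x - Z k i x\<bar>) \<partial>M) \<noteq> \<infinity>"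
      using ennreal_less_top le_less_trans by (metis infinity_ennreal_def less_irrefl)
    then have "AE x in M. (\<Sum>k. ennreal \<bar>Z (Suc k) i x - Z k i x\<bar>) \<noteq> \<infinity>"
      by (intro nn_integral_noteq_infinite) measurable
    then show ?thesis
    proof eventually_elim
      case (elim x)
      then have "summable (\<lambda>k. \<bar>Z (Suc k) i x - Z k i x\<bar>)" by (intro summable_suminf_not_top) auto
      then have "summable (\<lambda>k. Z (Suc k) i x - Z k i x)" by (rule summable_rabs_cancel)
      then have "(\<lambda>m. \<Sum>k<m. Z (Suc k) i x - Z k i x) \<longlonglongrightarrow> (\<Sum>k. Z (Suc k) i x - Z k i x)" by (rule summable_LIMSEQ)
      then have "(\<lambda>m. Z m i x - Z 0 i x) \<longlonglongrightarrow> (\<Sum>k. Z (Suc k) i x - Z k i x)"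
        unfolding sum_lessThan_telescope[of "\<lambda>k. Z k i x"] .
      from tendsto_add[OF this tendsto_const[of "Z 0 i x"]] show ?case by (auto simp: convergent_def)
    qed
  qed
  then have "AE x in M. \<forall>i\<in>I. convergent (\<lambda>m. Z m i x)" using I by (intro AE_finite_allI) auto
  with ZK that show ?thesis by blast
qed

section \<open>Cluster points in large products, and integrals of monotone limits\<close>

lemma compact_box_UNIV:
  fixes b :: "'a \<Rightarrow> real"
  shows "compact {x. \<forall>i. 0 \<le> x i \<and> x i \<le> b i}"
proof -
  have "compactin (product_topology (\<lambda>_::'a. euclidean) UNIV) (PiE UNIV (\<lambda>i. {0..b i}))"
    by (simp add: compactin_PiE)
  moreover have "PiE UNIV (\<lambda>i. {0..b i}) = {x. \<forall>i. 0 \<le> x i \<and> x i \<le> b i}" by (auto simp: PiE_iff)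
  ultimately show ?thesis by (simp add: euclidean_product_topology)
qed

text \<open>For an uncountable index set no subsequence need converge. A cluster point of the image
  filter still inherits every closed condition that holds eventually; here these are tested by
  continuous real functions.\<close>

lemma bounded_sequence_cluster_point:
  fixes T :: "nat \<Rightarrow> 'a \<Rightarrow> real"
  assumes "\<And>m i. 0 \<le> T m i \<and> T m i \<le> b i"
  obtains X where "\<And>h c. continuous_on UNIV h \<Longrightarrow> \<forall>\<^sub>F m in sequentially. c \<le> h (T m) \<Longrightarrow> c \<le> (h X :: real)"
proof -
  let ?U = "{x. \<forall>i. 0 \<le> x i \<and> x i \<le> b i}"
  let ?F = "filtermap T sequentially"
  have "?F \<le> principal ?U" "?F \<noteq> bot"
    using assms by (auto simp: le_principal eventually_filtermap filtermap_bot_iff)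
  then obtain X where X: "inf (nhds X) ?F \<noteq> bot"
    using compact_filter[THEN iffD1, OF compact_box_UNIV[of b], rule_format, of ?F] by (auto simp: le_principal)
  show ?thesis
  proof (rule that[of X], rule ccontr)
    fix h :: "('a \<Rightarrow> real) \<Rightarrow> real" and c
    assume h: "continuous_on UNIV h" and c: "\<forall>\<^sub>F m in sequentially. c \<le> h (T m)" and "\<not> c \<le> h X"
    have "open {x. h x < c}" by (rule open_Collect_less[OF h continuous_on_const])
    then have "\<forall>\<^sub>F x in nhds X. h x < c"
      using \<open>\<not> c \<le> h X\<close> eventually_nhds_in_open[of "{x. h x < c}" X] by simp
    moreover have "\<forall>\<^sub>F x in ?F. c \<le> h x" using c by (simp add: eventually_filtermap)
    ultimately have "\<forall>\<^sub>F x in inf (nhds X) ?F. False"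
      unfolding eventually_inf by (intro exI[of _ "\<lambda>x. h x < c"] exI[of _ "\<lambda>x. c \<le> h x"]) auto
    then show False using X by (simp add: trivial_limit_def)
  qed
qed

text \<open>\<open>W\<close> stands for a cluster point of integrals, for which limit and integral
  cannot simply be exchanged. Its increments dominate lower Riemann sums of \<open>q\<close>, and
  for monotone \<open>q\<close> lower and upper sums over \<open>N\<close> equal pieces differ by (b
  - a)(q b - q a) / N.\<close>

lemma integral_le_of_lower_increments:
  fixes q W :: "real \<Rightarrow> real"
  assumes ab: "a \<le> b" and q: "mono_on {a..b} q"
    and W: "\<And>x y. a \<le> x \<Longrightarrow> x \<le> y \<Longrightarrow> y \<le> b \<Longrightarrow> (y - x) * q x \<le> W y - W x"
  shows "integral {a..b} q \<le> W b - W a"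
proof -
  define V where "V x = integral {a..x} q" for x
  have V: "V y - V x \<le> (y - x) * q y" if "a \<le> x" "x \<le> y" "y \<le> b" for x y
  proof -
    have i: "q integrable_on {a..y}" "q integrable_on {x..y}"
      using that by (auto intro!: integrable_on_mono_on mono_on_subset[OF q])
    have "integral {a..x} q + integral {x..y} q = integral {a..y} q"
      using that i by (intro Henstock_Kurzweil_Integration.integral_combine) auto
    moreover have "integral {x..y} q \<le> integral {x..y} (\<lambda>_. q y)"
      using i that monotone_onD[OF q] by (intro integral_le) auto
    ultimately show ?thesis using that by (simp add: V_def mult.commute)
  qed
  have bound: "- ((b - a) / real N) * (q b - q a) \<le> (W b - V b) - (W a - V a)" if N: "N > 0" for N :: nat
  proof -
    define h where "h = (b - a) / real N"
    have h: "0 \<le> h" "real N * h = b - a" using ab N by (auto simp: h_def)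
    have "- h * (q (a + real k * h) - q a) \<le> (W (a + real k * h) - V (a + real k * h)) - (W a - V a)" if "k \<le> N" for k
      using that
    proof (induction k)
      case (Suc k)
      let ?x = "a + real k * h" and ?y = "a + real (Suc k) * h"
      have "real (Suc k) * h \<le> real N * h" using Suc.prems h by (intro mult_right_mono) auto
      then have xy: "a \<le> ?x" "?x \<le> ?y" "?y \<le> b" using h by (auto simp: algebra_simps)
      have "?y - ?x = h" by (simp add: algebra_simps)
      then have "h * q ?x - h * q ?y \<le> (W ?y - W ?x) - (V ?y - V ?x)"
        using W[OF xy] V[OF xy] by simp
      then show ?case using Suc by (simp add: algebra_simps)
    qed simp
    from this[of N] show ?thesis using h by (simp add: h_def)
  qed
  have "(\<lambda>N. - ((b - a) / real N) * (q b - q a)) \<longlonglongrightarrow> - 0 * (q b - q a)"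
    by (intro tendsto_intros lim_const_over_n)
  then have "0 \<le> (W b - V b) - (W a - V a)"
    using bound by (intro LIMSEQ_le_const2[where X = "\<lambda>N. - ((b - a) / real N) * (q b - q a)"]) (auto intro!: exI[of _ 1])
  then show ?thesis by (simp add: V_def)
qed

section \<open>Passing to the limit\<close>

context price_benchmark
begin

lemma almost_optimalD:
  assumes "almost_optimal m Q" "i \<in> bidders"
  shows "Q i \<in> borel_measurable \<nu>"
    "v \<in> space \<nu> \<Longrightarrow> 0 \<le> Q i v \<and> Q i v \<le> 1"
    "v \<in> space \<nu> \<Longrightarrow> 1 \<le> x \<Longrightarrow> x \<le> y \<Longrightarrow> Q i (v(i := x)) \<le> Q i (v(i := y))"
  using assms unfolding almost_optimal_def by blast+

lemma almost_optimal_revenue: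
  assumes "almost_optimal m Q" "v \<in> space \<nu>" "\<And>i. i \<in> bidders \<Longrightarrow> v i < real m"
  shows "(1 - 1 / real m) * bench v \<le> lam * (\<Sum>i\<in>bidders. line_revenue Q i v)"
  using assms unfolding almost_optimal_def by blast

lemma almost_optimal_mono_on:
  assumes "almost_optimal m Q" "i \<in> bidders" "v \<in> space \<nu>" "1 \<le> a0"
  shows "mono_on {a0..b} (\<lambda>z. Q i (v(i := z)))"
  using almost_optimalD(3)[OF assms(1-3)] assms(4) by (auto simp: mono_on_def)

text \<open>Both the range of bids and the guaranteed fraction of the benchmark grow with
  \<open>m\<close>. This gives the decreasing sets for
  \<open>ae_convergent_selection\<close>.\<close>

lemma almost_optimal_Suc:
  assumes Q: "almost_optimal (Suc m) Q" and m: "m \<ge> 1"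
  shows "almost_optimal m Q"
  unfolding almost_optimal_def
proof (intro conjI ballI allI impI)
  fix v assume v: "v \<in> space \<nu>" "\<forall>i\<in>bidders. v i < real m"
  have "(1 - 1 / real m) * bench v \<le> (1 - 1 / real (Suc m)) * bench v"
    using m bench_ge[of v] nd_pos by (intro mult_right_mono) (auto simp: field_simps)
  also have "\<dots> \<le> lam * (\<Sum>i\<in>bidders. line_revenue Q i v)"
  proof (rule almost_optimal_revenue[OF Q v(1)])
    fix i assume "i \<in> bidders"
    then have "v i < real m" using v(2) by blast
    then show "v i < real (Suc m)" by simp
  qed
  finally show "(1 - 1 / real m) * bench v \<le> lam * (\<Sum>i\<in>bidders. line_revenue Q i v)" .
qed (use almost_optimalD[OF Q] in auto)

text \<open>Every condition is linear in \<open>Q\<close>. The integrals add up because monotone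
  functions are integrable.\<close>

lemma almost_optimal_midpoint:
  assumes P: "almost_optimal m P" and Q: "almost_optimal m Q"
  shows "almost_optimal m (\<lambda>i v. (P i v + Q i v) / 2)"
  unfolding almost_optimal_def
proof (intro conjI ballI allI impI)
  fix i assume i: "i \<in> bidders"
  show "(\<lambda>v. (P i v + Q i v) / 2) \<in> borel_measurable \<nu>"
    using almost_optimalD(1)[OF P i] almost_optimalD(1)[OF Q i] by measurable
  fix v assume v: "v \<in> space \<nu>"
  show "0 \<le> (P i v + Q i v) / 2" "(P i v + Q i v) / 2 \<le> 1"
    using almost_optimalD(2)[OF P i v] almost_optimalD(2)[OF Q i v] by auto
  fix x y :: real assume "1 \<le> x" "x \<le> y"
  then show "(P i (v(i := x)) + Q i (v(i := x))) / 2 \<le> (P i (v(i := y)) + Q i (v(i := y))) / 2"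
    using almost_optimalD(3)[OF P i v] almost_optimalD(3)[OF Q i v] by (simp add: add_mono)
next
  fix v assume v: "v \<in> space \<nu>" "\<forall>i\<in>bidders. v i < real m"
  have "line_revenue (\<lambda>i v. (P i v + Q i v) / 2) i v = (line_revenue P i v + line_revenue Q i v) / 2"
    if i: "i \<in> bidders" for i
  proof -
    have "(\<lambda>z. P i (v(i := z))) integrable_on {1..v i}" "(\<lambda>z. Q i (v(i := z))) integrable_on {1..v i}"
      using almost_optimal_mono_on[OF P i v(1)] almost_optimal_mono_on[OF Q i v(1)] by (auto intro: integrable_on_mono_on)
    then have "integral {1..v i} (\<lambda>z. (P i (v(i := z)) + Q i (v(i := z))) / 2) =
      (integral {1..v i} (\<lambda>z. P i (v(i := z))) + integral {1..v i} (\<lambda>z. Q i (v(i := z)))) / 2"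
      by (simp add: Henstock_Kurzweil_Integration.integral_add)
    then show ?thesis unfolding line_revenue_def by (simp add: field_simps)
  qed
  then have "(\<Sum>i\<in>bidders. line_revenue (\<lambda>i v. (P i v + Q i v) / 2) i v) =
     (\<Sum>i\<in>bidders. (line_revenue P i v + line_revenue Q i v) / 2)"
    by (rule sum.cong[OF refl])
  then have "lam * (\<Sum>i\<in>bidders. line_revenue (\<lambda>i v. (P i v + Q i v) / 2) i v) =
     (lam * (\<Sum>i\<in>bidders. line_revenue P i v) + lam * (\<Sum>i\<in>bidders. line_revenue Q i v)) / 2"
    by (simp only: sum.distrib sum_divide_distrib[symmetric] distrib_left times_divide_eq_right)
  then show "(1 - 1 / real m) * bench v \<le> lam * (\<Sum>i\<in>bidders. line_revenue (\<lambda>i v. (P i v + Q i v) / 2) i v)"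
    using almost_optimal_revenue[OF P v(1)] almost_optimal_revenue[OF Q v(1)] v(2) by simp
qed

text \<open>The cluster point provides monotonicity and revenue at every bid vector, but no
  measurability; almost everywhere convergence provides measurability, but says nothing on a null
  set. Both are taken for the same sequence \<open>Z\<close>, so they agree wherever
  \<open>Z\<close> converges.\<close>

lemma exists_optimal_cdf:
  obtains Q Z where
    "\<And>i v. i \<in> bidders \<Longrightarrow> v \<in> space \<nu> \<Longrightarrow> 0 \<le> Q i v \<and> Q i v \<le> 1"
    "\<And>i v x y. i \<in> bidders \<Longrightarrow> v \<in> space \<nu> \<Longrightarrow> 1 \<le> x \<Longrightarrow> x \<le> y \<Longrightarrow> Q i (v(i := x)) \<le> Q i (v(i := y))"
    "\<And>v. v \<in> space \<nu> \<Longrightarrow> bench v \<le> lam * (\<Sum>i\<in>bidders. line_revenue Q i v)"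
    "\<And>m i. i \<in> bidders \<Longrightarrow> Z m i \<in> borel_measurable \<nu>"
    "AE v in \<nu>. \<forall>i\<in>bidders. (\<lambda>m::nat. Z m i v) \<longlonglongrightarrow> Q i v"
proof -
  obtain Z where Z: "\<And>m. Z m \<in> {Q. almost_optimal (Suc m) Q}"
    and conv: "AE v in \<nu>. \<forall>i\<in>bidders. convergent (\<lambda>m. Z m i v)"
  proof (rule ae_convergent_selection[of \<nu> bidders "\<lambda>m. {Q. almost_optimal (Suc m) Q}"])
    show "{Q. almost_optimal (Suc m) Q} \<noteq> {}" for m using exists_almost_optimal[of "Suc m"] by auto
    show "{Q. almost_optimal (Suc (Suc m)) Q} \<subseteq> {Q. almost_optimal (Suc m) Q}" for m
      using almost_optimal_Suc[of "Suc m"] by auto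
  qed (use prob_space_bids_measure almost_optimal_midpoint almost_optimalD(1,2) in auto)
  have Z: "almost_optimal (Suc m) (Z m)" for m using Z by simp
  \<comment> \<open>The Boolean selects the distribution function or its integral up to
    \<open>v i\<close>. The integral gets a coordinate of its own, since at a cluster point it need
    not be the integral of the limit.\<close>
  define T where "T m = (\<lambda>(i, v, b). if i \<in> bidders \<and> v \<in> space \<nu> then
     (if b then Z m i v else integral {1..v i} (\<lambda>z. Z m i (v(i := z)))) else 0)" for m
  have bound: "0 \<le> T m z \<and> T m z \<le> (case z of (i, v, b) \<Rightarrow> max 1 (v i))" for m z
  proof (cases z)
    case (fields i v b)
    show ?thesis
    proof (cases "i \<in> bidders \<and> v \<in> space \<nu>")
      case True
      then have i: "i \<in> bidders" and v: "v \<in> space \<nu>" by auto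
      have v1: "1 \<le> v i" using v i by (auto simp: space_bids_measure PiE_iff)
      have int: "(\<lambda>z. Z m i (v(i := z))) integrable_on {1..v i}"
        using almost_optimal_mono_on[OF Z i v] by (auto intro: integrable_on_mono_on)
      have b01: "0 \<le> Z m i (v(i := z)) \<and> Z m i (v(i := z)) \<le> 1" if "1 \<le> z" for z
        using almost_optimalD(2)[OF Z i upd_space[OF v i that]] .
      have "0 \<le> integral {1..v i} (\<lambda>z. Z m i (v(i := z)))"
        using int b01 by (intro Henstock_Kurzweil_Integration.integral_nonneg) auto
      moreover have "integral {1..v i} (\<lambda>z. Z m i (v(i := z))) \<le> integral {1..v i} (\<lambda>z. 1)"
        using int b01 by (intro integral_le) auto
      ultimately show ?thesis
        using True v1 almost_optimalD(2)[OF Z i v, of m] by (auto simp: T_def fields le_max_iff_disj)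
    qed (auto simp: T_def fields)
  qed
  obtain X where X: "\<And>h c. continuous_on UNIV h \<Longrightarrow> \<forall>\<^sub>F m in sequentially. c \<le> h (T m) \<Longrightarrow> c \<le> (h X :: real)"
    using bounded_sequence_cluster_point[of T, OF bound] by blast
  define Q where "Q i v = X (i, v, True)" for i v
  define A where "A i v = X (i, v, False)" for i v
  note cont = continuous_on_product_coordinates continuous_on_add continuous_on_diff continuous_on_mult
     continuous_on_const continuous_on_minus continuous_on_sum
  have ge0: "0 \<le> X z" for z
    by (rule X[of "\<lambda>x. x z" 0]) (use bound in \<open>auto intro!: cont\<close>)
  have Q1: "Q i v \<le> 1" if "i \<in> bidders" "v \<in> space \<nu>" for i v
  proof -
    have "- 1 \<le> - X (i, v, True)"
      by (rule X[of "\<lambda>x. - x (i, v, True)" "- 1"])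
         (use that almost_optimalD(2)[OF Z] in \<open>auto intro!: cont simp: T_def\<close>)
    then show ?thesis by (simp add: Q_def)
  qed
  have Qmono: "Q i (v(i := x)) \<le> Q i (v(i := y))"
    if "i \<in> bidders" "v \<in> space \<nu>" "1 \<le> x" "x \<le> y" for i v x y
  proof -
    have "0 \<le> X (i, v(i := y), True) - X (i, v(i := x), True)"
      by (rule X[of "\<lambda>f. f (i, v(i := y), True) - f (i, v(i := x), True)" 0])
         (use that almost_optimalD(3)[OF Z] upd_space in \<open>auto intro!: cont simp: T_def\<close>)
    then show ?thesis by (simp add: Q_def)
  qed
  have incr: "(y - x) * Q i (v(i := x)) \<le> A i (v(i := y)) - A i (v(i := x))"
    if i: "i \<in> bidders" and v: "v \<in> space \<nu>" and xy: "1 \<le> x" "x \<le> y" for i v x y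
  proof -
    have "0 \<le> X (i, v(i := y), False) - X (i, v(i := x), False) - (y - x) * X (i, v(i := x), True)"
    proof (rule X[of "\<lambda>f. f (i, v(i := y), False) - f (i, v(i := x), False) - (y - x) * f (i, v(i := x), True)" 0])
      have "(y - x) * Z m i (v(i := x)) \<le> integral {1..y} (\<lambda>z. Z m i (v(i := z))) - integral {1..x} (\<lambda>z. Z m i (v(i := z)))" for m
      proof -
        have int: "(\<lambda>z. Z m i (v(i := z))) integrable_on {1..y}" "(\<lambda>z. Z m i (v(i := z))) integrable_on {x..y}"
          using almost_optimal_mono_on[OF Z i v] xy by (auto intro: integrable_on_mono_on)
        have "integral {1..x} (\<lambda>z. Z m i (v(i := z))) + integral {x..y} (\<lambda>z. Z m i (v(i := z))) = integral {1..y} (\<lambda>z. Z m i (v(i := z)))"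
          using xy int by (intro Henstock_Kurzweil_Integration.integral_combine) auto
        moreover have "integral {x..y} (\<lambda>z. Z m i (v(i := x))) \<le> integral {x..y} (\<lambda>z. Z m i (v(i := z)))"
          using int almost_optimalD(3)[OF Z i v] xy by (intro integral_le) auto
        ultimately show ?thesis using xy by simp
      qed
      then show "\<forall>\<^sub>F m in sequentially. 0 \<le> T m (i, v(i := y), False) - T m (i, v(i := x), False) - (y - x) * T m (i, v(i := x), True)"
        using i v xy upd_space[OF v i] by (simp add: T_def)
    qed (intro cont)
    then show ?thesis by (simp add: Q_def A_def)
  qed
  have rev: "bench v \<le> lam * (\<Sum>i\<in>bidders. v i * Q i v - A i v)" if v: "v \<in> space \<nu>" for v
  proof (rule field_le_epsilon)
    fix e :: real assume e: "0 < e"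
    have bp: "0 < bench v" using bench_ge[of v] nd_pos by linarith
    have "bench v - e \<le> lam * (\<Sum>i\<in>bidders. v i * X (i, v, True) - X (i, v, False))"
    proof (rule X[of "\<lambda>f. lam * (\<Sum>i\<in>bidders. v i * f (i, v, True) - f (i, v, False))" "bench v - e"])
      define B where "B = Max (v ` bidders)"
      have B: "v i \<le> B" if "i \<in> bidders" for i using that by (auto simp: B_def)
      obtain k :: nat where k: "max B (bench v / e) < real k" using reals_Archimedean2 by blast
      have "\<forall>\<^sub>F m in sequentially. k \<le> m" by (rule eventually_ge_at_top)
      then show "\<forall>\<^sub>F m in sequentially. bench v - e \<le> lam * (\<Sum>i\<in>bidders. v i * T m (i, v, True) - T m (i, v, False))"
      proof eventually_elim
        case (elim m)
        have "bench v / e < real (Suc m)" using elim k by simp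
        then have "bench v / real (Suc m) \<le> e" using e by (simp add: field_simps del: of_nat_Suc)
        then have "bench v - e \<le> (1 - 1 / real (Suc m)) * bench v" by (simp add: algebra_simps del: of_nat_Suc)
        also have "\<dots> \<le> lam * (\<Sum>i\<in>bidders. line_revenue (Z m) i v)"
        proof (rule almost_optimal_revenue[OF Z v])
          fix i assume "i \<in> bidders"
          from B[OF this] show "v i < real (Suc m)" using elim k by simp
        qed
        also have "(\<Sum>i\<in>bidders. line_revenue (Z m) i v) = (\<Sum>i\<in>bidders. v i * T m (i, v, True) - T m (i, v, False))"
          using v by (intro sum.cong) (auto simp: T_def line_revenue_def)
        finally show ?case .
      qed
    qed (intro cont)
    then show "bench v \<le> lam * (\<Sum>i\<in>bidders. v i * Q i v - A i v) + e" by (simp add: Q_def A_def)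
  qed
  show ?thesis
  proof (rule that[of Q Z])
    show "0 \<le> Q i v \<and> Q i v \<le> 1" if "i \<in> bidders" "v \<in> space \<nu>" for i v
      using that Q1 ge0 by (simp add: Q_def)
    show "Z m i \<in> borel_measurable \<nu>" if "i \<in> bidders" for m i using almost_optimalD(1)[OF Z that] .
    show "bench v \<le> lam * (\<Sum>i\<in>bidders. line_revenue Q i v)" if v: "v \<in> space \<nu>" for v
    proof -
      have "v i * Q i v - A i v \<le> line_revenue Q i v" if i: "i \<in> bidders" for i
      proof -
        have v1: "1 \<le> v i" using v i by (auto simp: space_bids_measure PiE_iff)
        \<comment> \<open>The integral of \<open>Q\<close> is at most its substitute
          \<open>A\<close>, so revenue computed with \<open>A\<close> is a lower bound for the true
          one.\<close>
        have "integral {1..v i} (\<lambda>z. Q i (v(i := z))) \<le> A i (v(i := v i)) - A i (v(i := 1))"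
        proof (rule integral_le_of_lower_increments[of 1 "v i" "\<lambda>z. Q i (v(i := z))" "\<lambda>z. A i (v(i := z))", OF v1])
          show "mono_on {1..v i} (\<lambda>z. Q i (v(i := z)))"
            using Qmono[OF i v] by (auto simp: mono_on_def)
        qed (use incr[OF i v] in auto)
        moreover have "0 \<le> A i (v(i := 1))" using ge0 by (simp add: A_def)
        ultimately show ?thesis by (simp add: line_revenue_def)
      qed
      then have "lam * (\<Sum>i\<in>bidders. v i * Q i v - A i v) \<le> lam * (\<Sum>i\<in>bidders. line_revenue Q i v)"
        using lam_pos by (intro mult_left_mono sum_mono) auto
      then show ?thesis using rev[OF v] by simp
    qed
    from conv AE_space show "AE v in \<nu>. \<forall>i\<in>bidders. (\<lambda>m. Z m i v) \<longlonglongrightarrow> Q i v"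
    proof eventually_elim
      case (elim v)
      show ?case
      proof
        fix i assume i: "i \<in> bidders"
        then have "convergent (\<lambda>m. Z m i v)" using elim by blast
        then obtain l where l: "(\<lambda>m. Z m i v) \<longlonglongrightarrow> l" unfolding convergent_def by blast
        have T: "T m (i, v, True) = Z m i v" for m using i elim by (simp add: T_def)
        have "l = Q i v"
        proof (rule antisym; rule field_le_epsilon)
          fix e :: real assume e: "0 < e"
          have "\<forall>\<^sub>F m in sequentially. l - e < Z m i v" using e by (intro order_tendstoD(1)[OF l]) simp
          then have "l - e \<le> X (i, v, True)"
            by (intro X[of "\<lambda>f. f (i, v, True)" "l - e"] cont) (auto simp: T elim: eventually_mono)
          then show "l \<le> Q i v + e" by (simp add: Q_def)
          have "\<forall>\<^sub>F m in sequentially. Z m i v < l + e" using e by (intro order_tendstoD(2)[OF l]) simp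
          then have "- (l + e) \<le> - X (i, v, True)"
            by (intro X[of "\<lambda>f. - f (i, v, True)" "- (l + e)"] cont) (auto simp: T elim: eventually_mono)
          then show "Q i v \<le> l + e" by (simp add: Q_def)
        qed
        then show "(\<lambda>m. Z m i v) \<longlonglongrightarrow> Q i v" using l by simp
      qed
    qed
  qed (use Qmono in auto)
qed

end

section \<open>The optimal auction\<close>

definition unit_coins :: "real measure" where
  "unit_coins = restrict_space lborel {0..1}"

lemma space_unit_coins [simp]: "space unit_coins = {0..1}"
  by (simp add: unit_coins_def space_restrict_space)

lemma prob_space_unit_coins: "prob_space unit_coins"
  by standard (simp add: unit_coins_def emeasure_restrict_space space_restrict_space)

lemma measurable_unit_coins: "f \<in> borel_measurable borel \<Longrightarrow> f \<in> borel_measurable unit_coins"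
  unfolding unit_coins_def by (rule measurable_restrict_space1) simp

lemma emeasure_unit_coins_interval:
  assumes "0 \<le> a" "a \<le> b" "b \<le> 1"
  shows "(\<integral>\<^sup>+\<omega>. (if a < \<omega> \<and> \<omega> \<le> b then 1 else 0) \<partial>unit_coins) = ennreal (b - a)"
proof -
  have "(\<integral>\<^sup>+\<omega>. (if a < \<omega> \<and> \<omega> \<le> b then 1 else 0) \<partial>unit_coins) =
    (\<integral>\<^sup>+\<omega>. (if a < \<omega> \<and> \<omega> \<le> b then 1 else 0) * indicator {0..1} \<omega> \<partial>lborel)"
    unfolding unit_coins_def by (rule nn_integral_restrict_space) simp
  also have "\<dots> = (\<integral>\<^sup>+\<omega>. indicator {a<..b} \<omega> \<partial>lborel)"
    using assms by (intro nn_integral_cong) (auto simp: indicator_def)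
  finally show ?thesis using assms by simp
qed

text \<open>
  The quantile function of a distribution function \<open>q\<close> on \<open>[1,\<infinity>)\<close>, written as an integral
  so that joint measurability in all parameters of \<open>q\<close> is a case of Fubini's theorem.
\<close>
definition quantile_price :: "(real \<Rightarrow> real) \<Rightarrow> real \<Rightarrow> ennreal" where
  "quantile_price q \<omega> = 1 + (\<integral>\<^sup>+z. (if 1 \<le> z \<and> q z < \<omega> then 1 else 0) \<partial>lborel)"

lemma quantile_price_le:
  assumes x: "1 \<le> x" "\<omega> \<le> q x" and mono: "\<And>z. x \<le> z \<Longrightarrow> q x \<le> q z"
  shows "quantile_price q \<omega> \<le> ennreal x"
proof -
  have "(\<integral>\<^sup>+z. (if 1 \<le> z \<and> q z < \<omega> then 1 else 0) \<partial>lborel) \<le> (\<integral>\<^sup>+z. indicator {1..x} z \<partial>lborel)"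
  proof (rule nn_integral_mono)
    fix z
    have "\<not> q z < \<omega>" if "x < z" using mono[of z] x(2) that by simp
    then show "(if 1 \<le> z \<and> q z < \<omega> then 1 else 0) \<le> (indicator {1..x} z :: ennreal)"
      by (auto simp: indicator_def not_le)
  qed
  also have "\<dots> = ennreal (x - 1)" using x by simp
  finally have "quantile_price q \<omega> \<le> 1 + ennreal (x - 1)"
    unfolding quantile_price_def by (rule add_left_mono)
  also have "1 + ennreal (x - 1) = ennreal x"
    using x by (simp flip: ennreal_1 ennreal_plus)
  finally show ?thesis .
qed

lemma measurable_indicator_less:
  assumes [measurable]: "(F :: 'a \<Rightarrow> real) \<in> borel_measurable M" "(G :: 'a \<Rightarrow> real) \<in> borel_measurable M"
    "(H :: 'a \<Rightarrow> real) \<in> borel_measurable M"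
  shows "(\<lambda>y. if 1 \<le> F y \<and> G y < H y then 1 else 0 :: ennreal) \<in> borel_measurable M"
  by measurable

lemma measurable_below:
  fixes q :: "real \<Rightarrow> real"
  assumes q: "\<And>x y. 1 \<le> x \<Longrightarrow> x \<le> y \<Longrightarrow> q x \<le> (q y :: real)"
  shows "(\<lambda>(\<omega>, z). if 1 \<le> z \<and> q z < \<omega> then 1 else 0 :: ennreal) \<in> borel_measurable (borel \<Otimes>\<^sub>M borel)"
proof -
  have "mono (\<lambda>z. q (max 1 z))" by (intro monoI q) auto
  then have [measurable]: "(\<lambda>z. q (max 1 z)) \<in> borel_measurable borel" by (rule borel_measurable_mono)
  have "(\<lambda>(\<omega>, z). if 1 \<le> z \<and> q (max 1 z) < \<omega> then 1 else 0 :: ennreal) \<in> borel_measurable (borel \<Otimes>\<^sub>M borel)"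
    by measurable
  moreover have "(\<lambda>(\<omega>, z). if 1 \<le> z \<and> q (max 1 z) < \<omega> then 1 else 0 :: ennreal) = (\<lambda>(\<omega>, z). if 1 \<le> z \<and> q z < \<omega> then 1 else 0)"
    by (auto simp: fun_eq_iff)
  ultimately show ?thesis by simp
qed

lemma measurable_quantile_price:
  assumes q: "\<And>x y. 1 \<le> x \<Longrightarrow> x \<le> y \<Longrightarrow> q x \<le> (q y :: real)"
  shows "quantile_price q \<in> borel_measurable borel"
proof -
  have "(\<lambda>(\<omega>, z). if 1 \<le> z \<and> q z < \<omega> then 1 else 0 :: ennreal) \<in> borel_measurable (borel \<Otimes>\<^sub>M lborel)"
    using measurable_below[of q, OF q] by simp
  from lborel.borel_measurable_nn_integral[OF this]
  show ?thesis unfolding quantile_price_def[abs_def] by measurable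
qed

text \<open>For a coin \<omega> \<le> q x the price is 1 plus the length of the set where q is below
  \<omega>. By Fubini's theorem these coins earn q x plus the integral of q x - q z over [1,x]. If q
  is not continuous from the right at x, some coins above q x also lead to the price x, hence only
  an inequality.\<close>

lemma quantile_price_revenue:
  assumes q: "\<And>x y. 1 \<le> x \<Longrightarrow> x \<le> y \<Longrightarrow> q x \<le> (q y :: real)"
    and q01: "\<And>x. 1 \<le> x \<Longrightarrow> 0 \<le> q x \<and> q x \<le> 1" and x: "1 \<le> x"
  shows "ennreal (x * q x - integral {1..x} q) \<le> (\<integral>\<^sup>+\<omega>. posted_payment (quantile_price q \<omega>) x \<partial>unit_coins)"
proof -
  let ?b = "\<lambda>\<omega> z. (if 1 \<le> z \<and> q z < \<omega> then 1 else 0) :: ennreal"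
  let ?c = "\<lambda>\<omega>. (if \<omega> \<le> q x then 1 else 0) :: ennreal"
  interpret U: prob_space unit_coins by (rule prob_space_unit_coins)
  interpret UL: pair_sigma_finite unit_coins lborel by standard
  have id[measurable]: "(\<lambda>\<omega>. \<omega>) \<in> unit_coins \<rightarrow>\<^sub>M borel" by (rule measurable_unit_coins) simp
  have cm[measurable]: "?c \<in> borel_measurable unit_coins" by (rule measurable_unit_coins) measurable
  have below: "(\<lambda>(\<omega>, z). ?b \<omega> z) \<in> borel_measurable (unit_coins \<Otimes>\<^sub>M lborel)"
  proof -
    have "(\<lambda>(\<omega>, z). (\<omega>, z)) \<in> unit_coins \<Otimes>\<^sub>M lborel \<rightarrow>\<^sub>M borel \<Otimes>\<^sub>M (borel :: real measure)"
      by measurable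
    from measurable_compose[OF this measurable_below[of q, OF q]] show ?thesis
      by (simp add: case_prod_beta')
  qed
  have prod: "(\<lambda>(\<omega>, z). ?c \<omega> * ?b \<omega> z) \<in> borel_measurable (unit_coins \<Otimes>\<^sub>M lborel)"
    using below by measurable
  have bm: "?b \<omega> \<in> borel_measurable lborel" for \<omega>
  proof -
    have "Pair \<omega> \<in> lborel \<rightarrow>\<^sub>M borel \<Otimes>\<^sub>M (borel :: real measure)" by simp
    from measurable_compose[OF this measurable_below[of q, OF q]] show ?thesis
      unfolding case_prod_conv .
  qed
  have im: "(\<lambda>\<omega>. \<integral>\<^sup>+z. ?b \<omega> z \<partial>lborel) \<in> borel_measurable unit_coins"
    using lborel.borel_measurable_nn_integral[OF below] by simp
  have mono: "mono_on {1..x} q" using q by (auto simp: mono_on_def)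
  have int: "q integrable_on {1..x}" by (rule integrable_on_mono_on[OF mono])
  have qle: "q z \<le> q x" if "1 \<le> z \<and> z \<le> x" for z using q[of z x] that by simp
  have hi: "((\<lambda>z. q x - q z) has_integral ((x - 1) * q x - integral {1..x} q)) {1..x}"
  proof (rule has_integral_diff[OF _ integrable_integral[OF int]])
    show "((\<lambda>z. q x) has_integral (x - 1) * q x) {1..x}"
      using has_integral_const_real[of "q x" 1 x] x by simp
  qed
  have nonneg: "0 \<le> (x - 1) * q x - integral {1..x} q"
    by (rule has_integral_nonneg[OF hi]) (simp add: qle)
  have c_int: "(\<integral>\<^sup>+\<omega>. ?c \<omega> \<partial>unit_coins) = ennreal (q x)"
  proof -
    have "(\<integral>\<^sup>+\<omega>. ?c \<omega> \<partial>unit_coins) = (\<integral>\<^sup>+\<omega>. ?c \<omega> * indicator {0..1} \<omega> \<partial>lborel)"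
      unfolding unit_coins_def by (rule nn_integral_restrict_space) simp
    also have "\<dots> = (\<integral>\<^sup>+\<omega>. indicator {0..q x} \<omega> \<partial>lborel)"
      using q01[OF x] by (intro nn_integral_cong) (auto simp: indicator_def)
    finally show ?thesis using q01[OF x] by simp
  qed
  have "ennreal (x * q x - integral {1..x} q) = ennreal (q x) + ennreal ((x - 1) * q x - integral {1..x} q)"
    using q01[OF x] nonneg by (subst ennreal_plus[symmetric]) (auto simp: algebra_simps)
  also have "ennreal ((x - 1) * q x - integral {1..x} q) = (\<integral>\<^sup>+z. ennreal (q x - q z) * indicator {1..x} z \<partial>lborel)"
    by (rule nn_integral_has_integral_lebesgue'[OF _ hi, symmetric]) (simp add: qle)
  also have "\<dots> \<le> (\<integral>\<^sup>+z. \<integral>\<^sup>+\<omega>. ?c \<omega> * ?b \<omega> z \<partial>unit_coins \<partial>lborel)"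
  proof (rule nn_integral_mono)
    fix z
    show "ennreal (q x - q z) * indicator {1..x} z \<le> (\<integral>\<^sup>+\<omega>. ?c \<omega> * ?b \<omega> z \<partial>unit_coins)"
    proof (cases "z \<in> {1..x}")
      case True
      then have "(\<integral>\<^sup>+\<omega>. (if q z < \<omega> \<and> \<omega> \<le> q x then 1 else 0) \<partial>unit_coins) = ennreal (q x - q z)"
        using qle[of z] q01[of z] q01[of x] by (intro emeasure_unit_coins_interval) auto
      moreover have "(\<integral>\<^sup>+\<omega>. ?c \<omega> * ?b \<omega> z \<partial>unit_coins) = (\<integral>\<^sup>+\<omega>. (if q z < \<omega> \<and> \<omega> \<le> q x then 1 else 0) \<partial>unit_coins)"
        using True by (intro nn_integral_cong) auto
      ultimately show ?thesis using True by simp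
    qed simp
  qed
  also have "(\<integral>\<^sup>+z. \<integral>\<^sup>+\<omega>. ?c \<omega> * ?b \<omega> z \<partial>unit_coins \<partial>lborel) = (\<integral>\<^sup>+\<omega>. \<integral>\<^sup>+z. ?c \<omega> * ?b \<omega> z \<partial>lborel \<partial>unit_coins)"
    by (rule UL.Fubini'[OF prod])
  also have "\<dots> = (\<integral>\<^sup>+\<omega>. ?c \<omega> * (\<integral>\<^sup>+z. ?b \<omega> z \<partial>lborel) \<partial>unit_coins)"
    by (intro nn_integral_cong nn_integral_cmult bm)
  also have "ennreal (q x) + \<dots> = (\<integral>\<^sup>+\<omega>. ?c \<omega> \<partial>unit_coins) + (\<integral>\<^sup>+\<omega>. ?c \<omega> * (\<integral>\<^sup>+z. ?b \<omega> z \<partial>lborel) \<partial>unit_coins)"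
    unfolding c_int ..
  also have "\<dots> = (\<integral>\<^sup>+\<omega>. ?c \<omega> + ?c \<omega> * (\<integral>\<^sup>+z. ?b \<omega> z \<partial>lborel) \<partial>unit_coins)"
    by (rule nn_integral_add[symmetric]) (intro cm borel_measurable_times_ennreal im)+
  also have "\<dots> \<le> (\<integral>\<^sup>+\<omega>. posted_payment (quantile_price q \<omega>) x \<partial>unit_coins)"
  proof (rule nn_integral_mono)
    fix \<omega>
    have "quantile_price q \<omega> \<le> ennreal x" if "\<omega> \<le> q x"
      by (rule quantile_price_le[where q = q]) (rule x that q[OF x]; assumption)+
    then show "?c \<omega> + ?c \<omega> * (\<integral>\<^sup>+z. ?b \<omega> z \<partial>lborel) \<le> posted_payment (quantile_price q \<omega>) x"
      by (auto simp: posted_payment_def) (simp add: quantile_price_def)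
  qed
  finally show ?thesis by (simp add: add_left_mono)
qed

lemma measurable_completion_AE_eq:
  assumes h: "h \<in> borel_measurable M" and N: "N \<in> null_sets M"
    and eq: "\<And>x. x \<in> space M \<Longrightarrow> x \<notin> N \<Longrightarrow> f x = h x"
  shows "f \<in> borel_measurable (completion M)"
proof (rule measurableI)
  fix B assume B: "B \<in> sets (borel :: 'b measure)"
  have "f -` B \<inter> space M = (h -` B \<inter> space M - N) \<union> (f -` B \<inter> space M \<inter> N)"
    using eq by auto
  moreover have "h -` B \<inter> space M - N \<in> sets (completion M)"
    using measurable_sets[OF h B] N by (intro sets_completionI_sets) auto
  moreover have "f -` B \<inter> space M \<inter> N \<in> sets (completion M)"
    by (rule sets_completionI_sub[OF N]) auto
  ultimately have "f -` B \<inter> space M \<in> sets (completion M)" using sets.Un by metis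
  then show "f -` B \<inter> space (completion M) \<in> sets (completion M)" by simp
qed auto

text \<open>Fubini's theorem for null sets, applied to a measurable null set that contains all
  exceptions.\<close>

lemma AE_bid_space_insert:
  assumes I: "finite I" "i \<in> I" and ae: "AE v in PiM I (\<lambda>_. bid_space). P v"
  shows "AE w in PiM (I - {i}) (\<lambda>_. bid_space). AE z in bid_space. P (w(i := z))"
proof -
  interpret B: sigma_finite_measure bid_space by (rule sigma_finite_bid_space)
  interpret product_sigma_finite "\<lambda>_. bid_space" by standard
  define J where "J = I - {i}"
  have J: "I = insert i J" "finite J" "i \<notin> J" using I by (auto simp: J_def)
  interpret PJ: sigma_finite_measure "PiM J (\<lambda>_. bid_space)" by (rule sigma_finite) (rule J(2))
  from ae obtain N where N: "N \<in> sets (PiM I (\<lambda>_. bid_space))" "emeasure (PiM I (\<lambda>_. bid_space)) N = 0"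
    "{v \<in> space (PiM I (\<lambda>_. bid_space)). \<not> P v} \<subseteq> N"
    unfolding eventually_ae_filter by auto
  have Nm: "indicator N \<in> borel_measurable (PiM (insert i J) (\<lambda>_. bid_space) :: _ measure)"
    using N(1) J(1) by (intro borel_measurable_indicator) simp
  have upd: "(\<lambda>(w, z). w(i := z)) \<in> PiM J (\<lambda>_. bid_space) \<Otimes>\<^sub>M bid_space \<rightarrow>\<^sub>M PiM (insert i J) (\<lambda>_. bid_space)"
    by (rule measurable_add_dim)
  have m2: "(\<lambda>(w, z). indicator N (w(i := z)) :: ennreal) \<in> borel_measurable (PiM J (\<lambda>_. bid_space) \<Otimes>\<^sub>M bid_space)"
    using measurable_compose[OF upd Nm] by (simp add: case_prod_beta')
  have "(\<integral>\<^sup>+w. \<integral>\<^sup>+z. indicator N (w(i := z)) \<partial>bid_space \<partial>PiM J (\<lambda>_. bid_space)) = (\<integral>\<^sup>+v. indicator N v \<partial>PiM (insert i J) (\<lambda>_. bid_space))"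
    by (rule product_nn_integral_insert[symmetric]) (use J Nm in auto)
  also have "\<dots> = 0" using N(1,2) J(1) by simp
  finally have "AE w in PiM J (\<lambda>_. bid_space). (\<integral>\<^sup>+z. indicator N (w(i := z)) \<partial>bid_space) = 0"
    using B.borel_measurable_nn_integral[OF m2] by (subst (asm) nn_integral_0_iff_AE) auto
  with AE_space have "AE w in PiM J (\<lambda>_. bid_space). AE z in bid_space. P (w(i := z))"
  proof eventually_elim
    case (elim w)
    have "(\<lambda>z. indicator N (w(i := z)) :: ennreal) \<in> borel_measurable bid_space"
      using measurable_compose[OF measurable_Pair1'[OF elim(1)] m2] by simp
    then have "AE z in bid_space. (indicator N (w(i := z)) :: ennreal) = 0"
      using elim(2) by (subst (asm) nn_integral_0_iff_AE) auto
    with AE_space show ?case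
    proof eventually_elim
      case (elim z)
      have "w(i := z) \<in> space (PiM I (\<lambda>_. bid_space))"
        using \<open>w \<in> space (PiM J (\<lambda>_. bid_space))\<close> elim(1) unfolding J(1)
        by (auto simp: space_PiM PiE_iff extensional_def)
      then show ?case using elim(2) N(3) by (auto simp: indicator_def split: if_splits)
    qed
  qed
  then show ?thesis unfolding J_def .
qed

text \<open>One uniform coin serves all bidders, since the revenue depends only on the expectation
  of each single payment. The price is an integral over z, so changing \<open>Q\<close> on a null
  set of z leaves it unaltered: for almost all bids of the others it equals the price
  \<open>h\<close> computed from the measurable limit \<open>l\<close> of the sequence
  \<open>Z\<close>.\<close>

lemma (in price_benchmark) optimal_auction_exists:
  "\<exists>(M :: real measure) g. truthful_auction n M g \<and>
     (\<forall>v\<in>bid_vectors n. bench v \<le> lam * expected_revenue n M g v)"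
proof -
  obtain Q Z where Q01: "\<And>i v. i \<in> bidders \<Longrightarrow> v \<in> space \<nu> \<Longrightarrow> 0 \<le> Q i v \<and> Q i v \<le> 1"
    and Qmono: "\<And>i v x y. i \<in> bidders \<Longrightarrow> v \<in> space \<nu> \<Longrightarrow> 1 \<le> x \<Longrightarrow> x \<le> y \<Longrightarrow> Q i (v(i := x)) \<le> Q i (v(i := y))"
    and Qrev: "\<And>v. v \<in> space \<nu> \<Longrightarrow> bench v \<le> lam * (\<Sum>i\<in>bidders. line_revenue Q i v)"
    and Zm: "\<And>m i. i \<in> bidders \<Longrightarrow> Z m i \<in> borel_measurable \<nu>"
    and conv: "AE v in \<nu>. \<forall>i\<in>bidders. (\<lambda>m::nat. Z m i v) \<longlonglongrightarrow> Q i v"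
    using exists_optimal_cdf by blast
  define g where "g i \<omega> w = quantile_price (\<lambda>z. Q i (w(i := z))) \<omega>" for i \<omega> w
  have others_upd: "(others n i v)(i := z) = v(i := z)" if "v \<in> space \<nu>" for i v z
    using that by (auto simp: others_def fun_eq_iff space_bids_measure PiE_iff extensional_def)
  have g_others: "g i \<omega> (others n i v) = quantile_price (\<lambda>z. Q i (v(i := z))) \<omega>" if "v \<in> space \<nu>" for i \<omega> v
    unfolding g_def others_upd[OF that] ..
  interpret U: prob_space unit_coins by (rule prob_space_unit_coins)
  have truthful: "truthful_auction n unit_coins g"
    unfolding truthful_auction_def
  proof (intro conjI ballI)
    show "prob_space unit_coins" by (rule prob_space_unit_coins)
    fix i assume i: "i \<in> {1..n}"
    fix v assume "v \<in> bid_vectors n"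
    then have v: "v \<in> space \<nu>" by (simp add: bid_vectors_eq_space)
    show "(\<lambda>\<omega>. g i \<omega> (others n i v)) \<in> borel_measurable unit_coins"
      unfolding g_others[OF v] using Qmono[OF i v] by (intro measurable_unit_coins measurable_quantile_price) auto
  next
    fix i assume i: "i \<in> {1..n}"
    let ?O = "others_measure n i"
    interpret O: sigma_finite_measure ?O by (rule sigma_finite_others_measure)
    interpret UO: pair_sigma_finite unit_coins ?O by standard
    define l where "l v = lim (\<lambda>m. Z m i v)" for v
    have lm: "l \<in> borel_measurable \<nu>"
      unfolding l_def[abs_def] using Zm[OF i] by (intro borel_measurable_lim_metric) auto
    \<comment> \<open>\<open>max 1 z\<close> keeps the argument of \<open>l\<close> a bid vector;
      the condition \<open>1 \<le> z\<close> in \<open>quantile_price\<close> hides the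
      change.\<close>
    define h where "h = (\<lambda>(\<omega>, w). quantile_price (\<lambda>z. l (w(i := max 1 z))) \<omega>)"
    have max: "max 1 \<in> borel \<rightarrow>\<^sub>M bid_space"
      unfolding bid_space_def by (rule measurable_restrict_space2) auto
    have upd: "(\<lambda>(w, z). w(i := z)) \<in> ?O \<Otimes>\<^sub>M bid_space \<rightarrow>\<^sub>M PiM (insert i ({1..n} - {i})) (\<lambda>_. bid_space)"
      unfolding others_measure_eq by (rule measurable_add_dim)
    have sets_ins: "sets (PiM (insert i ({1..n} - {i})) (\<lambda>_. bid_space)) = sets \<nu>"
      using i by (simp add: sets_bids_measure insert_absorb)
    let ?P = "(unit_coins \<Otimes>\<^sub>M ?O) \<Otimes>\<^sub>M (lborel :: real measure)"
    have lw: "(\<lambda>y. l ((snd (fst y))(i := max 1 (snd y)))) \<in> borel_measurable ?P"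
    proof -
      have "(\<lambda>y. (snd (fst y), max 1 (snd y))) \<in> ?P \<rightarrow>\<^sub>M ?O \<Otimes>\<^sub>M bid_space"
        by (intro measurable_Pair measurable_compose[OF measurable_fst measurable_snd] measurable_compose[OF measurable_snd])
           (use max in \<open>simp cong: measurable_cong_sets\<close>)
      from measurable_compose[OF this upd]
      have "(\<lambda>y. (snd (fst y))(i := max 1 (snd y))) \<in> ?P \<rightarrow>\<^sub>M \<nu>"
        using sets_ins by (simp cong: measurable_cong_sets)
      from measurable_compose[OF this lm] show ?thesis .
    qed
    have om: "(\<lambda>y. fst (fst y)) \<in> borel_measurable ?P"
      by (intro measurable_compose[OF measurable_fst] measurable_compose[OF measurable_fst measurable_unit_coins]) simp_all
    have zm: "(\<lambda>y. snd y) \<in> borel_measurable ?P"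
      by measurable
    have "(\<lambda>(p, z). if 1 \<le> z \<and> l ((snd p)(i := max 1 z)) < fst p then 1 else 0 :: ennreal) \<in> borel_measurable ?P"
      using measurable_indicator_less[OF zm lw om] by (simp only: case_prod_beta')
    from lborel.borel_measurable_nn_integral[OF this]
    have hm: "h \<in> borel_measurable (unit_coins \<Otimes>\<^sub>M ?O)"
      unfolding h_def quantile_price_def case_prod_beta' by measurable
    have "AE v in PiM {1..n} (\<lambda>_. bid_space). \<forall>i\<in>bidders. (\<lambda>m. Z m i v) \<longlonglongrightarrow> Q i v"
      using conv by (simp add: AE_bids_measure_iff)
    then have "AE v in PiM {1..n} (\<lambda>_. bid_space). l v = Q i v"
      using i by (auto simp: l_def elim!: eventually_mono intro: limI)
    from AE_bid_space_insert[OF _ i this]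
    have "AE w in ?O. AE z in bid_space. l (w(i := z)) = Q i (w(i := z))"
      unfolding others_measure_eq by simp
    then obtain N where N: "N \<in> sets ?O" "emeasure ?O N = 0"
      "{w \<in> space ?O. \<not> (AE z in bid_space. l (w(i := z)) = Q i (w(i := z)))} \<subseteq> N"
      unfolding eventually_ae_filter by auto
    have null: "space unit_coins \<times> N \<in> null_sets (unit_coins \<Otimes>\<^sub>M ?O)"
    proof (rule null_setsI)
      show "space unit_coins \<times> N \<in> sets (unit_coins \<Otimes>\<^sub>M ?O)" by (rule pair_measureI[OF sets.top N(1)])
      show "emeasure (unit_coins \<Otimes>\<^sub>M ?O) (space unit_coins \<times> N) = 0"
        using O.emeasure_pair_measure_Times[OF sets.top N(1), of unit_coins] N(2) by simp
    qed
    show "(\<lambda>(\<omega>, w). g i \<omega> w) \<in> borel_measurable (completion (unit_coins \<Otimes>\<^sub>M ?O))"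
    proof (rule measurable_completion_AE_eq[OF hm null])
      fix p assume p: "p \<in> space (unit_coins \<Otimes>\<^sub>M ?O)" "p \<notin> space unit_coins \<times> N"
      obtain \<omega> w where pp: "p = (\<omega>, w)" by (cases p)
      have "w \<in> space ?O" "w \<notin> N" using p by (auto simp: pp space_pair_measure)
      then have "AE z in bid_space. l (w(i := z)) = Q i (w(i := z))" using N(3) by blast
      then have "AE z in lborel. z \<in> {1..} \<longrightarrow> l (w(i := z)) = Q i (w(i := z))"
        unfolding bid_space_def by (subst (asm) AE_restrict_space_iff) auto
      then have "(\<integral>\<^sup>+z. (if 1 \<le> z \<and> Q i (w(i := z)) < \<omega> then 1 else 0 :: ennreal) \<partial>lborel) =
        (\<integral>\<^sup>+z. (if 1 \<le> z \<and> l (w(i := max 1 z)) < \<omega> then 1 else 0) \<partial>lborel)"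
        by (intro nn_integral_cong_AE) (auto elim!: eventually_mono simp: max_def)
      then show "(case p of (\<omega>, w) \<Rightarrow> g i \<omega> w) = h p"
        by (simp add: pp g_def h_def quantile_price_def)
    qed
  qed
  have "bench v \<le> lam * expected_revenue n unit_coins g v" if vb: "v \<in> bid_vectors n" for v
  proof -
    have v: "v \<in> space \<nu>" using vb by (simp add: bid_vectors_eq_space)
    have line: "ennreal (line_revenue Q i v) \<le> (\<integral>\<^sup>+\<omega>. posted_payment (g i \<omega> (others n i v)) (v i) \<partial>unit_coins)"
      "0 \<le> line_revenue Q i v" if i: "i \<in> bidders" for i
    proof -
      have v1: "1 \<le> v i" using v i by (auto simp: space_bids_measure PiE_iff)
      let ?q = "\<lambda>z. Q i (v(i := z))"
      have q01: "0 \<le> ?q x \<and> ?q x \<le> 1" if "1 \<le> x" for x using Q01[OF i upd_space[OF v i that]] .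
      have "ennreal (v i * ?q (v i) - integral {1..v i} ?q) \<le> (\<integral>\<^sup>+\<omega>. posted_payment (quantile_price ?q \<omega>) (v i) \<partial>unit_coins)"
        using Qmono[OF i v] q01 v1 by (intro quantile_price_revenue) auto
      then show "ennreal (line_revenue Q i v) \<le> (\<integral>\<^sup>+\<omega>. posted_payment (g i \<omega> (others n i v)) (v i) \<partial>unit_coins)"
        unfolding g_others[OF v] line_revenue_def by simp
      have "integral {1..v i} ?q \<le> integral {1..v i} (\<lambda>_. ?q (v i))"
      proof (rule integral_le)
        show "?q integrable_on {1..v i}"
          using Qmono[OF i v] by (intro integrable_on_mono_on) (auto simp: mono_on_def)
        show "?q x \<le> ?q (v i)" if "x \<in> {1..v i}" for x
          by (rule Qmono[OF i v]) (use that in auto)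
      qed (rule integrable_const_ivl)
      then show "0 \<le> line_revenue Q i v"
        using v1 q01[of "v i"] by (simp add: line_revenue_def algebra_simps)
    qed
    have rev_nonneg: "0 \<le> expected_revenue n unit_coins g v"
      unfolding expected_revenue_def revenue_def
      by (intro integral_nonneg_AE AE_I2 sum_nonneg) (simp add: payment_def)
    have "ennreal (\<Sum>i\<in>bidders. line_revenue Q i v) = (\<Sum>i\<in>bidders. ennreal (line_revenue Q i v))"
      using line(2) by (intro sum_ennreal[symmetric]) auto
    also have "\<dots> \<le> ennreal (expected_revenue n unit_coins g v)"
      unfolding ennreal_expected_revenue[OF truthful vb] by (intro sum_mono line(1))
    finally have "(\<Sum>i\<in>bidders. line_revenue Q i v) \<le> expected_revenue n unit_coins g v"
      using rev_nonneg by (simp add: ennreal_le_iff)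
    then have "lam * (\<Sum>i\<in>bidders. line_revenue Q i v) \<le> lam * expected_revenue n unit_coins g v"
      using lam_pos by (intro mult_left_mono) auto
    then show ?thesis using Qrev[OF v] by simp
  qed
  then show ?thesis using truthful by blast
qed

lemma (in price_benchmark) optimal_ratio:
  assumes f: "\<And>v. v \<in> bid_vectors n \<Longrightarrow> f v = bench v"
  shows "(\<exists>(M :: real measure) g. truthful_auction n M g \<and> has_competitive_ratio n M g f lam) \<and>
    (\<forall>(M :: 'c measure) g r. truthful_auction n M g \<longrightarrow> has_competitive_ratio n M g f r \<longrightarrow> lam \<le> r)"
proof (intro conjI allI impI)
  show "\<exists>(M :: real measure) g. truthful_auction n M g \<and> has_competitive_ratio n M g f lam"
    using optimal_auction_exists f by (auto simp: has_competitive_ratio_def)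
next
  fix M :: "'c measure" and g r
  assume "truthful_auction n M g" "has_competitive_ratio n M g f r"
  then show "lam \<le> r"
    using f by (intro competitive_ratio_ge[of M g r]) (auto simp: has_competitive_ratio_def)
qed

theorem theorem2:
  fixes n :: nat
  assumes "n \<ge> 2"
  shows
    "((\<exists>(M :: real measure) g. truthful_auction n M g \<and>
          has_competitive_ratio n M g (benchmark_F2 n) (lambda_ratio n)) \<and>
      (\<forall>(M :: 'c measure) g r. truthful_auction n M g \<longrightarrow>
          has_competitive_ratio n M g (benchmark_F2 n) r \<longrightarrow> lambda_ratio n \<le> r)) \<and>
     ((\<exists>(M :: real measure) g. truthful_auction n M g \<and>
          has_competitive_ratio n M g (benchmark_maxV n) (gamma_ratio n)) \<and>
      (\<forall>(M :: 'c measure) g r. truthful_auction n M g \<longrightarrow>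
          has_competitive_ratio n M g (benchmark_maxV n) r \<longrightarrow> gamma_ratio n \<le> r))"
proof -
  interpret F2: price_benchmark n 0 F2_coeff "lambda_ratio n" by (rule price_benchmark_F2[OF assms])
  interpret V: price_benchmark n 1 maxV_coeff "gamma_ratio n" by (rule price_benchmark_maxV[OF assms])
  show ?thesis
    by (intro conjI[OF F2.optimal_ratio V.optimal_ratio])
       (simp_all add: assms benchmark_F2_eq benchmark_maxV_eq)
qed

end
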